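(* Let $G$ be a mixed graph on $n$ vertices in which each mixed component has either the AP property or the AC property. Let $F_1,\dots,F_q$ be the mixed components of $G$ having the AP property, and let $H_1,\dots,H_l$ be the mixed components of $G$ having the AC property for which $t(H_i)$ is even. Let $p(G)$ be the number of mixed components of $G$ having the AC property, and let $N_l=\{1,2,\dots,l\}$. (All mixed components are counted as members of the multiset $\mathcal{S}(G)$.) Then $$\det\mathcal{I}(G)=2^{p(G)}(-1)^{2n-p(G)-\sum_{i=1}^{q}\frac{t(F_i)+1}{2}}\times\sum_{S\subseteq N_l}(-1)^{|S|-\sum_{i\in S}\frac{t(H_i)}{2}}$$ if $t(F_i)$ is odd for all $i=1,\dots,q$, and $\det\mathcal{I}(G)=0$ otherwise.
   Context: A mixed graph $G$ has a finite nonempty vertex set $V_G=\{v_1,\dots,v_n\}$, a finite set $E_G$ of (undirected) edges, each joining an unordered pair of vertices $\{u,v\}$ (a loop if $u=v$), and a finite set $\vec E_G$ of arcs, each going from $u$ to $v$ for an ordered pair $(u,v)$ of vertices (a directed loop if $u=v$); multiple edges, loops, arcs and directed loops are allowed. The integrated adjacency matrix $\mathcal{I}(G)$ is the real symmetric $2n\times 2n$ matrix $\begin{bmatrix}A&D\\ D^T&A\end{bmatrix}$, where $A_{ij}$ ($i\neq j$) is the number of edges joining $v_i$ and $v_j$, $A_{ii}$ is twice the number of loops at $v_i$, and $D_{ij}$ is the number of arcs from $v_i$ to $v_j$. The out-degree (in-degree) of $u$ is the number of arcs starting (ending) at $u$. A submixed graph of $G$ is given by subsets of the vertices, edges and arcs,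 with the restricted incidences. The undirected part $G_u$ is the graph with vertex set $V_G$ and edge set $E_G$ (no arcs). A mixed graph is called a graph if it has no arcs; components are connected components (for mixed graphs, ignoring directions of arcs). A walk in $G$ is a sequence $u_1,e_1,u_2,\dots,e_k,u_{k+1}$ where each $e_j$ is an edge joining $u_j,u_{j+1}$, or an arc from $u_j$ to $u_{j+1}$ (traversed forward), or an arc from $u_{j+1}$ to $u_j$ (traversed backward); a directed loop may be regarded as traversed in either direction. It is closed if $u_1=u_{k+1}$. An alternating walk is a walk containing at least one arc in which, starting from the first arc, successive arcs alternate between forward and backward direction. Numbers of arcs in a walk are counted with repetition. Mixed components. A submixed graph $G'$ of $G$ with at least one arc is a special submixed graph of $G$ if: any two distinct vertices of $G'$ are joined by an alternating walk in $G'$; and if a component $H$ of $G'_u$ has at least one vertex at which some arc of $G'$ ends and at least one vertex at which some arc of $G'$ starts, then for each vertex $v$ of $H$ there is a closed alternating walk in $G'$ starting and ending at $v$ and containing an odd number of arcs. A submixed graph $G'$ of $G$ is a mixed component of $G$ if it is one of: Type I: a component of $G_u$ each of whose vertices has out-degree zero in $G$; Type II: a component of $G_u$ each of whose vertices has in-degree zero in $G$; Type III: a maximal special submixed graph of $G$. $\mathcal{S}(G)$ is the multiset of all mixed components, where a component of $G$ with no arcs is taken twice (once as Type I and once as Type II). An alternating path is an alternating walk $W$ such that: (i) each vertex occurs at most twice in $W$; (ii) if a vertex occurs twice, the number of arcs between its two occurrences is odd; (iii) each edge occurs at most twice; (iv) if an edge occurs twice, the number of arcs between its two occurrences is odd;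 (v) each arc of $W$ occurs exactly once. An alternating cycle is an alternating walk $W$ such that: its starting and ending vertices are the same; it satisfies (iii)-(v); its vertices other than the starting (= ending) vertex satisfy (i) and (ii); the starting vertex occurs at most thrice; and if the starting vertex occurs thrice, the number of arcs between its successive occurrences is odd. For a mixed component $H$ of $G$: $\Theta_H$ is the set of $v\in V_H$ such that some alternating path in $H$ contains $v$ twice; $\Omega_H$ is the set of $e\in E_H$ such that some alternating path in $H$ contains $e$ twice; $t(H)=|E_H|+|\Omega_H|+|\vec E_H|$. $H$ has the AP property if $H$ is a path (undirected path graph, consisting of edges only, possibly a single vertex), or $H$ has an alternating path which contains each vertex $v$ of $H$ exactly twice if $v\in\Theta_H$ and exactly once otherwise, all arcs of $H$, and each edge $e$ of $H$ exactly twice if $e\in\Omega_H$ and exactly once otherwise. $H$ has the AC property if $H$ is a cycle (undirected cycle graph, consisting of edges only), or $H$ has an alternating cycle with an even number of arcs, with starting vertex $u$, which contains $u$ thrice if $u\in\Theta_H$ and twice otherwise, each vertex $v\ne u$ of $H$ exactly twice if $v\in\Theta_H$ and exactly once otherwise, all arcs of $H$, and each edge $e$ of $H$ exactly twice if $e\in\Omega_H$ and exactly once otherwise. *)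

theory Defs
  imports "Jordan_Normal_Form.Determinant" "HOL-Library.Multiset"
begin

(* uends e is the set of end vertices of the edge e: a singleton exactly when e is a loop. *)
record ('v, 'e, 'a) mixed_graph =
  verts :: "'v set"
  edges :: "'e set"
  arcs :: "'a set"
  uends :: "'e \<Rightarrow> 'v set"
  tail :: "'a \<Rightarrow> 'v"
  head :: "'a \<Rightarrow> 'v"

definition mixed_graph :: "('v, 'e, 'a) mixed_graph \<Rightarrow> bool" where
  "mixed_graph G \<longleftrightarrow>
     finite (verts G) \<and> verts G \<noteq> {} \<and> finite (edges G) \<and> finite (arcs G) \<and>
     (\<forall>e\<in>edges G. \<exists>u\<in>verts G. \<exists>v\<in>verts G. uends G e = {u, v}) \<and>
     (\<forall>a\<in>arcs G. tail G a \<in> verts G \<and> head G a \<in> verts G)"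

definition out_degree :: "('v, 'e, 'a) mixed_graph \<Rightarrow> 'v \<Rightarrow> nat" where
  "out_degree G u = card {a \<in> arcs G. tail G a = u}"

definition in_degree :: "('v, 'e, 'a) mixed_graph \<Rightarrow> 'v \<Rightarrow> nat" where
  "in_degree G u = card {a \<in> arcs G. head G a = u}"

(* The incidence functions are total and shared with G, so a submixed graph is determined
   by its vertex, edge and arc sets, and equality of records is equality of submixed graphs. *)
definition submixed :: "('v, 'e, 'a) mixed_graph \<Rightarrow> ('v, 'e, 'a) mixed_graph \<Rightarrow> bool" where
  "submixed H G \<longleftrightarrow>
     mixed_graph H \<and>
     verts H \<subseteq> verts G \<and> edges H \<subseteq> edges G \<and> arcs H \<subseteq> arcs G \<and>
     uends H = uends G \<and> tail H = tail G \<and> head H = head G"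

definition undirected_part :: "('v, 'e, 'a) mixed_graph \<Rightarrow> ('v, 'e, 'a) mixed_graph" where
  "undirected_part G = G\<lparr>arcs := {}\<rparr>"


definition edge_matrix :: "('v, 'e, 'a) mixed_graph \<Rightarrow> 'v list \<Rightarrow> real mat" where
  "edge_matrix G vs = mat (length vs) (length vs) (\<lambda>(i, j).
     if i = j then 2 * real (card {e \<in> edges G. uends G e = {vs ! i}})
     else real (card {e \<in> edges G. uends G e = {vs ! i, vs ! j}}))"

definition arc_matrix :: "('v, 'e, 'a) mixed_graph \<Rightarrow> 'v list \<Rightarrow> real mat" where
  "arc_matrix G vs = mat (length vs) (length vs) (\<lambda>(i, j).
     real (card {a \<in> arcs G. tail G a = vs ! i \<and> head G a = vs ! j}))"

(* The list vs is the enumeration v_1, ..., v_n of the vertices. *)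
definition integrated_adjacency_matrix :: "('v, 'e, 'a) mixed_graph \<Rightarrow> 'v list \<Rightarrow> real mat" where
  "integrated_adjacency_matrix G vs =
     four_block_mat (edge_matrix G vs) (arc_matrix G vs)
       (transpose_mat (arc_matrix G vs)) (edge_matrix G vs)"


datatype ('e, 'a) step = Edge 'e | Fwd 'a | Bwd 'a

fun is_step :: "('v, 'e, 'a) mixed_graph \<Rightarrow> 'v \<Rightarrow> ('e, 'a) step \<Rightarrow> 'v \<Rightarrow> bool" where
  "is_step G u (Edge e) v \<longleftrightarrow> e \<in> edges G \<and> uends G e = {u, v}"
| "is_step G u (Fwd a) v \<longleftrightarrow> a \<in> arcs G \<and> tail G a = u \<and> head G a = v"
| "is_step G u (Bwd a) v \<longleftrightarrow> a \<in> arcs G \<and> tail G a = v \<and> head G a = u"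

(* The walk u_1, e_1, u_2, ..., e_k, u_(k+1) is given by the list us of its k + 1 vertices
   and the list es of its k steps. *)
definition walk :: "('v, 'e, 'a) mixed_graph \<Rightarrow> 'v list \<Rightarrow> ('e, 'a) step list \<Rightarrow> bool" where
  "walk G us es \<longleftrightarrow>
     length us = Suc (length es) \<and> set us \<subseteq> verts G \<and>
     (\<forall>i<length es. is_step G (us ! i) (es ! i) (us ! Suc i))"

(* The arcs of a walk in order of traversal, each with the flag "traversed forward". *)
fun arc_seq :: "('e, 'a) step list \<Rightarrow> ('a \<times> bool) list" where
  "arc_seq [] = []"
| "arc_seq (Edge e # es) = arc_seq es"
| "arc_seq (Fwd a # es) = (a, True) # arc_seq es"
| "arc_seq (Bwd a # es) = (a, False) # arc_seq es"

abbreviation num_arcs :: "('e, 'a) step list \<Rightarrow> nat" where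
  "num_arcs es \<equiv> length (arc_seq es)"

definition alternating_walk :: "('v, 'e, 'a) mixed_graph \<Rightarrow> 'v list \<Rightarrow> ('e, 'a) step list \<Rightarrow> bool" where
  "alternating_walk G us es \<longleftrightarrow>
     walk G us es \<and> arc_seq es \<noteq> [] \<and> successively (\<noteq>) (map snd (arc_seq es))"


definition connected_mixed :: "('v, 'e, 'a) mixed_graph \<Rightarrow> bool" where
  "connected_mixed G \<longleftrightarrow>
     (\<forall>u\<in>verts G. \<forall>v\<in>verts G. \<exists>us es. walk G us es \<and> hd us = u \<and> last us = v)"

definition component_of :: "('v, 'e, 'a) mixed_graph \<Rightarrow> ('v, 'e, 'a) mixed_graph \<Rightarrow> bool" where
  "component_of H G \<longleftrightarrow>
     submixed H G \<and> connected_mixed H \<and>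
     (\<forall>H'. submixed H' G \<and> connected_mixed H' \<and> submixed H H' \<longrightarrow> H' = H)"

definition special_submixed :: "('v, 'e, 'a) mixed_graph \<Rightarrow> ('v, 'e, 'a) mixed_graph \<Rightarrow> bool" where
  "special_submixed H G \<longleftrightarrow>
     submixed H G \<and> arcs H \<noteq> {} \<and>
     (\<forall>u\<in>verts H. \<forall>v\<in>verts H. u \<noteq> v \<longrightarrow>
        (\<exists>us es. alternating_walk H us es \<and> hd us = u \<and> last us = v)) \<and>
     (\<forall>K. component_of K (undirected_part H) \<and>
        (\<exists>v\<in>verts K. \<exists>a\<in>arcs H. head H a = v) \<and> (\<exists>v\<in>verts K. \<exists>a\<in>arcs H. tail H a = v) \<longrightarrow>
        (\<forall>v\<in>verts K. \<exists>us es. alternating_walk H us es \<and> hd us = v \<and> last us = v \<and>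
           odd (num_arcs es)))"

definition type_I :: "('v, 'e, 'a) mixed_graph \<Rightarrow> ('v, 'e, 'a) mixed_graph set" where
  "type_I G = {H. component_of H (undirected_part G) \<and> (\<forall>v\<in>verts H. out_degree G v = 0)}"

definition type_II :: "('v, 'e, 'a) mixed_graph \<Rightarrow> ('v, 'e, 'a) mixed_graph set" where
  "type_II G = {H. component_of H (undirected_part G) \<and> (\<forall>v\<in>verts H. in_degree G v = 0)}"

definition type_III :: "('v, 'e, 'a) mixed_graph \<Rightarrow> ('v, 'e, 'a) mixed_graph set" where
  "type_III G = {H. special_submixed H G \<and>
     (\<forall>H'. special_submixed H' G \<and> submixed H H' \<longrightarrow> H' = H)}"

lemma finite_submixed:
  assumes "mixed_graph G"
  shows "finite {H. submixed H G}"
proof (rule finite_subset)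
  let ?f = "\<lambda>(V, E, A). \<lparr>verts = V, edges = E, arcs = A,
               uends = uends G, tail = tail G, head = head G\<rparr>"
  show "{H. submixed H G} \<subseteq> ?f ` (Pow (verts G) \<times> Pow (edges G) \<times> Pow (arcs G))"
  proof
    fix H assume "H \<in> {H. submixed H G}"
    then have "H = ?f (verts H, edges H, arcs H)"
      and "(verts H, edges H, arcs H) \<in> Pow (verts G) \<times> Pow (edges G) \<times> Pow (arcs G)"
      by (auto simp: submixed_def)
    then show "H \<in> ?f ` (Pow (verts G) \<times> Pow (edges G) \<times> Pow (arcs G))" by (rule image_eqI)
  qed
  show "finite (?f ` (Pow (verts G) \<times> Pow (edges G) \<times> Pow (arcs G)))"
    using assms by (simp add: mixed_graph_def)
qed

lemma finite_types:
  assumes "mixed_graph G"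
  shows "finite (type_I G)" "finite (type_II G)" "finite (type_III G)"
proof -
  have "mixed_graph (undirected_part G)"
    using assms by (simp add: mixed_graph_def undirected_part_def)
  then have "finite {H. submixed H (undirected_part G)}" by (rule finite_submixed)
  then show "finite (type_I G)" "finite (type_II G)"
    by (auto simp: type_I_def type_II_def component_of_def elim: finite_subset[rotated])
  show "finite (type_III G)"
    using finite_submixed[OF assms]
    by (auto simp: type_III_def special_submixed_def elim: finite_subset[rotated])
qed

(* The components of G without arcs are
   exactly the common elements of type_I and type_II; they get multiplicity two. *)
definition mixed_components :: "('v, 'e, 'a) mixed_graph \<Rightarrow> ('v, 'e, 'a) mixed_graph multiset" where
  "mixed_components G = mset_set (type_I G) + mset_set (type_II G) + mset_set (type_III G)"


(* Number of arcs in the steps number i, ..., j - 1: these are the steps between the vertex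
   occurrences us ! i and us ! j, and also account for the arcs between the steps es ! i and
   es ! j if es ! i is an edge. *)
definition arcs_between :: "('e, 'a) step list \<Rightarrow> nat \<Rightarrow> nat \<Rightarrow> nat" where
  "arcs_between es i j = num_arcs (take (j - i) (drop i es))"

definition vertex_ok :: "'v list \<Rightarrow> ('e, 'a) step list \<Rightarrow> 'v \<Rightarrow> bool" where
  "vertex_ok us es u \<longleftrightarrow>
     count_list us u \<le> 2 \<and>
     (\<forall>i j. i < j \<and> j < length us \<and> us ! i = u \<and> us ! j = u \<longrightarrow> odd (arcs_between es i j))"

definition edge_ok :: "('e, 'a) step list \<Rightarrow> 'e \<Rightarrow> bool" where
  "edge_ok es e \<longleftrightarrow>
     count_list es (Edge e) \<le> 2 \<and>
     (\<forall>i j. i < j \<and> j < length es \<and> es ! i = Edge e \<and> es ! j = Edge e \<longrightarrow>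
        odd (arcs_between es i j))"

definition alternating_path :: "('v, 'e, 'a) mixed_graph \<Rightarrow> 'v list \<Rightarrow> ('e, 'a) step list \<Rightarrow> bool" where
  "alternating_path G us es \<longleftrightarrow>
     alternating_walk G us es \<and>
     (\<forall>u. vertex_ok us es u) \<and> (\<forall>e. edge_ok es e) \<and> distinct (map fst (arc_seq es))"

definition alternating_cycle :: "('v, 'e, 'a) mixed_graph \<Rightarrow> 'v list \<Rightarrow> ('e, 'a) step list \<Rightarrow> bool" where
  "alternating_cycle G us es \<longleftrightarrow>
     alternating_walk G us es \<and> hd us = last us \<and>
     (\<forall>e. edge_ok es e) \<and> distinct (map fst (arc_seq es)) \<and>
     (\<forall>u. u \<noteq> hd us \<longrightarrow> vertex_ok us es u) \<and>
     count_list us (hd us) \<le> 3 \<and>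
     (count_list us (hd us) = 3 \<longrightarrow>
        (\<forall>i j. i < j \<and> j < length us \<and> us ! i = hd us \<and> us ! j = hd us \<and>
           (\<forall>k. i < k \<and> k < j \<longrightarrow> us ! k \<noteq> hd us) \<longrightarrow> odd (arcs_between es i j)))"

definition Theta :: "('v, 'e, 'a) mixed_graph \<Rightarrow> 'v set" where
  "Theta H = {v \<in> verts H. \<exists>us es. alternating_path H us es \<and> count_list us v = 2}"

definition Omega :: "('v, 'e, 'a) mixed_graph \<Rightarrow> 'e set" where
  "Omega H = {e \<in> edges H. \<exists>us es. alternating_path H us es \<and> count_list es (Edge e) = 2}"

definition t_number :: "('v, 'e, 'a) mixed_graph \<Rightarrow> nat" where
  "t_number H = card (edges H) + card (Omega H) + card (arcs H)"


definition is_path_graph :: "('v, 'e, 'a) mixed_graph \<Rightarrow> bool" where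
  "is_path_graph H \<longleftrightarrow>
     arcs H = {} \<and>
     (\<exists>us es. distinct us \<and> distinct es \<and> set us = verts H \<and> set es = edges H \<and>
        length us = Suc (length es) \<and>
        (\<forall>i<length es. uends H (es ! i) = {us ! i, us ! Suc i}))"

(* As multigraphs may have loops and multiple edges, a loop is a cycle of length 1 and two
   parallel edges form a cycle of length 2. *)
definition is_cycle_graph :: "('v, 'e, 'a) mixed_graph \<Rightarrow> bool" where
  "is_cycle_graph H \<longleftrightarrow>
     arcs H = {} \<and>
     (\<exists>us es. us \<noteq> [] \<and> distinct us \<and> distinct es \<and> set us = verts H \<and> set es = edges H \<and>
        length us = length es \<and>
        (\<forall>i<length es. uends H (es ! i) = {us ! i, us ! (Suc i mod length us)}))"

definition AP_property :: "('v, 'e, 'a) mixed_graph \<Rightarrow> bool" where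
  "AP_property H \<longleftrightarrow>
     is_path_graph H \<or>
     (\<exists>us es. alternating_path H us es \<and>
        (\<forall>v\<in>verts H. count_list us v = (if v \<in> Theta H then 2 else 1)) \<and>
        arcs H \<subseteq> fst ` set (arc_seq es) \<and>
        (\<forall>e\<in>edges H. count_list es (Edge e) = (if e \<in> Omega H then 2 else 1)))"

definition AC_property :: "('v, 'e, 'a) mixed_graph \<Rightarrow> bool" where
  "AC_property H \<longleftrightarrow>
     is_cycle_graph H \<or>
     (\<exists>us es. alternating_cycle H us es \<and> even (num_arcs es) \<and>
        count_list us (hd us) = (if hd us \<in> Theta H then 3 else 2) \<and>
        (\<forall>v\<in>verts H. v \<noteq> hd us \<longrightarrow> count_list us v = (if v \<in> Theta H then 2 else 1)) \<and>
        arcs H \<subseteq> fst ` set (arc_seq es) \<and>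
        (\<forall>e\<in>edges H. count_list es (Edge e) = (if e \<in> Omega H then 2 else 1)))"

end

theory Submission
  imports Defs "HOL-Combinatorics.Cycles"
begin

text \<open>The matrix \<open>I(G)\<close> is the adjacency matrix of an undirected multigraph, the \<^emph>\<open>cover\<close> of \<open>G\<close>. Every
vertex \<open>v\<close> has two copies \<open>(v, True)\<close> and \<open>(v, False)\<close>, every edge has one copy in each of the two
layers, and an arc from \<open>u\<close> to \<open>v\<close> becomes a single edge joining \<open>(u, True)\<close> to \<open>(v, False)\<close>
(\<open>det_integrated\<close>).

A walk in the cover that stands in the layer \<open>True\<close> can leave this layer only along the forward
direction of an arc, and a walk in the layer \<open>False\<close> can leave it only along the backward
direction. So the walks in the cover are exactly the lifts of those walks of \<open>G\<close> in which the
directions of the arcs alternate, and the layer of a lifted walk changes with every arc. The conditions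
on repetitions in an alternating path, with their parities of numbers of arcs, say precisely that the
lift does not repeat a vertex. Consequently the multiset of mixed components consists of the projections
(\<^emph>\<open>shadows\<close>) of the connected components of the cover: those inside the layer \<open>True\<close> give type I,
those inside the layer \<open>False\<close> give type II, and those that contain a lifted arc give type III
(\<open>mixed_components_eq\<close>).

The determinant of the cover is the product of the determinants of its components. A component whose
shadow \<open>H\<close> has the AP property is a path, and one whose shadow has the AC property is a cycle, in both
cases with \<open>t(H)\<close> edges (\<open>AP_component_is_path\<close>, \<open>AC_component_is_cycle\<close>). The point to settle is that
the prescribed path or cycle \<open>W\<close> of \<open>H\<close>, once it is lifted, fills the component, although \<open>W\<close> is only
known to pass an edge twice when some alternating path of \<open>H\<close> does. Suppose that a copy \<open>f\<close> of an edge
\<open>e\<close> has an end on the lift of \<open>W\<close> but is not on it. Then the other copy \<open>g\<close> of \<open>e\<close> is on it, since \<open>W\<close>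
passes every edge. Following \<open>W\<close> between \<open>f\<close> and \<open>g\<close> and appending \<open>f\<close> gives a path that contains \<open>f\<close> and
\<open>g\<close> (\<open>path_through_two_edges\<close>), so some alternating path passes \<open>e\<close> twice. Then \<open>W\<close> has to pass \<open>e\<close>
twice and \<open>f\<close> is on its lift, a contradiction. So the lift of \<open>W\<close> cannot be left
(\<open>trail_spans_component\<close>).

A path with \<open>t\<close> edges has the determinant \<open>(-1)^((t + 1) / 2)\<close> for odd \<open>t\<close> and \<open>0\<close> for even \<open>t\<close>; a cycle
with \<open>t\<close> edges has the determinant \<open>2\<close> for odd \<open>t\<close> and \<open>-2 (1 + (-1)^(1 - t / 2))\<close> for even \<open>t\<close>. The sum
over subsets is the expanded product of the brackets for the even cycles. Only the even cycles
contribute a sign \<open>-1\<close>, whereas the formula has one for every cycle. This is no discrepancy: the cover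
has \<open>2n\<close> vertices, a path with an odd number of edges has an even number of vertices, and so the number
of odd cycles is even.\<close>


section \<open>Determinants indexed by finite sets\<close>

text \<open>The Leibniz formula for rows and columns indexed by an arbitrary finite set. The components of a
graph are sets of vertices, and their determinants can be multiplied and expanded without numbering
the vertices.\<close>

definition Det :: "'x set \<Rightarrow> ('x \<Rightarrow> 'x \<Rightarrow> real) \<Rightarrow> real" where
  "Det S M = (\<Sum>p | p permutes S. of_int (sign p) * (\<Prod>i\<in>S. M i (p i)))"

lemma det_eq_Det:
  assumes "distinct ws"
  shows "det (mat (length ws) (length ws) (\<lambda>(i, j). M (ws ! i) (ws ! j))) = Det (set ws) M"
proof -
  let ?I = "{0..<length ws}" and ?f = "(!) ws"
  let ?g = "inv_into ?I ?f"
  have bij: "bij_betw ?f ?I (set ws)"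
    using assms by (intro bij_betw_nth) auto
  then have bij': "bij_betw ?g (set ws) ?I" by (rule bij_betw_inv_into)
  have inj: "inj_on ?f ?I" using bij by (rule bij_betw_imp_inj_on)
  define A where "A = mat (length ws) (length ws) (\<lambda>(i, j). M (ws ! i) (ws ! j))"
  have "det A = (\<Sum>p | p permutes ?I. of_int (sign p) * (\<Prod>i\<in>?I. A $$ (i, p i)))"
    unfolding A_def by (intro det_def' mat_carrier)
  also have "\<dots> = Det (set ws) M"
    unfolding Det_def
  proof (rule sum.reindex_bij_witness[of _ "map_permutation (set ws) ?g" "map_permutation ?I ?f"])
    fix p assume "p \<in> {p. p permutes ?I}"
    then have p: "p permutes ?I" by simp
    show "map_permutation (set ws) ?g (map_permutation ?I ?f p) = p"
      by (rule map_permutation_compose_inv[OF bij p]) (use inj in simp)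
    show "map_permutation ?I ?f p \<in> {p. p permutes set ws}"
      using map_permutation_permutes[OF bij p] by simp
    have sgn: "sign (map_permutation ?I ?f p) = sign p"
      by (rule sign_map_permutation[OF inj p]) simp
    have "(\<Prod>x\<in>set ws. M x (map_permutation ?I ?f p x)) =
        (\<Prod>i\<in>?I. M (ws ! i) (map_permutation ?I ?f p (ws ! i)))"
      by (rule prod.reindex_bij_betw[OF bij, symmetric])
    also have "\<dots> = (\<Prod>i\<in>?I. A $$ (i, p i))"
      by (rule prod.cong[OF refl]) (use permutes_in_image[OF p] in \<open>auto simp: A_def map_permutation_apply[OF inj]\<close>)
    finally show "of_int (sign (map_permutation ?I ?f p)) * (\<Prod>x\<in>set ws. M x (map_permutation ?I ?f p x))
      = of_int (sign p) * (\<Prod>i\<in>?I. A $$ (i, p i))"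
      by (simp add: sgn)
  next
    fix p assume "p \<in> {p. p permutes set ws}"
    then have p: "p permutes set ws" by simp
    show "map_permutation ?I ?f (map_permutation (set ws) ?g p) = p"
      by (rule map_permutation_compose_inv[OF bij' p]) (use bij in \<open>auto simp: bij_betw_inv_into_right\<close>)
    show "map_permutation (set ws) ?g p \<in> {p. p permutes ?I}"
      using map_permutation_permutes[OF bij' p] by simp
  qed
  finally show ?thesis by (simp add: A_def)
qed

lemma Det_empty [simp]: "Det {} M = 1"
  by (simp add: Det_def)

lemma Det_singleton [simp]: "Det {x} M = M x x"
  by (simp add: Det_def permutes_sing)

lemma Det_cong:
  assumes "S = T" "\<And>x y. x \<in> T \<Longrightarrow> y \<in> T \<Longrightarrow> M x y = N x y"
  shows "Det S M = Det T N"
  unfolding Det_def \<open>S = T\<close>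
  by (intro sum.cong prod.cong refl arg_cong2[of _ _ _ _ "(*)"])
     (auto simp: permutes_in_image assms(2))

text \<open>A permutation that contributes to the sum maps \<open>S\<close> into \<open>S\<close>, hence splits into a permutation of \<open>S\<close>
and one of \<open>T\<close>.\<close>

lemma Det_Un:
  assumes fin: "finite S" "finite T" and disj: "S \<inter> T = {}"
    and zero: "\<And>i j. i \<in> S \<Longrightarrow> j \<in> T \<Longrightarrow> M i j = 0"
  shows "Det (S \<union> T) M = Det S M * Det T M"
proof -
  let ?t = "\<lambda>S p. of_int (sign p) * (\<Prod>i\<in>S. M i (p i))"
  let ?P = "{p. p permutes S \<union> T \<and> p ` S = S}"
  have image_T: "p ` T = T" if "p permutes S \<union> T" "p ` S = S" for p
  proof -
    have "p ` (S \<union> T - S) = p ` (S \<union> T) - p ` S"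
      by (rule image_set_diff) (use that in \<open>auto dest: permutes_inj\<close>)
    then show ?thesis using that disj by (auto simp: permutes_image Un_Diff Diff_triv)
  qed
  have "Det (S \<union> T) M = sum (?t (S \<union> T)) ?P"
    unfolding Det_def
  proof (rule sum.mono_neutral_right)
    show "finite {p. p permutes S \<union> T}" using fin by (simp add: finite_permutations)
    show "\<forall>p\<in>{p. p permutes S \<union> T} - ?P. ?t (S \<union> T) p = 0"
    proof
      fix p assume "p \<in> {p. p permutes S \<union> T} - ?P"
      then have p: "p permutes S \<union> T" "p ` S \<noteq> S" by auto
      have "\<not> p ` S \<subseteq> S"
        using p fin by (meson endo_inj_surj inj_on_subset permutes_inj subset_UNIV)
      then obtain i where i: "i \<in> S" "p i \<notin> S" by blast
      then have "p i \<in> T" using p(1) by (metis Un_iff permutes_in_image)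
      with i zero have "\<exists>i\<in>S \<union> T. M i (p i) = 0" by blast
      then show "?t (S \<union> T) p = 0" using fin by (simp add: prod_zero)
    qed
  qed auto
  also have "\<dots> = (\<Sum>(q, r)\<in>{q. q permutes S} \<times> {r. r permutes T}. ?t S q * ?t T r)"
  proof (rule sum.reindex_bij_witness[of _ "\<lambda>(q, r). q \<circ> r"
        "\<lambda>p. (restrict_id p S, restrict_id p T)"])
    fix p assume "p \<in> ?P"
    then have p: "p permutes S \<union> T" "p ` S = S" by auto
    note pT = image_T[OF p]
    have inj: "inj p" using p(1) by (rule permutes_inj)
    have r: "restrict_id p S permutes S" "restrict_id p T permutes T"
      using inj_on_subset[OF inj subset_UNIV] p(2) pT
      by (auto intro!: permutes_restrict_id simp: bij_betw_def)
    then show "(restrict_id p S, restrict_id p T) \<in> {q. q permutes S} \<times> {r. r permutes T}" by simp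
    have eq: "restrict_id p S \<circ> restrict_id p T = p"
    proof
      fix x
      show "(restrict_id p S \<circ> restrict_id p T) x = p x"
        using disj pT permutes_not_in[OF p(1)] by (auto simp: restrict_id_def)
    qed
    then show "(case (restrict_id p S, restrict_id p T) of (q, r) \<Rightarrow> q \<circ> r) = p" by simp
    have "sign p = sign (restrict_id p S) * sign (restrict_id p T)"
      using sign_compose[OF permutes_imp_permutation[OF fin(1) r(1)] permutes_imp_permutation[OF fin(2) r(2)]]
      by (simp add: eq)
    then show "(case (restrict_id p S, restrict_id p T) of (q, r) \<Rightarrow> ?t S q * ?t T r) = ?t (S \<union> T) p"
      using fin disj by (simp add: prod.union_disjoint)
  next
    fix qr assume "qr \<in> {q. q permutes S} \<times> {r. r permutes T}"
    then obtain q r where qr: "qr = (q, r)" "q permutes S" "r permutes T" by auto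
    have outS: "r x = x" if "x \<in> S" for x
      using permutes_not_in[OF qr(3)] that disj by blast
    have outT: "q (r x) = r x" if "x \<in> T" for x
      using permutes_not_in[OF qr(2)] permutes_in_image[OF qr(3)] that disj by blast
    have "q \<circ> r permutes S \<union> T"
      using qr by (intro permutes_compose) (auto intro: permutes_subset)
    moreover have "(q \<circ> r) ` S = S"
      using outS permutes_image[OF qr(2)] by force
    ultimately show "(case qr of (q, r) \<Rightarrow> q \<circ> r) \<in> ?P" by (simp add: qr)
    show "(restrict_id (case qr of (q, r) \<Rightarrow> q \<circ> r) S, restrict_id (case qr of (q, r) \<Rightarrow> q \<circ> r) T) = qr"
      using outS outT permutes_not_in[OF qr(2)] permutes_not_in[OF qr(3)]
      by (auto simp: qr(1) restrict_id_def fun_eq_iff)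
  qed
  also have "\<dots> = Det S M * Det T M"
    by (simp add: Det_def sum_product sum.cartesian_product)
  finally show ?thesis .
qed

lemma Det_Union:
  assumes "finite \<T>" "\<And>T. T \<in> \<T> \<Longrightarrow> finite T" "disjoint \<T>"
    and "\<And>S T i j. S \<in> \<T> \<Longrightarrow> T \<in> \<T> \<Longrightarrow> S \<noteq> T \<Longrightarrow> i \<in> S \<Longrightarrow> j \<in> T \<Longrightarrow> M i j = 0"
  shows "Det (\<Union>\<T>) M = (\<Prod>T\<in>\<T>. Det T M)"
  using assms
proof (induction \<T> rule: finite_induct)
  case (insert S \<T>)
  have "S \<inter> \<Union>\<T> = {}"
    using insert.hyps(2) insert.prems(2) by (auto simp: disjoint_def)
  moreover have "M i j = 0" if "i \<in> S" "j \<in> \<Union>\<T>" for i j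
    using that insert.hyps(2) insert.prems(3)[OF insertI1 insertI2] by blast
  ultimately have "Det (S \<union> \<Union>\<T>) M = Det S M * Det (\<Union>\<T>) M"
    using insert.hyps insert.prems(1) by (intro Det_Un) auto
  also have "Det (\<Union>\<T>) M = (\<Prod>T\<in>\<T>. Det T M)"
    using insert.prems(1,2) insert.prems(3)[OF insertI2 insertI2]
    by (intro insert.IH) (auto simp: disjoint_def)
  finally show ?case using insert.hyps by simp
qed simp

text \<open>Such a permutation is the transposition of \<open>x\<close> and \<open>y\<close> followed by a permutation of \<open>S\<close>; the minus
sign is the sign of the transposition.\<close>

lemma sum_permutations_swapping:
  assumes fin: "finite S" and xy: "x \<notin> S" "y \<notin> S" "x \<noteq> y"
  shows "(\<Sum>p | p permutes insert x (insert y S) \<and> p x = y \<and> p y = x.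
            of_int (sign p) * (\<Prod>i\<in>insert x (insert y S). M i (p i))) = - (M x y * M y x * Det S M)"
proof -
  let ?\<tau> = "Transposition.transpose x y"
  have "(\<Sum>p | p permutes insert x (insert y S) \<and> p x = y \<and> p y = x.
            of_int (sign p) * (\<Prod>i\<in>insert x (insert y S). M i (p i))) =
     (\<Sum>q | q permutes S. - (M x y * M y x) * (of_int (sign q) * (\<Prod>i\<in>S. M i (q i))))"
  proof (rule sum.reindex_bij_witness[of _ "\<lambda>q. ?\<tau> \<circ> q" "\<lambda>p. ?\<tau> \<circ> p"])
    fix p assume "p \<in> {p. p permutes insert x (insert y S) \<and> p x = y \<and> p y = x}"
    then have p: "p permutes insert x (insert y S)" "p x = y" "p y = x" by auto
    show "?\<tau> \<circ> (?\<tau> \<circ> p) = p" by (simp add: fun_eq_iff)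
    have \<tau>: "?\<tau> permutes insert x (insert y S)" by (simp add: permutes_swap_id)
    have "?\<tau> \<circ> p permutes insert x (insert y S)" using p(1) \<tau> by (rule permutes_compose)
    then have q: "?\<tau> \<circ> p permutes S"
      by (rule permutes_superset) (use p in auto)
    then show "?\<tau> \<circ> p \<in> {q. q permutes S}" by simp
    have "sign (?\<tau> \<circ> p) = - sign p"
      using permutes_imp_permutation[OF _ p(1)] permutes_imp_permutation[OF _ \<tau>] fin xy
      by (subst sign_compose) (auto simp: sign_swap_id)
    moreover have "(\<Prod>i\<in>S. M i ((?\<tau> \<circ> p) i)) = (\<Prod>i\<in>S. M i (p i))"
    proof (rule prod.cong[OF refl])
      fix i assume i: "i \<in> S"
      then have "p i \<noteq> x" "p i \<noteq> y"
        using permutes_inj[OF p(1)] p(2,3) xy by (metis injD)+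
      then show "M i ((?\<tau> \<circ> p) i) = M i (p i)" by simp
    qed
    ultimately show "- (M x y * M y x) * (of_int (sign (?\<tau> \<circ> p)) * (\<Prod>i\<in>S. M i ((?\<tau> \<circ> p) i))) =
       of_int (sign p) * (\<Prod>i\<in>insert x (insert y S). M i (p i))"
      using fin xy p by simp
  next
    fix q assume "q \<in> {q. q permutes S}"
    then have q: "q permutes S" by simp
    show "?\<tau> \<circ> (?\<tau> \<circ> q) = q" by (simp add: fun_eq_iff)
    have "?\<tau> \<circ> q permutes insert x (insert y S)"
      using q by (intro permutes_compose) (auto simp: permutes_swap_id intro: permutes_subset)
    then show "?\<tau> \<circ> q \<in> {p. p permutes insert x (insert y S) \<and> p x = y \<and> p y = x}"
      using permutes_not_in[OF q] xy by simp
  qed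
  then show ?thesis by (simp add: Det_def sum_distrib_left sum_negf)
qed

text \<open>If \<open>x\<close> is a leaf of a graph and \<open>y\<close> is its neighbour, then only permutations that swap \<open>x\<close> and \<open>y\<close>
contribute.\<close>

lemma Det_pendant:
  assumes fin: "finite S" and xy: "x \<notin> S" "y \<notin> S" "x \<noteq> y"
    and "M x x = 0" "\<And>z. z \<in> S \<Longrightarrow> M x z = 0" "\<And>z. z \<in> S \<Longrightarrow> M z x = 0"
  shows "Det (insert x (insert y S)) M = - (M x y * M y x * Det S M)"
proof -
  let ?U = "insert x (insert y S)"
  have "Det ?U M = (\<Sum>p | p permutes ?U \<and> p x = y \<and> p y = x. of_int (sign p) * (\<Prod>i\<in>?U. M i (p i)))"
    unfolding Det_def
  proof (rule sum.mono_neutral_right)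
    show "finite {p. p permutes ?U}" using fin by (simp add: finite_permutations)
    show "\<forall>p\<in>{p. p permutes ?U} - {p. p permutes ?U \<and> p x = y \<and> p y = x}.
        of_int (sign p) * (\<Prod>i\<in>?U. M i (p i)) = 0"
    proof
      fix p assume *: "p \<in> {p. p permutes ?U} - {p. p permutes ?U \<and> p x = y \<and> p y = x}"
      then have p: "p permutes ?U" by simp
      obtain w where w: "w \<in> ?U" "p w = x"
        using permutes_image[OF p] by (metis image_iff insertI1)
      have px: "p x \<in> ?U" unfolding permutes_in_image[OF p] by simp
      have "M x (p x) = 0 \<or> M w (p w) = 0"
      proof (cases "p x = y")
        case True
        then have "w \<noteq> y" using * p w by auto
        then show ?thesis using w assms(5,7) by auto
      next
        case False
        then show ?thesis using px assms(5,6) by auto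
      qed
      then have "\<exists>i\<in>?U. M i (p i) = 0" using w by blast
      then show "of_int (sign p) * (\<Prod>i\<in>?U. M i (p i)) = 0"
        using fin by (metis finite.insertI mult_zero_right prod_zero)
    qed
  qed auto
  also have "\<dots> = - (M x y * M y x * Det S M)"
    using fin xy by (rule sum_permutations_swapping)
  finally show ?thesis .
qed


section \<open>Determinants of paths and cycles\<close>

text \<open>Removing an end vertex together with its neighbour leaves a path with two vertices fewer and changes
the sign.\<close>

lemma Det_path:
  assumes "distinct us"
    and "\<And>a b. a < length us \<Longrightarrow> b < length us \<Longrightarrow>
           M (us ! a) (us ! b) = (if b = Suc a \<or> a = Suc b then 1 else 0)"
  shows "Det (set us) M = (if even (length us) then (-1) ^ (length us div 2) else 0)"
  using assms
proof (induction us rule: induct_list012)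
  case (2 x)
  from "2.prems"(2)[of 0 0] show ?case by simp
next
  case (3 x y zs)
  note M = "3.prems"(2)
  have zs: "M x z = 0 \<and> M z x = 0" if z: "z \<in> set zs" for z
  proof -
    obtain c where "c < length zs" "z = zs ! c" using z by (metis in_set_conv_nth)
    then show ?thesis using M[of 0 "Suc (Suc c)"] M[of "Suc (Suc c)" 0] by simp
  qed
  have "Det (insert x (insert y (set zs))) M = - (M x y * M y x * Det (set zs) M)"
    using "3.prems"(1) zs M[of 0 0] by (intro Det_pendant) auto
  also have "Det (set zs) M = (if even (length zs) then (-1) ^ (length zs div 2) else 0)"
    using "3.prems"(1) M[of "Suc (Suc a)" "Suc (Suc b)" for a b] by (intro "3.IH"(1)) auto
  finally show ?case using M[of 0 1] M[of 1 0] by simp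
qed simp

lemma sign_cycle_of_list:
  "distinct us \<Longrightarrow> sign (cycle_of_list us) = (-1) ^ (length us - 1)"
proof (induction us rule: cycle_of_list.induct)
  case (1 i j cs)
  have "sign (cycle_of_list (i # j # cs)) =
      sign (Transposition.transpose i j) * sign (cycle_of_list (j # cs))"
    unfolding cycle_of_list.simps(1) by (intro sign_compose permutation_swap_id permutation_of_cycle)
  with 1 show ?case by (simp add: sign_swap_id del: cycle_of_list.simps)
qed auto

lemma cycle_of_list_nth:
  assumes "distinct us" "k < length us"
  shows "cycle_of_list us (us ! k) = us ! (Suc k mod length us)"
proof -
  have "map (cycle_of_list us) us = rotate1 us"
    using cyclic_rotation[OF assms(1), of 1] by simp
  then show ?thesis using assms(2) by (metis nth_map nth_rotate1)
qed

text \<open>The matrix restricted to \<open>us\<close> is the adjacency matrix of a cycle that visits \<open>us\<close> in this order. For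
fewer than three vertices two neighbours are joined twice or a vertex is joined to itself, and the
entries would be \<open>2\<close>.\<close>

definition cycle_matrix :: "'x list \<Rightarrow> ('x \<Rightarrow> 'x \<Rightarrow> real) \<Rightarrow> bool" where
  "cycle_matrix us M \<longleftrightarrow> distinct us \<and> 3 \<le> length us \<and>
     (\<forall>a<length us. \<forall>b<length us. M (us ! a) (us ! b) =
        (if b = Suc a mod length us \<or> a = Suc b mod length us then 1 else 0))"

lemma cycle_matrixD:
  assumes "cycle_matrix us M" "a < length us" "b < length us"
  shows "M (us ! a) (us ! b) = (if b = Suc a mod length us \<or> a = Suc b mod length us then 1 else 0)"
  using assms by (auto simp: cycle_matrix_def)

lemma Suc_mod_eq: "a < L \<Longrightarrow> Suc a mod L = (if Suc a = L then 0 else Suc a)"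
  by auto

text \<open>Running through the cycle backwards from the same start exchanges the two neighbours of the start.\<close>

lemma cycle_matrix_reverse:
  assumes "cycle_matrix us M"
  shows "cycle_matrix (hd us # rev (tl us)) M"
proof -
  define L where "L = length us"
  have L: "3 \<le> L" and dist: "distinct us" using assms by (auto simp: cycle_matrix_def L_def)
  have nth: "(hd us # rev (tl us)) ! a = us ! (if a = 0 then 0 else L - a)" if "a < L" for a
    using L that by (cases us) (auto simp: L_def nth_Cons' rev_nth Suc_diff_Suc)
  have "M ((hd us # rev (tl us)) ! a) ((hd us # rev (tl us)) ! b) =
     (if b = Suc a mod L \<or> a = Suc b mod L then 1 else 0)" if "a < L" "b < L" for a b
  proof -
    let ?a = "if a = 0 then 0 else L - a" and ?b = "if b = 0 then 0 else L - b"
    have "?a < L" "?b < L" using L that by auto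
    then have "M (us ! ?a) (us ! ?b) = (if ?b = Suc ?a mod L \<or> ?a = Suc ?b mod L then 1 else 0)"
      using cycle_matrixD[OF assms, of ?a ?b] by (simp add: L_def)
    also have "(?b = Suc ?a mod L \<or> ?a = Suc ?b mod L) \<longleftrightarrow> (b = Suc a mod L \<or> a = Suc b mod L)"
      unfolding Suc_mod_eq[OF \<open>?a < L\<close>] Suc_mod_eq[OF \<open>?b < L\<close>] Suc_mod_eq[OF that(1)] Suc_mod_eq[OF that(2)]
      using that L by (cases "a = 0"; cases "b = 0"; cases "Suc a = L"; cases "Suc b = L") (simp_all, linarith+)
    finally show ?thesis unfolding nth[OF that(1)] nth[OF that(2)] .
  qed
  moreover have "length (hd us # rev (tl us)) = L" "distinct (hd us # rev (tl us))"
    using L dist by (cases us; simp add: L_def)+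
  ultimately show ?thesis using L by (simp add: cycle_matrix_def)
qed

text \<open>A permutation that moves along edges, takes the first step forward and does not step back at once
has to go on forward: the vertex behind is already the image of another vertex.\<close>

lemma permutation_along_cycle:
  assumes M: "cycle_matrix us M" and p: "p permutes set us"
    and nz: "\<And>x. x \<in> set us \<Longrightarrow> M x (p x) \<noteq> 0"
    and start: "p (us ! 0) = us ! 1" "p (us ! 1) \<noteq> us ! 0"
  shows "p = cycle_of_list us"
proof -
  define L where "L = length us"
  have L: "3 \<le> L" and dist: "distinct us" using M by (auto simp: cycle_matrix_def L_def)
  have step: "p (us ! k) = us ! (Suc k mod L) \<or> (\<exists>j<L. k = Suc j mod L \<and> p (us ! k) = us ! j)"
    if "k < L" for k
  proof -
    have "p (us ! k) \<in> set us" using that permutes_in_image[OF p] by (simp add: L_def)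
    then obtain j where j: "j < L" "p (us ! k) = us ! j" unfolding L_def by (metis in_set_conv_nth)
    have "M (us ! k) (us ! j) \<noteq> 0" using nz[of "us ! k"] j that by (simp add: L_def)
    then have "j = Suc k mod L \<or> k = Suc j mod L"
      using cycle_matrixD[OF M, of k j] j that by (simp add: L_def split: if_splits)
    then show ?thesis using j by auto
  qed
  have succ: "p (us ! k) = us ! (Suc k mod L)" if "k < L" for k
    using that
  proof (induction k rule: less_induct)
    case (less k)
    consider "k = 0" | "k = 1" | m where "k = Suc (Suc m)" by (metis One_nat_def not0_implies_Suc)
    then show ?case
    proof cases
      case 1
      then show ?thesis using start L by simp
    next
      case 2
      have "j = 0" if "j < L" "1 = Suc j mod L" for j
        using that by (cases "Suc j = L") auto
      then show ?thesis using step[OF less.prems] start(2) 2 by auto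
    next
      case 3
      have "p (us ! m) = us ! Suc m" using less.IH[of m] less.prems 3 by simp
      moreover have "p (us ! k) \<noteq> p (us ! m)"
        using dist less.prems 3 permutes_inj[OF p] by (simp add: nth_eq_iff_index_eq L_def inj_eq)
      moreover have "j = Suc m" if "j < L" "k = Suc j mod L" for j
        using that 3 by (cases "Suc j = L") auto
      ultimately show ?thesis
        using step[OF less.prems] by metis
    qed
  qed
  show ?thesis
  proof
    fix x show "p x = cycle_of_list us x"
    proof (cases "x \<in> set us")
      case True
      then obtain k where "k < L" "x = us ! k" unfolding L_def by (metis in_set_conv_nth)
      then show ?thesis using succ cycle_of_list_nth[OF dist] by (simp add: L_def)
    next
      case False
      then show ?thesis using permutes_not_in[OF p] id_outside_supp by metis
    qed
  qed
qed

text \<open>The permutations that move the start of the cycle to its successor either swap these two vertices,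
which leaves a path with \<open>length us - 2\<close> vertices, or rotate the whole cycle.\<close>

lemma sum_permutations_first_step:
  assumes M: "cycle_matrix us M"
  shows "(\<Sum>p | p permutes set us \<and> p (us ! 0) = us ! 1. of_int (sign p) * (\<Prod>x\<in>set us. M x (p x))) =
    (-1) ^ (length us - 1) - (if even (length us) then (-1) ^ (length us div 2 - 1) else 0)"
proof -
  obtain x y zs where us: "us = x # y # zs" and zs: "zs \<noteq> []"
    using M by (auto simp: cycle_matrix_def numeral_3_eq_3 Suc_le_length_iff)
  have dist: "distinct us" using M by (simp add: cycle_matrix_def)
  have u01: "us ! 0 = x" "us ! 1 = y" by (simp_all add: us)
  have len: "even (length us) = even (length zs)" "length us div 2 - 1 = length zs div 2"
    by (simp_all add: us)
  let ?t = "\<lambda>p. real_of_int (sign p) * (\<Prod>x\<in>set us. M x (p x))"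
  let ?A = "{p. p permutes set us \<and> p x = y \<and> p y = x}" and ?c = "cycle_of_list us"
  have c: "?c (us ! k) = us ! (Suc k mod length us)" if "k < length us" for k
    using cycle_of_list_nth[OF dist that] .
  have cxy: "?c x = y" "?c y \<noteq> x"
    using c[of 0] c[of 1] dist zs Suc_mod_eq[of 0 "length us"] Suc_mod_eq[of 1 "length us"]
    by (auto simp: us simp del: cycle_of_list.simps)
  have "(\<Sum>p | p permutes set us \<and> p x = y. ?t p) = sum ?t (insert ?c ?A)"
  proof (rule sum.mono_neutral_right)
    show "finite {p. p permutes set us \<and> p x = y}"
      by (rule finite_subset[OF _ finite_permutations[of "set us"]]) auto
    show "insert ?c ?A \<subseteq> {p. p permutes set us \<and> p x = y}"
      using cxy cycle_permutes[of us] by blast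
    show "\<forall>p\<in>{p. p permutes set us \<and> p x = y} - insert ?c ?A. ?t p = 0"
    proof
      fix p assume *: "p \<in> {p. p permutes set us \<and> p x = y} - insert ?c ?A"
      then have "\<exists>x\<in>set us. M x (p x) = 0"
        using permutation_along_cycle[OF M, of p] by (auto simp only: u01)
      then have "(\<Prod>x\<in>set us. M x (p x)) = 0" by (intro prod_zero finite_set)
      then show "?t p = 0" by simp
    qed
  qed
  also have "\<dots> = ?t ?c + sum ?t ?A"
  proof (rule sum.insert)
    show "finite ?A" by (rule finite_subset[OF _ finite_permutations[of "set us"]]) auto
    show "?c \<notin> ?A" using cxy by blast
  qed
  also have "sum ?t ?A = - (M x y * M y x * Det (set zs) M)"
    using sum_permutations_swapping[of "set zs" x y M] dist by (simp add: us)
  also have "\<dots> = - Det (set zs) M"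
    using cycle_matrixD[OF M, of 0 1] cycle_matrixD[OF M, of 1 0] zs
      Suc_mod_eq[of 0 "length us"] by (simp add: us)
  also have "Det (set zs) M = (if even (length zs) then (-1) ^ (length zs div 2) else 0)"
  proof (rule Det_path)
    fix a b assume "a < length zs" "b < length zs"
    then show "M (zs ! a) (zs ! b) = (if b = Suc a \<or> a = Suc b then 1 else 0)"
      using cycle_matrixD[OF M, of "Suc (Suc a)" "Suc (Suc b)"]
        Suc_mod_eq[of "Suc (Suc a)" "length us"] Suc_mod_eq[of "Suc (Suc b)" "length us"]
      by (simp add: us split: if_splits)
  qed (use dist us in simp)
  also have "?t ?c = (-1) ^ (length us - 1)"
  proof -
    have "M v (?c v) = 1" if v: "v \<in> set us" for v
    proof -
      obtain k where k: "k < length us" "v = us ! k" using v by (metis in_set_conv_nth)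
      then show ?thesis using c[OF k(1)] cycle_matrixD[OF M k(1), of "Suc k mod length us"]
        by (simp add: us del: cycle_of_list.simps)
    qed
    then show ?thesis using sign_cycle_of_list[OF dist] by (simp del: cycle_of_list.simps)
  qed
  finally show ?thesis unfolding u01 len by simp
qed


text \<open>The start of the cycle is moved to its successor or to its predecessor; the second case is the first
one for the reversed cycle.\<close>

lemma Det_long_cycle:
  assumes M: "cycle_matrix us M"
  shows "Det (set us) M =
    2 * (-1) ^ (length us - 1) - (if even (length us) then 2 * (-1) ^ (length us div 2 - 1) else 0)"
proof -
  define us' where "us' = hd us # rev (tl us)"
  have M': "cycle_matrix us' M" unfolding us'_def using M by (rule cycle_matrix_reverse)
  have len: "3 \<le> length us" and dist: "distinct us" using M by (auto simp: cycle_matrix_def)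
  define z where "z = us ! (length us - 1)"
  have us': "set us' = set us" "length us' = length us" "us' ! 0 = us ! 0" "us' ! 1 = z"
  proof -
    obtain x zs where us: "us = x # zs" "zs \<noteq> []"
      using len by (cases us; cases "tl us") auto
    show "set us' = set us" "length us' = length us" "us' ! 0 = us ! 0"
      by (simp_all add: us'_def us(1))
    show "us' ! 1 = z"
      using us(2) by (simp add: us'_def z_def us(1) rev_nth nth_Cons')
  qed
  have neq: "us ! 1 \<noteq> z" using len dist nth_eq_iff_index_eq[OF dist, of 1 "length us - 1"]
    by (simp add: z_def)
  let ?t = "\<lambda>p. real_of_int (sign p) * (\<Prod>x\<in>set us. M x (p x))"
  have fin: "finite {p. p permutes set us \<and> p (us ! 0) = w}" for w
    by (rule finite_subset[OF _ finite_permutations[of "set us"]]) auto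
  have "Det (set us) M =
     sum ?t ({p. p permutes set us \<and> p (us ! 0) = us ! 1} \<union> {p. p permutes set us \<and> p (us ! 0) = z})"
    unfolding Det_def
  proof (rule sum.mono_neutral_right)
    show "finite {p. p permutes set us}" by (simp add: finite_permutations)
    show "\<forall>p\<in>{p. p permutes set us} -
        ({p. p permutes set us \<and> p (us ! 0) = us ! 1} \<union> {p. p permutes set us \<and> p (us ! 0) = z}). ?t p = 0"
    proof
      fix p assume p: "p \<in> {p. p permutes set us} -
        ({p. p permutes set us \<and> p (us ! 0) = us ! 1} \<union> {p. p permutes set us \<and> p (us ! 0) = z})"
      have u0: "us ! 0 \<in> set us" using len by (intro nth_mem) linarith
      then have "p (us ! 0) \<in> set us" using p by (simp add: permutes_in_image)
      then obtain j where j: "j < length us" "p (us ! 0) = us ! j" by (metis in_set_conv_nth)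
      then have "j \<noteq> 1" "j \<noteq> length us - 1" using p by (auto simp: z_def)
      moreover have "Suc 0 mod length us = 1" "Suc j mod length us = (if Suc j = length us then 0 else Suc j)"
        using len j(1) by auto
      moreover have "M (us ! 0) (us ! j) =
          (if j = Suc 0 mod length us \<or> 0 = Suc j mod length us then 1 else 0)"
        by (rule cycle_matrixD[OF M]) (use len j(1) in linarith)+
      ultimately have "M (us ! 0) (p (us ! 0)) = 0" by (simp add: j(2) split: if_splits)
      then have "\<exists>x\<in>set us. M x (p x) = 0" using u0 by (rule bexI[of _ "us ! 0"])
      then show "?t p = 0" by (simp add: prod_zero)
    qed
  qed auto
  also have "\<dots> = sum ?t {p. p permutes set us \<and> p (us ! 0) = us ! 1}
      + sum ?t {p. p permutes set us \<and> p (us ! 0) = z}"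
    using neq by (intro sum.union_disjoint fin) auto
  also have "sum ?t {p. p permutes set us \<and> p (us ! 0) = us ! 1} =
      (-1) ^ (length us - 1) - (if even (length us) then (-1) ^ (length us div 2 - 1) else 0)"
    using M by (rule sum_permutations_first_step)
  also have "sum ?t {p. p permutes set us \<and> p (us ! 0) = z} =
      (-1) ^ (length us - 1) - (if even (length us) then (-1) ^ (length us div 2 - 1) else 0)"
    using sum_permutations_first_step[OF M'] unfolding us' .
  finally show ?thesis by simp
qed


section \<open>Walks and connected components\<close>

definition joined :: "('v, 'e, 'a) mixed_graph \<Rightarrow> 'v \<Rightarrow> 'v \<Rightarrow> bool" where
  "joined G u v \<longleftrightarrow> (\<exists>us es. walk G us es \<and> hd us = u \<and> last us = v)"

text \<open>Connectedness by walks is the reflexive transitive closure of this relation, which gives access to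
induction along walks without handling lists of steps.\<close>

definition adjacent :: "('v, 'e, 'a) mixed_graph \<Rightarrow> ('v \<times> 'v) set" where
  "adjacent G = {(u, v). u \<in> verts G \<and> v \<in> verts G \<and> (\<exists>s. is_step G u s v)}"

lemma walk_Nil [simp]: "\<not> walk G [] es" 
  by (simp add: walk_def)

lemma walk_no_steps [simp]: "walk G us [] \<longleftrightarrow> (\<exists>u\<in>verts G. us = [u])"
  by (auto simp: walk_def length_Suc_conv)

lemma walk_Cons:
  "walk G (u # us) (s # es) \<longleftrightarrow> us \<noteq> [] \<and> u \<in> verts G \<and> is_step G u s (hd us) \<and> walk G us es"
proof (cases us)
  case (Cons w ws)
  then show ?thesis by (auto simp: walk_def All_less_Suc2)
qed (simp add: walk_def)

lemma walk_not_Nil: "walk G us es \<Longrightarrow> us \<noteq> []"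
  by auto

lemma walk_set: "walk G us es \<Longrightarrow> set us \<subseteq> verts G"
  by (simp add: walk_def)

lemma adjacent_sym: "(u, v) \<in> adjacent G \<Longrightarrow> (v, u) \<in> adjacent G"
proof -
  have "\<exists>s'. is_step G v s' u" if "is_step G u s v" for s
  proof (cases s)
    case (Edge e)
    with that have "is_step G v (Edge e) u" by (auto simp: insert_commute)
    then show ?thesis ..
  next
    case (Fwd a)
    with that have "is_step G v (Bwd a) u" by simp
    then show ?thesis ..
  next
    case (Bwd a)
    with that have "is_step G v (Fwd a) u" by simp
    then show ?thesis ..
  qed
  then show "(u, v) \<in> adjacent G \<Longrightarrow> (v, u) \<in> adjacent G" by (auto simp: adjacent_def)
qed

lemma walk_imp_rtrancl: "walk G us es \<Longrightarrow> (hd us, last us) \<in> (adjacent G)\<^sup>*"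
proof (induction es arbitrary: us)
  case (Cons s es)
  then obtain u us' where us: "us = u # us'" by (cases us) auto
  with Cons.prems have w: "us' \<noteq> []" "u \<in> verts G" "is_step G u s (hd us')" "walk G us' es"
    by (auto simp: walk_Cons)
  then have "(u, hd us') \<in> adjacent G" using walk_set[OF w(4)] by (auto simp: adjacent_def)
  then show ?case using Cons.IH[OF w(4)] w(1) by (simp add: us converse_rtrancl_into_rtrancl)
qed auto

lemma joined_iff: "joined G u v \<longleftrightarrow> u \<in> verts G \<and> (u, v) \<in> (adjacent G)\<^sup>*"
proof
  assume "joined G u v"
  then obtain us es where w: "walk G us es" "hd us = u" "last us = v" by (auto simp: joined_def)
  then have "u \<in> verts G" using walk_set[OF w(1)] walk_not_Nil[OF w(1)] hd_in_set by auto
  with walk_imp_rtrancl[OF w(1)] w show "u \<in> verts G \<and> (u, v) \<in> (adjacent G)\<^sup>*" by simp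
next
  assume *: "u \<in> verts G \<and> (u, v) \<in> (adjacent G)\<^sup>*"
  then have "(u, v) \<in> (adjacent G)\<^sup>*" by simp
  then have "u \<in> verts G \<longrightarrow> joined G u v"
  proof (induction rule: converse_rtrancl_induct)
    case base
    have "walk G [v] [] \<and> hd [v] = v \<and> last [v] = v" if "v \<in> verts G" using that by simp
    then show ?case unfolding joined_def by blast
  next
    case (step y z)
    then obtain s us es where s: "is_step G y s z" "y \<in> verts G" and w: "walk G us es" "hd us = z" "last us = v"
      by (auto simp: adjacent_def joined_def)
    have "us \<noteq> []" using w(1) by auto
    then have "walk G (y # us) (s # es) \<and> hd (y # us) = y \<and> last (y # us) = v"
      using s w by (simp add: walk_Cons)
    then show ?case unfolding joined_def by blast
  qed
  with * show "joined G u v" by simp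
qed

lemma joined_refl: "u \<in> verts G \<Longrightarrow> joined G u u"
  by (simp add: joined_iff)

lemma joined_verts: "joined G u v \<Longrightarrow> u \<in> verts G \<and> v \<in> verts G"
  unfolding joined_iff by (metis (no_types, lifting) adjacent_def case_prodD mem_Collect_eq rtranclE)

lemma joined_sym: "joined G u v \<Longrightarrow> joined G v u"
proof -
  have "sym (adjacent G)" by (auto simp: sym_def dest: adjacent_sym)
  then have "sym ((adjacent G)\<^sup>*)" by (rule sym_rtrancl)
  then show "joined G u v \<Longrightarrow> joined G v u"
    using joined_verts[of G u v] by (auto simp: joined_iff dest: symD)
qed

lemma joined_trans: "joined G u v \<Longrightarrow> joined G v w \<Longrightarrow> joined G u w"
  by (auto simp: joined_iff)

lemma joined_step: "is_step G u s v \<Longrightarrow> u \<in> verts G \<Longrightarrow> v \<in> verts G \<Longrightarrow> joined G u v"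
  by (auto simp: joined_iff adjacent_def)

lemma joined_edge:
  "mixed_graph G \<Longrightarrow> e \<in> edges G \<Longrightarrow> u \<in> uends G e \<Longrightarrow> v \<in> uends G e \<Longrightarrow> joined G u v"
proof -
  assume G: "mixed_graph G" "e \<in> edges G" "u \<in> uends G e" "v \<in> uends G e"
  then obtain x y where xy: "uends G e = {x, y}" "x \<in> verts G" "y \<in> verts G"
    unfolding mixed_graph_def by blast
  then have "joined G x y" using G by (intro joined_step[of _ _ "Edge e"]) auto
  then show "joined G u v" using G(3,4) xy by (auto intro: joined_refl joined_sym)
qed

lemma is_step_mono: "submixed H G \<Longrightarrow> is_step H u s v \<Longrightarrow> is_step G u s v"
  by (cases s) (auto simp: submixed_def)

lemma walk_mono: "submixed H G \<Longrightarrow> walk H us es \<Longrightarrow> walk G us es"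
  using is_step_mono[of H G] by (auto simp: walk_def dest: subsetD) (auto simp: submixed_def)

lemma joined_mono: "submixed H G \<Longrightarrow> joined H u v \<Longrightarrow> joined G u v"
  unfolding joined_def using walk_mono by blast

lemma submixed_trans: "submixed H K \<Longrightarrow> submixed K G \<Longrightarrow> submixed H G"
  by (auto simp: submixed_def)

lemma submixed_antisym: "submixed H G \<Longrightarrow> submixed G H \<Longrightarrow> H = G"
  by (auto simp: submixed_def intro!: mixed_graph.equality)


text \<open>An arc belongs to the component as soon as its tail does, because its head is then joined to the same
vertices.\<close>

definition component :: "('v, 'e, 'a) mixed_graph \<Rightarrow> 'v \<Rightarrow> ('v, 'e, 'a) mixed_graph" where
  "component G x = G\<lparr>verts := {y. joined G x y}, edges := {e \<in> edges G. uends G e \<subseteq> {y. joined G x y}},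
     arcs := {a \<in> arcs G. joined G x (tail G a)}\<rparr>"

lemma component_simps [simp]:
  "verts (component G x) = {y. joined G x y}"
  "edges (component G x) = {e \<in> edges G. uends G e \<subseteq> {y. joined G x y}}"
  "arcs (component G x) = {a \<in> arcs G. joined G x (tail G a)}"
  "uends (component G x) = uends G" "tail (component G x) = tail G" "head (component G x) = head G"
  by (simp_all add: component_def)

lemma joined_tail_head:
  assumes "mixed_graph G" "a \<in> arcs G"
  shows "joined G (tail G a) (head G a)"
  using assms by (intro joined_step[of _ _ "Fwd a"]) (auto simp: mixed_graph_def)

lemma submixed_component:
  assumes G: "mixed_graph G" and x: "x \<in> verts G"
  shows "submixed (component G x) G"
proof -
  let ?V = "{y. joined G x y}"
  have V: "?V \<subseteq> verts G" by (auto dest: joined_verts)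
  have fin: "finite (verts G)" "finite (edges G)" "finite (arcs G)"
    using G by (auto simp: mixed_graph_def)
  have "finite ?V" using V fin(1) by (rule finite_subset)
  moreover have "x \<in> ?V" using x by (simp add: joined_refl)
  moreover have "\<exists>u\<in>?V. \<exists>v\<in>?V. uends G e = {u, v}" if e: "e \<in> edges G" "uends G e \<subseteq> ?V" for e
  proof -
    obtain u v where "uends G e = {u, v}" using G e(1) unfolding mixed_graph_def by blast
    with e(2) show ?thesis by auto
  qed
  moreover have "joined G x (head G a)" if "a \<in> arcs G" "joined G x (tail G a)" for a
    using joined_trans[OF that(2) joined_tail_head[OF G that(1)]] .
  ultimately have "mixed_graph (component G x)" using fin by (auto simp: mixed_graph_def)
  then show ?thesis using V by (auto simp: submixed_def)
qed

lemma component_cong: "joined G x y \<Longrightarrow> component G x = component G y"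
proof -
  assume "joined G x y"
  then have "{z. joined G x z} = {z. joined G y z}" by (auto intro: joined_trans joined_sym)
  then show ?thesis by (simp add: component_def set_eq_iff)
qed

lemma connected_component:
  assumes x: "x \<in> verts G"
  shows "connected_mixed (component G x)"
proof -
  have "joined G x y \<longrightarrow> (y, z) \<in> (adjacent (component G x))\<^sup>*" if "(y, z) \<in> (adjacent G)\<^sup>*" for y z
    using that
  proof (induction rule: converse_rtrancl_induct)
    case (step y w)
    show ?case
    proof
      assume xy: "joined G x y"
      obtain s where s: "is_step G y s w" "y \<in> verts G" "w \<in> verts G"
        using step.hyps(1) by (auto simp: adjacent_def)
      then have xw: "joined G x w" using xy by (blast intro: joined_step joined_trans)
      have "is_step (component G x) y s w" using s(1) xy xw by (cases s) auto
      then have "(y, w) \<in> adjacent (component G x)" using xy xw by (auto simp: adjacent_def)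
      then show "(y, z) \<in> (adjacent (component G x))\<^sup>*"
        using step.IH xw by (simp add: converse_rtrancl_into_rtrancl)
    qed
  qed simp
  then have "joined (component G x) y z" if "joined G x y" "joined G x z" for y z
    using that joined_trans[OF joined_sym[OF that(1)] that(2)] by (simp add: joined_iff)
  then show ?thesis by (simp add: connected_mixed_def joined_def)
qed

lemma connected_submixed_component:
  assumes G: "mixed_graph G" and K: "submixed K G" "connected_mixed K" and x: "x \<in> verts K"
  shows "submixed K (component G x)"
proof -
  have KG: "joined K u v \<Longrightarrow> joined G u v" for u v using joined_mono[OF K(1)] .
  have xy: "joined G x y" if "y \<in> verts K" for y
    using K(2) x that KG by (simp add: connected_mixed_def joined_def)
  have "uends K e \<subseteq> {y. joined G x y}" if e: "e \<in> edges K" for e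
  proof -
    obtain u v where "uends K e = {u, v}" "u \<in> verts K" "v \<in> verts K"
      using K(1) e unfolding submixed_def mixed_graph_def by blast
    then show ?thesis using xy by simp
  qed
  moreover have "tail K a \<in> verts K" if "a \<in> arcs K" for a
    using K(1) that unfolding submixed_def mixed_graph_def by blast
  moreover have KG: "mixed_graph K" "verts K \<subseteq> verts G" "edges K \<subseteq> edges G" "arcs K \<subseteq> arcs G"
    "uends K = uends G" "tail K = tail G" "head K = head G"
    using K(1) by (auto simp: submixed_def)
  ultimately show ?thesis using xy by (auto simp: submixed_def)
qed

text \<open>The components defined by maximality are the subgraphs induced on the classes of mutually joined
vertices.\<close>

lemma component_of_iff:
  assumes G: "mixed_graph G"
  shows "component_of H G \<longleftrightarrow> (\<exists>x\<in>verts G. H = component G x)"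
proof
  assume H: "component_of H G"
  then have sub: "submixed H G" "connected_mixed H" by (auto simp: component_of_def)
  then obtain x where x: "x \<in> verts H" by (auto simp: submixed_def mixed_graph_def)
  then have xG: "x \<in> verts G" using sub by (auto simp: submixed_def)
  have "component G x = H"
    using H submixed_component[OF G xG] connected_component[OF xG]
      connected_submixed_component[OF G sub x] by (auto simp: component_of_def)
  then show "\<exists>x\<in>verts G. H = component G x" using xG by blast
next
  assume "\<exists>x\<in>verts G. H = component G x"
  then obtain x where x: "x \<in> verts G" and H: "H = component G x" by blast
  have "K = H" if K: "submixed K G" "connected_mixed K" "submixed H K" for K
  proof -
    have "x \<in> verts H" using x by (simp add: H joined_refl)
    then have "x \<in> verts K" using K(3) by (auto simp: submixed_def)
    then have "submixed K H" unfolding H by (rule connected_submixed_component[OF G K(1,2)])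
    then show ?thesis using K(3) by (rule submixed_antisym)
  qed
  then show "component_of H G"
    using submixed_component[OF G x] connected_component[OF x] by (auto simp: component_of_def H)
qed

lemma undirected_part_simps [simp]:
  "verts (undirected_part G) = verts G" "edges (undirected_part G) = edges G"
  "arcs (undirected_part G) = {}" "uends (undirected_part G) = uends G"
  "tail (undirected_part G) = tail G" "head (undirected_part G) = head G"
  by (simp_all add: undirected_part_def)

lemma mixed_graph_undirected_part: "mixed_graph G \<Longrightarrow> mixed_graph (undirected_part G)"
  by (simp add: mixed_graph_def)


section \<open>The cover of a mixed graph\<close>

text \<open>In the layer \<open>True\<close> the next arc of an alternating walk is traversed forward, in the layer \<open>False\<close> it is
traversed backward. The cover has no arcs; its fields \<open>tail\<close> and \<open>head\<close> are chosen to depend only on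
those of \<open>G\<close>, so that the cover of a submixed graph is a submixed graph of the cover.\<close>

definition cover :: "('v, 'e, 'a) mixed_graph \<Rightarrow> ('v \<times> bool, ('e \<times> bool) + 'a, 'a) mixed_graph" where
  "cover G = \<lparr>verts = verts G \<times> UNIV, edges = (edges G \<times> UNIV) <+> arcs G, arcs = {},
     uends = case_sum (\<lambda>(e, b). (\<lambda>v. (v, b)) ` uends G e) (\<lambda>a. {(tail G a, True), (head G a, False)}),
     tail = \<lambda>a. (tail G a, True), head = \<lambda>a. (head G a, False)\<rparr>"

lemma cover_simps [simp]:
  "verts (cover G) = verts G \<times> UNIV" "edges (cover G) = (edges G \<times> UNIV) <+> arcs G"
  "arcs (cover G) = {}" "uends (cover G) (Inl (e, b)) = (\<lambda>v. (v, b)) ` uends G e"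
  "uends (cover G) (Inr a) = {(tail G a, True), (head G a, False)}"
  by (simp_all add: cover_def)

lemma mixed_graph_cover:
  assumes "mixed_graph G"
  shows "mixed_graph (cover G)"
proof -
  have "\<exists>u\<in>verts G \<times> UNIV. \<exists>v\<in>verts G \<times> UNIV. uends (cover G) y = {u, v}"
    if "y \<in> (edges G \<times> UNIV) <+> arcs G" for y
  proof (cases y)
    case (Inl eb)
    obtain e b where "eb = (e, b)" by (cases eb)
    with Inl that have y: "y = Inl (e, b)" "e \<in> edges G" by auto
    with assms obtain u v where "u \<in> verts G" "v \<in> verts G" "uends G e = {u, v}"
      unfolding mixed_graph_def by blast
    then show ?thesis by (intro bexI[of _ "(u, b)"] bexI[of _ "(v, b)"]) (auto simp: y(1))
  next
    case (Inr a)
    then show ?thesis using assms that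
      by (intro bexI[of _ "(tail G a, True)"] bexI[of _ "(head G a, False)"]) (auto simp: mixed_graph_def)
  qed
  then show ?thesis using assms by (simp add: mixed_graph_def)
qed

lemma submixed_cover: "submixed H G \<Longrightarrow> submixed (cover H) (cover G)"
proof -
  assume H: "submixed H G"
  then have "mixed_graph (cover H)" by (auto simp: submixed_def intro: mixed_graph_cover)
  with H show ?thesis by (auto simp: submixed_def cover_def Plus_def)
qed


section \<open>Lifting alternating walks to the cover\<close>

text \<open>The layer after a step that is taken in the layer \<open>b\<close>.\<close>

fun turn :: "bool \<Rightarrow> ('e, 'a) step \<Rightarrow> bool" where
  "turn b (Edge e) = b"
| "turn b (Fwd a) = (\<not> b)"
| "turn b (Bwd a) = (\<not> b)"

text \<open>The edge of the cover above a step that is taken in the layer \<open>b\<close>.\<close>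

fun label :: "bool \<Rightarrow> ('e, 'a) step \<Rightarrow> ('e \<times> bool) + 'a" where
  "label b (Edge e) = Inl (e, b)"
| "label b (Fwd a) = Inr a"
| "label b (Bwd a) = Inr a"

fun lift_verts :: "bool \<Rightarrow> 'v list \<Rightarrow> ('e, 'a) step list \<Rightarrow> ('v \<times> bool) list" where
  "lift_verts b [] es = []"
| "lift_verts b (u # us) [] = [(u, b)]"
| "lift_verts b (u # us) (s # es) = (u, b) # lift_verts (turn b s) us es"

fun lift_edges :: "bool \<Rightarrow> ('e, 'a) step list \<Rightarrow> (('e \<times> bool) + 'a) list" where
  "lift_edges b [] = []"
| "lift_edges b (s # es) = label b s # lift_edges (turn b s) es"

text \<open>The walks that can be lifted to start in the layer \<open>b\<close>. A walk without arcs can be lifted to both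
layers.\<close>

fun alternates :: "bool \<Rightarrow> ('e, 'a) step list \<Rightarrow> bool" where
  "alternates b [] \<longleftrightarrow> True"
| "alternates b (Edge e # es) \<longleftrightarrow> alternates b es"
| "alternates b (Fwd a # es) \<longleftrightarrow> b \<and> alternates False es"
| "alternates b (Bwd a # es) \<longleftrightarrow> \<not> b \<and> alternates True es"

lemma alternates_iff:
  "alternates b es \<longleftrightarrow> successively (\<noteq>) (map snd (arc_seq es)) \<and>
     (arc_seq es \<noteq> [] \<longrightarrow> snd (hd (arc_seq es)) = b)"
  by (induction b es rule: alternates.induct) (auto simp: successively_Cons hd_map)

lemma alternating_walk_iff:
  "alternating_walk G us es \<longleftrightarrow> walk G us es \<and> arc_seq es \<noteq> [] \<and> (\<exists>b. alternates b es)"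
  unfolding alternating_walk_def alternates_iff by auto

lemma map_fst_lift_verts: "length us = Suc (length es) \<Longrightarrow> map fst (lift_verts b us es) = us"
  by (induction b us es rule: lift_verts.induct) auto

lemma length_lift_edges [simp]: "length (lift_edges b es) = length es"
  by (induction b es rule: lift_edges.induct) auto

lemma hd_lift_verts: "us \<noteq> [] \<Longrightarrow> hd (lift_verts b us es) = (hd us, b)"
  by (cases us; cases es) auto

lemma lift_verts_eq_Nil [simp]: "lift_verts b us es = [] \<longleftrightarrow> us = []"
  by (cases us; cases es) auto

lemma walk_lift:
  assumes "walk G us es" "alternates b es"
  shows "walk (cover G) (lift_verts b us es) (map Edge (lift_edges b es))"
  using assms
proof (induction b us es rule: lift_verts.induct)
  case (3 b u us s es)
  then have w: "us \<noteq> []" "u \<in> verts G" "is_step G u s (hd us)" "walk G us es"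
    by (auto simp: walk_Cons)
  have "alternates (turn b s) es" using "3.prems"(2) by (cases s) auto
  with w(4) have IH: "walk (cover G) (lift_verts (turn b s) us es) (map Edge (lift_edges (turn b s) es))"
    by (rule "3.IH")
  have "is_step (cover G) (u, b) (Edge (label b s)) (hd us, turn b s)"
    using w(3) "3.prems"(2) by (cases s) (auto simp: insert_commute)
  then show ?case using IH w(1,2) by (simp add: walk_Cons hd_lift_verts del: is_step.simps)
qed auto

fun unlift :: "bool \<Rightarrow> (('e \<times> bool) + 'a) list \<Rightarrow> ('e, 'a) step list" where
  "unlift b [] = []"
| "unlift b (Inl (e, c) # ys) = Edge e # unlift b ys"
| "unlift b (Inr a # ys) = (if b then Fwd a else Bwd a) # unlift (\<not> b) ys"

text \<open>Every walk in the cover is the lift of its projection, with the layer of its first vertex as the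
starting layer.\<close>

lemma walk_unlift:
  assumes "walk (cover G) xs (map Edge ys)" "b = snd (hd xs)"
  shows "walk G (map fst xs) (unlift b ys) \<and> alternates b (unlift b ys) \<and>
    lift_verts b (map fst xs) (unlift b ys) = xs \<and> lift_edges b (unlift b ys) = ys"
  using assms
proof (induction b ys arbitrary: xs rule: unlift.induct)
  case (2 b e c ys)
  then obtain x xs' where xs: "xs = x # xs'" by (cases xs) auto
  have w: "xs' \<noteq> []" "x \<in> verts (cover G)" "Inl (e, c) \<in> edges (cover G)"
    "(\<lambda>v. (v, c)) ` uends G e = {x, hd xs'}" "walk (cover G) xs' (map Edge ys)"
    using "2.prems"(1) by (auto simp: walk_Cons xs)
  obtain u v where uv: "x = (u, c)" "hd xs' = (v, c)" using w(4) by blast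
  have b: "b = c" using "2.prems"(2) by (simp add: xs uv)
  have "uends G e = fst ` ((\<lambda>v. (v, c)) ` uends G e)" by (simp add: image_image)
  then have "uends G e = {u, v}" using w(4) by (simp add: uv)
  moreover have "hd (map fst xs') = v" using w(1) uv by (simp add: hd_map)
  ultimately show ?case
    using "2.IH"[OF w(5)] w(1-3) uv by (auto simp: xs walk_Cons b)
next
  case (3 b a ys)
  then obtain x xs' where xs: "xs = x # xs'" by (cases xs) auto
  have w: "xs' \<noteq> []" "x \<in> verts (cover G)" "a \<in> arcs G"
    "{(tail G a, True), (head G a, False)} = {x, hd xs'}" "walk (cover G) xs' (map Edge ys)"
    using "3.prems"(1) by (auto simp: walk_Cons xs)
  have b: "b = snd x" using "3.prems"(2) by (simp add: xs)
  obtain v c where vc: "hd xs' = (v, c)" by (cases "hd xs'")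
  have *: "(if b then tail G a else head G a) = fst x" "(if b then head G a else tail G a) = fst (hd xs')"
      "snd (hd xs') = (\<not> b)"
    using w(4) by (auto simp: b vc doubleton_eq_iff)
  moreover have "hd (map fst xs') = fst (hd xs')" using w(1) by (simp add: hd_map)
  ultimately show ?case
    using "3.IH"[OF w(5)] w(1-3) by (cases b) (auto simp: xs walk_Cons b)
qed (auto simp: walk_Cons)

lemma arc_seq_append [simp]: "arc_seq (es @ fs) = arc_seq es @ arc_seq fs"
  by (induction es rule: arc_seq.induct) auto

lemma snd_lift_verts:
  "i < length us \<Longrightarrow> i \<le> length es \<Longrightarrow> snd (lift_verts b us es ! i) = (b = even (num_arcs (take i es)))"
proof (induction b us es arbitrary: i rule: lift_verts.induct)
  case (3 b u us s es)
  then show ?case by (cases i; cases s) auto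
qed auto

lemma lift_edges_nth:
  "i < length es \<Longrightarrow> lift_edges b es ! i = label (b = even (num_arcs (take i es))) (es ! i)"
proof (induction b es arbitrary: i rule: lift_edges.induct)
  case (2 b s es)
  then show ?case by (cases i; cases s; cases b) auto
qed simp

text \<open>The layer of a lifted walk changes with every arc. So two positions are separated by an odd number of
arcs exactly if they are in different layers, and this is how the parity conditions on alternating
paths become conditions of distinctness.\<close>

lemma odd_arcs_between:
  assumes "i \<le> j" "j \<le> length es"
  shows "odd (arcs_between es i j) \<longleftrightarrow>
    (b = even (num_arcs (take i es))) \<noteq> (b = even (num_arcs (take j es)))"
proof -
  have "take j es = take i es @ take (j - i) (drop i es)"
    using assms(1) by (metis le_add_diff_inverse take_add)
  then have "num_arcs (take j es) = num_arcs (take i es) + arcs_between es i j"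
    by (simp add: arcs_between_def)
  then show ?thesis by auto
qed

lemma distinct_iff_count: "distinct xs \<longleftrightarrow> (\<forall>x. count_list xs x \<le> 1)"
proof (induction xs)
  case (Cons y xs)
  have "y \<notin> set xs \<longleftrightarrow> count_list xs y = 0" by (simp add: count_list_0_iff)
  with Cons show ?case by (auto simp: le_Suc_eq)
qed simp

lemma count_list_map_fst:
  "count_list (map fst xs) v = count_list xs (v, True) + count_list xs (v, False)"
  by (induction xs) auto

lemma count_lift_edges:
  "count_list es (Edge e) = count_list (lift_edges b es) (Inl (e, True)) + count_list (lift_edges b es) (Inl (e, False))"
  "count_list (map fst (arc_seq es)) a = count_list (lift_edges b es) (Inr a)"
proof -
  show "count_list es (Edge e) = count_list (lift_edges b es) (Inl (e, True)) + count_list (lift_edges b es) (Inl (e, False))"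
  proof (induction b es rule: lift_edges.induct)
    case (2 b s es)
    then show ?case by (cases s) auto
  qed simp
  show "count_list (map fst (arc_seq es)) a = count_list (lift_edges b es) (Inr a)"
  proof (induction b es rule: lift_edges.induct)
    case (2 b s es)
    then show ?case by (cases s) auto
  qed simp
qed

lemma Inr_in_lift_edges: "Inr a \<in> set (lift_edges b es) \<longleftrightarrow> a \<in> fst ` set (arc_seq es)"
  using count_lift_edges(2)[of es a b] count_list_0_iff[of "lift_edges b es" "Inr a"]
    count_list_0_iff[of "map fst (arc_seq es)" a] by auto

text \<open>Two passages through the same edge in the same layer are separated by an even number of arcs, and an
arc has only one copy in the cover.\<close>

lemma distinct_lift_edges_iff:
  "distinct (lift_edges b es) \<longleftrightarrow> (\<forall>e. edge_ok es e) \<and> distinct (map fst (arc_seq es))"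
proof
  assume *: "distinct (lift_edges b es)"
  then have le: "count_list (lift_edges b es) y \<le> 1" for y by (simp add: distinct_iff_count)
  have "edge_ok es e" for e
    unfolding edge_ok_def
  proof (intro conjI allI impI)
    show "count_list es (Edge e) \<le> 2"
      using le[of "Inl (e, True)"] le[of "Inl (e, False)"] by (simp add: count_lift_edges(1)[of _ _ b])
    fix i j assume ij: "i < j \<and> j < length es \<and> es ! i = Edge e \<and> es ! j = Edge e"
    then have "lift_edges b es ! i \<noteq> lift_edges b es ! j" using * by (simp add: nth_eq_iff_index_eq)
    then show "odd (arcs_between es i j)" using ij odd_arcs_between[of i j es b] by (auto simp: lift_edges_nth)
  qed
  moreover have "distinct (map fst (arc_seq es))"
    unfolding distinct_iff_count count_lift_edges(2)[of _ _ b] using le by blast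
  ultimately show "(\<forall>e. edge_ok es e) \<and> distinct (map fst (arc_seq es))" by blast
next
  assume *: "(\<forall>e. edge_ok es e) \<and> distinct (map fst (arc_seq es))"
  show "distinct (lift_edges b es)"
  proof (rule ccontr)
    assume "\<not> distinct (lift_edges b es)"
    then obtain i j where ij: "i < j" "j < length es" "lift_edges b es ! i = lift_edges b es ! j"
      by (auto simp: distinct_conv_nth) (metis linorder_neqE_nat)
    show False
    proof (cases "lift_edges b es ! i")
      case (Inl ec)
      then obtain e c where y: "lift_edges b es ! i = Inl (e, c)" by (cases ec) auto
      then have "label (b = even (num_arcs (take i es))) (es ! i) = Inl (e, c)"
        "label (b = even (num_arcs (take j es))) (es ! j) = Inl (e, c)"
        using ij by (simp_all add: lift_edges_nth)
      then have "es ! i = Edge e" "es ! j = Edge e"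
        "(b = even (num_arcs (take i es))) = (b = even (num_arcs (take j es)))"
        by (cases "es ! i"; cases "es ! j"; simp)+
      then show False using * ij odd_arcs_between[of i j es b] by (auto simp: edge_ok_def)
    next
      case (Inr a)
      have "count_list (map fst (arc_seq es)) a \<le> 1" using * by (simp only: distinct_iff_count)
      then have "count_list (lift_edges b es) (Inr a) \<le> 1" by (simp add: count_lift_edges(2)[of _ _ b])
      moreover have "card {i, j} \<le> card {k. k < length es \<and> lift_edges b es ! k = Inr a}"
        using ij Inr by (intro card_mono) auto
      moreover have "count_list (lift_edges b es) (Inr a) = card {k. k < length es \<and> lift_edges b es ! k = Inr a}"
        by (simp add: count_list_eq_length_filter length_filter_conv_card eq_commute)
      ultimately show False using ij(1) by simp
    qed
  qed
qed

lemma lift_verts_nth: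
  assumes "length us = Suc (length es)" "i \<le> length es"
  shows "lift_verts b us es ! i = (us ! i, b = even (num_arcs (take i es)))"
proof -
  have "fst (lift_verts b us es ! i) = map fst (lift_verts b us es) ! i"
    using assms map_fst_lift_verts[OF assms(1), of b] by (metis le_imp_less_Suc length_map nth_map)
  then have "fst (lift_verts b us es ! i) = us ! i" by (simp add: map_fst_lift_verts assms(1))
  moreover have "snd (lift_verts b us es ! i) = (b = even (num_arcs (take i es)))"
    using assms by (intro snd_lift_verts) auto
  ultimately show ?thesis by (simp add: prod_eq_iff)
qed

lemma length_lift_verts: "length us = Suc (length es) \<Longrightarrow> length (lift_verts b us es) = length us"
  using map_fst_lift_verts by (metis length_map)

lemma lift_verts_eq_iff:
  assumes "length us = Suc (length es)" "i < j" "j \<le> length es"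
  shows "lift_verts b us es ! i = lift_verts b us es ! j \<longleftrightarrow> us ! i = us ! j \<and> even (arcs_between es i j)"
  using assms odd_arcs_between[of i j es b] by (auto simp: lift_verts_nth)

text \<open>A repeated vertex of the walk is allowed exactly if its occurrences are in different layers. As there
are only two layers, a vertex then occurs at most twice.\<close>

lemma distinct_lift_verts_iff:
  assumes len: "length us = Suc (length es)"
  shows "distinct (lift_verts b us es) \<longleftrightarrow> (\<forall>u. vertex_ok us es u)"
proof
  assume *: "distinct (lift_verts b us es)"
  then have le: "count_list (lift_verts b us es) y \<le> 1" for y by (simp only: distinct_iff_count)
  have "count_list us u \<le> 2" for u
    using le[of "(u, True)"] le[of "(u, False)"] count_list_map_fst[of "lift_verts b us es" u]
    by (simp add: map_fst_lift_verts len)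
  moreover have "odd (arcs_between es i j)" if "i < j" "j < length us" "us ! i = us ! j" for i j
    using * that lift_verts_eq_iff[OF len that(1), of b] length_lift_verts[OF len, of b] len
    by (auto simp: distinct_conv_nth)
  ultimately show "\<forall>u. vertex_ok us es u" by (simp add: vertex_ok_def)
next
  assume *: "\<forall>u. vertex_ok us es u"
  show "distinct (lift_verts b us es)"
  proof (rule ccontr)
    assume "\<not> distinct (lift_verts b us es)"
    then obtain i j where ij: "i < j" "j < length us" "lift_verts b us es ! i = lift_verts b us es ! j"
      by (auto simp: distinct_conv_nth length_lift_verts[OF len]) (metis linorder_neqE_nat)
    then have "us ! i = us ! j" "even (arcs_between es i j)"
      using lift_verts_eq_iff[OF len ij(1), of b] len by auto
    then show False using * ij by (auto simp: vertex_ok_def)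
  qed
qed


section \<open>Paths and cycles in multigraphs\<close>

definition edge_path :: "('v, 'e, 'a) mixed_graph \<Rightarrow> 'v list \<Rightarrow> 'e list \<Rightarrow> bool" where
  "edge_path K xs ys \<longleftrightarrow> walk K xs (map Edge ys) \<and> distinct xs"

text \<open>The closing vertex is listed twice, at both ends of \<open>xs\<close>. The condition \<open>distinct ys\<close> excludes that a
single edge is passed to and fro.\<close>

definition edge_cycle :: "('v, 'e, 'a) mixed_graph \<Rightarrow> 'v list \<Rightarrow> 'e list \<Rightarrow> bool" where
  "edge_cycle K xs ys \<longleftrightarrow> walk K xs (map Edge ys) \<and> ys \<noteq> [] \<and> hd xs = last xs \<and>
     distinct (tl xs) \<and> distinct ys"

lemma walk_edge_ends:
  "walk K xs (map Edge ys) \<Longrightarrow> y \<in> set ys \<Longrightarrow> y \<in> edges K \<and> uends K y \<subseteq> set xs"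
proof (induction ys arbitrary: xs)
  case (Cons z ys)
  then obtain x xs' where xs: "xs = x # xs'" by (cases xs) auto
  with Cons.prems(1) have "xs' \<noteq> []" "z \<in> edges K" "uends K z = {x, hd xs'}" "walk K xs' (map Edge ys)"
    by (auto simp: walk_Cons)
  then show ?case using Cons.IH Cons.prems(2) by (force simp: xs)
qed simp

lemma edge_path_Cons:
  "edge_path K (x # xs) (y # ys) \<longleftrightarrow> xs \<noteq> [] \<and> x \<in> verts K \<and> x \<notin> set xs \<and> y \<in> edges K \<and>
     uends K y = {x, hd xs} \<and> edge_path K xs ys"
  by (auto simp: edge_path_def walk_Cons)

lemma edge_path_distinct: "edge_path K xs ys \<Longrightarrow> distinct ys"
proof (induction ys arbitrary: xs)
  case (Cons y ys)
  then obtain x xs' where xs: "xs = x # xs'" by (cases xs) (auto simp: edge_path_def)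
  have p: "x \<notin> set xs'" "uends K y = {x, hd xs'}" "edge_path K xs' ys"
    using Cons.prems by (auto simp: xs edge_path_Cons)
  then have "y \<notin> set ys" using walk_edge_ends[of K xs' ys y] by (auto simp: edge_path_def)
  then show ?case using Cons.IH[OF p(3)] by simp
qed simp

text \<open>Follow the path from its start until it first meets an end of \<open>f\<close>, and leave it there along \<open>f\<close>. The
bound on the vertices of the new path allows it to be extended at its start.\<close>

lemma path_absorbs_edge:
  assumes "edge_path K (x # xs) ys" "f \<in> edges K" "uends K f = {p, q}" "p \<noteq> q"
    and "p \<in> verts K" "q \<in> verts K" "uends K f \<inter> set (x # xs) \<noteq> {}"
  shows "\<exists>xs' ys'. edge_path K (x # xs') ys' \<and> f \<in> set ys' \<and> set xs' \<subseteq> set xs \<union> {p, q}"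
  using assms
proof (induction ys arbitrary: x xs)
  case Nil
  then have "x = p \<or> x = q" "xs = []" by (auto simp: edge_path_def walk_def)
  moreover have "edge_path K [p, q] [f]" "edge_path K [q, p] [f]"
    using Nil.prems by (auto simp: edge_path_def walk_Cons insert_commute)
  ultimately show ?case by force
next
  case (Cons y ys)
  show ?case
  proof (cases "x \<in> {p, q}")
    case True
    have "edge_path K [p, q] [f]" "edge_path K [q, p] [f]"
      using Cons.prems by (auto simp: edge_path_def walk_Cons insert_commute)
    then show ?thesis using True by force
  next
    case False
    have px: "xs \<noteq> []" "x \<in> verts K" "x \<notin> set xs" "y \<in> edges K" "uends K y = {x, hd xs}" "edge_path K xs ys"
      using Cons.prems(1) by (auto simp: edge_path_Cons)
    obtain z zs where xs: "xs = z # zs" using px(1) by (cases xs) auto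
    obtain xs' ys' where IH: "edge_path K (z # xs') ys'" "f \<in> set ys'" "set xs' \<subseteq> set zs \<union> {p, q}"
      using Cons.IH[of z zs] Cons.prems px(6) False by (auto simp: xs)
    have "edge_path K (x # z # xs') (y # ys')"
      using px False IH by (auto simp: edge_path_Cons xs)
    then show ?thesis using IH by (intro exI[of _ "z # xs'"] exI[of _ "y # ys'"]) (auto simp: xs)
  qed
qed

text \<open>If \<open>g\<close> is the first edge of the path, its first vertex is no end of \<open>f\<close>, and the rest of the path can
be made to absorb \<open>f\<close>. If \<open>f\<close> meets the path only in the first vertex, \<open>f\<close> is put in front. In all other
cases the first vertex can be dropped.\<close>

lemma path_through_two_edges:
  assumes "edge_path K xs ys" "g \<in> set ys" "f \<in> edges K" "uends K f = {p, q}" "p \<noteq> q"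
    and "p \<in> verts K" "q \<in> verts K" "uends K f \<inter> set xs \<noteq> {}" "uends K f \<inter> uends K g = {}"
  shows "\<exists>xs' ys'. edge_path K xs' ys' \<and> f \<in> set ys' \<and> g \<in> set ys'"
  using assms
proof (induction ys arbitrary: xs)
  case (Cons y ys)
  obtain x xs1 where xs1: "xs = x # xs1" using Cons.prems(1) by (cases xs) (auto simp: edge_path_def)
  have px: "xs1 \<noteq> []" "x \<in> verts K" "x \<notin> set xs1" "y \<in> edges K" "uends K y = {x, hd xs1}" "edge_path K xs1 ys"
    using Cons.prems(1) by (auto simp: edge_path_Cons xs1)
  obtain z zs where xs: "xs1 = z # zs" using px(1) by (cases xs1) auto
  show ?case
  proof (cases "g = y")
    case True
    then have x: "x \<notin> {p, q}" using Cons.prems(4,9) px(5) by auto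
    obtain xs' ys' where IH: "edge_path K (z # xs') ys'" "f \<in> set ys'" "set xs' \<subseteq> set zs \<union> {p, q}"
      using path_absorbs_edge[of K z zs ys f p q] Cons.prems px(6) x by (auto simp: xs xs1)
    have "edge_path K (x # z # xs') (y # ys')"
      using px x IH by (auto simp: edge_path_Cons xs)
    then show ?thesis using IH(2) True by (metis list.set_intros)
  next
    case False
    then have g: "g \<in> set ys" using Cons.prems(2) by simp
    show ?thesis
    proof (cases "uends K f \<inter> set xs1 = {}")
      case True
      then obtain w where w: "uends K f = {w, x}" "w \<noteq> x" "w \<in> verts K"
        using Cons.prems by (auto simp: xs1)
      then have "edge_path K (w # xs) (f # y # ys)"
        using Cons.prems(1,3) True by (auto simp: edge_path_Cons xs1)
      then show ?thesis using g by (metis list.set_intros)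
    next
      case False
      then show ?thesis using Cons.IH[OF px(6) g] Cons.prems by auto
    qed
  qed
qed simp

lemma walk_butlast: "walk K us es \<Longrightarrow> es \<noteq> [] \<Longrightarrow> walk K (butlast us) (butlast es)"
  by (auto simp: walk_def nth_butlast dest: in_set_butlastD)

text \<open>A cycle without one of its edges other than \<open>g\<close> is a path with the same vertices that still contains
\<open>g\<close>.\<close>

lemma cycle_through_two_edges:
  assumes c: "edge_cycle K xs ys" and g: "g \<in> set ys" and f: "f \<in> edges K" "uends K f = {p, q}" "p \<noteq> q"
    "p \<in> verts K" "q \<in> verts K" and meet: "uends K f \<inter> set xs \<noteq> {}" and disj: "uends K f \<inter> uends K g = {}"
  shows "\<exists>xs' ys'. edge_path K xs' ys' \<and> f \<in> set ys' \<and> g \<in> set ys'"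
proof -
  obtain y ys1 where ys: "ys = y # ys1" using g by (cases ys) auto
  obtain x xs1 where xs: "xs = x # xs1" using c by (cases xs) (auto simp: edge_cycle_def)
  have w: "xs1 \<noteq> []" "uends K y = {x, hd xs1}" "walk K xs1 (map Edge ys1)" "x = last xs1" "distinct xs1"
    using c by (auto simp: edge_cycle_def xs ys walk_Cons)
  have set: "set xs1 = set xs" using w by (auto simp: xs)
  show ?thesis
  proof (cases "g \<in> set ys1")
    case True
    have "edge_path K xs1 ys1" using w by (simp add: edge_path_def)
    then show ?thesis
      by (rule path_through_two_edges[OF _ True f _ disj]) (use meet set in simp)
  next
    case False
    then have gy: "g = y" using g ys by simp
    have "ys1 \<noteq> []"
    proof
      assume "ys1 = []"
      then have "xs1 = [x]" using w(3,4) by (auto simp: walk_def length_Suc_conv)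
      then show False using meet disj w(2) gy by (auto simp: xs)
    qed
    have "walk K (butlast xs) (map Edge (butlast ys))"
      using walk_butlast[of K xs "map Edge ys"] c by (simp add: edge_cycle_def map_butlast)
    moreover have "distinct (butlast xs)" "set (butlast xs) = set xs"
    proof -
      have "xs1 = butlast xs1 @ [x]" using w(1,4) by simp
      then have "distinct (butlast xs1 @ [x])" "set xs1 = insert x (set (butlast xs1))"
        using w(5) by (metis, metis set_append list.simps(15) empty_set Un_insert_right sup_bot_right)
      then show "distinct (butlast xs)" "set (butlast xs) = set xs" using w(1) by (auto simp: xs)
    qed
    ultimately have "edge_path K (butlast xs) (butlast ys)" "set (butlast xs) = set xs"
      by (simp_all add: edge_path_def)
    moreover have "g \<in> set (butlast ys)" using gy \<open>ys1 \<noteq> []\<close> by (simp add: ys)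
    ultimately show ?thesis
      using path_through_two_edges[OF _ _ f, of "butlast xs" "butlast ys" g] meet disj by simp
  qed
qed


section \<open>Alternating paths and cycles as paths and cycles of the cover\<close>

lemma ends_in_verts: "mixed_graph G \<Longrightarrow> e \<in> edges G \<Longrightarrow> uends G e \<subseteq> verts G"
  using joined_edge joined_verts by (metis subsetI)

lemma alternating_walk_has_arc:
  assumes "alternating_walk H us es"
  shows "\<exists>a\<in>arcs H. a \<in> fst ` set (arc_seq es)"
proof -
  have "fst ` set (arc_seq es) \<subseteq> arcs H" if "walk H us es" for us
    using that
  proof (induction es arbitrary: us)
    case (Cons s es)
    then obtain u us' where "us = u # us'" by (cases us) auto
    then have "is_step H u s (hd us')" "walk H us' es" using Cons.prems by (auto simp: walk_Cons)
    then show ?case using Cons.IH[of us'] by (cases s) auto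
  qed simp
  moreover have "arc_seq es \<noteq> []" "walk H us es" using assms by (auto simp: alternating_walk_def)
  ultimately show ?thesis by (metis image_is_empty set_empty subset_eq ex_in_conv)
qed

text \<open>The numbers of passages through edges are kept because the properties AP and AC are expressed by
them.\<close>

lemma alternating_path_lift:
  assumes "alternating_path H us es"
  shows "\<exists>xs ys. edge_path (cover H) xs ys \<and>
    (\<forall>e. count_list es (Edge e) = count_list ys (Inl (e, True)) + count_list ys (Inl (e, False))) \<and>
    (\<forall>a. Inr a \<in> set ys \<longleftrightarrow> a \<in> fst ` set (arc_seq es)) \<and> (\<exists>a\<in>arcs H. Inr a \<in> set ys)"
proof -
  have w: "walk H us es" and vok: "\<forall>u. vertex_ok us es u"
    using assms by (auto simp: alternating_path_def alternating_walk_def)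
  obtain b where b: "alternates b es"
    using assms by (auto simp: alternating_path_def alternating_walk_iff)
  have len: "length us = Suc (length es)" using w by (simp add: walk_def)
  have "edge_path (cover H) (lift_verts b us es) (lift_edges b es)"
    using walk_lift[OF w b] vok distinct_lift_verts_iff[OF len] by (simp add: edge_path_def)
  moreover have "\<exists>a\<in>arcs H. Inr a \<in> set (lift_edges b es)"
    unfolding Inr_in_lift_edges using assms alternating_walk_has_arc by (auto simp: alternating_path_def)
  ultimately show ?thesis
    using count_lift_edges(1)[of es _ b] Inr_in_lift_edges[of _ b es] by blast
qed

text \<open>Only the copies of arcs connect the two layers.\<close>

lemma layer_constant:
  assumes "walk (cover H) xs (map Edge ys)" "\<And>a. Inr a \<notin> set ys" "Inl (e, c) \<in> set ys"
  shows "c = snd (hd xs)"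
  using assms
proof (induction ys arbitrary: xs)
  case (Cons y ys)
  obtain x xs' where xs: "xs = x # xs'" using Cons.prems(1) by (cases xs) auto
  have w: "walk (cover H) xs' (map Edge ys)" "uends (cover H) y = {x, hd xs'}"
    using Cons.prems(1) by (auto simp: walk_Cons xs)
  obtain e' c' where y: "y = Inl (e', c')" using Cons.prems(2) by (cases y) auto
  have "(\<lambda>v. (v, c')) ` uends H e' = {x, hd xs'}" using w(2) by (simp add: y)
  then have "x \<in> (\<lambda>v. (v, c')) ` uends H e'" "hd xs' \<in> (\<lambda>v. (v, c')) ` uends H e'" by simp_all
  then have "snd x = c'" "snd (hd xs') = c'" by auto
  moreover have "c = snd (hd xs')" if "Inl (e, c) \<in> set ys"
    using Cons.IH[OF w(1)] Cons.prems(2) that by simp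
  ultimately show ?case using Cons.prems(3) by (auto simp: xs y)
qed simp

text \<open>A path of the cover that contains both copies of an edge changes the layer and so contains an arc.
This is why its projection is an alternating path and not just a walk without arcs.\<close>

lemma mem_Omega_if_both_lifts:
  assumes p: "edge_path (cover H) xs ys" and e: "Inl (e, True) \<in> set ys" "Inl (e, False) \<in> set ys"
  shows "e \<in> Omega H"
proof -
  define b us es where "b = snd (hd xs)" and "us = map fst xs" and "es = unlift b ys"
  have w: "walk (cover H) xs (map Edge ys)" using p by (simp add: edge_path_def)
  have l: "walk H us es" "alternates b es" "lift_verts b us es = xs" "lift_edges b es = ys"
    using walk_unlift[OF w b_def] by (simp_all add: us_def es_def)
  have "\<exists>a. Inr a \<in> set ys"
  proof (rule ccontr)
    assume "\<nexists>a. Inr a \<in> set ys"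
    then have "True = snd (hd xs)" "False = snd (hd xs)"
      using layer_constant[OF w] e by blast+
    then show False by simp
  qed
  then have "arc_seq es \<noteq> []" using Inr_in_lift_edges[of _ b es] l(4) by auto
  moreover have "length us = Suc (length es)" using l(1) by (simp add: walk_def)
  moreover have "distinct xs" "distinct ys" using p edge_path_distinct by (auto simp: edge_path_def)
  ultimately have "alternating_path H us es"
    unfolding alternating_path_def alternating_walk_iff
    using l distinct_lift_verts_iff[of us es b] distinct_lift_edges_iff[of b es] by auto
  moreover have "count_list es (Edge e) = 2"
  proof -
    have "count_list ys y = 1" if "y \<in> set ys" for y
      using that \<open>distinct ys\<close> distinct_iff_count[of ys] count_list_0_iff[of ys y] by (metis le_neq_implies_less less_one)
    then show ?thesis using e count_lift_edges(1)[of es e b] l(4) by simp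
  qed
  moreover have "e \<in> edges H" using walk_edge_ends[OF w e(1)] by auto
  ultimately show ?thesis by (auto simp: Omega_def)
qed

lemma count_list_eq_card: "count_list xs x = card {i. i < length xs \<and> xs ! i = x}"
  by (simp add: count_list_eq_length_filter length_filter_conv_card eq_commute)

text \<open>For the starting vertex the parity condition is only stated for consecutive occurrences. It has
at most three occurrences, two of them at the ends, so that any two occurrences other than both ends
are consecutive.\<close>

lemma alternating_cycle_repetition:
  assumes c: "alternating_cycle H us es" and ij: "i < j" "j < length us" "us ! i = us ! j"
    and ends: "\<not> (i = 0 \<and> Suc j = length us)"
  shows "odd (arcs_between es i j)"
proof (cases "us ! i = hd us")
  case False
  then have "vertex_ok us es (us ! i)" using c by (simp add: alternating_cycle_def)
  then show ?thesis using ij by (auto simp: vertex_ok_def)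
next
  case True
  let ?P = "{k. k < length us \<and> us ! k = hd us}" and ?L = "length us - 1"
  have ne: "us \<noteq> []" using ij by auto
  have ends_P: "0 \<in> ?P" "?L \<in> ?P" "i \<in> ?P" "j \<in> ?P"
    using ne True ij c by (auto simp: hd_conv_nth last_conv_nth alternating_cycle_def)
  have count: "count_list us (hd us) = card ?P" by (rule count_list_eq_card)
  have "card {0, ?L, i, j} \<le> card ?P" using ends_P by (intro card_mono) auto
  moreover have le: "card ?P \<le> 3"
    using c unfolding alternating_cycle_def count[symmetric] by blast
  moreover have "card {0, ?L, i, j} = 4" if "0 < i \<and> j < ?L" using that ij by simp
  ultimately have "\<not> (0 < i \<and> j < ?L)" by fastforce
  then have cases: "i = 0 \<or> j = ?L" using ij by linarith
  \<comment> \<open>Exactly one of the two positions is an end, so the four numbers are three positions.\<close>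
  have three: "card {0, ?L, i, j} = 3" using cases ends ij by (auto simp: insert_commute)
  then have P: "{0, ?L, i, j} = ?P" using ends_P le by (intro card_seteq) auto
  have "card ?P = 3" using three unfolding P .
  moreover have "us ! k \<noteq> hd us" if k: "i < k" "k < j" for k
  proof
    assume "us ! k = hd us"
    then have "k \<in> ?P" using k ij by simp
    then have "k \<in> {0, ?L, i, j}" unfolding P .
    then show False using k ij cases by auto
  qed
  ultimately show ?thesis
    using c ij True unfolding alternating_cycle_def count by metis
qed

text \<open>The number of arcs has to be even, for otherwise the lift ends in the layer opposite to its start and
is not closed.\<close>

lemma alternating_cycle_lift:
  assumes c: "alternating_cycle H us es" and even: "even (num_arcs es)"
  shows "\<exists>xs ys. edge_cycle (cover H) xs ys \<and>
    (\<forall>e. count_list es (Edge e) = count_list ys (Inl (e, True)) + count_list ys (Inl (e, False))) \<and>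
    (\<forall>a. Inr a \<in> set ys \<longleftrightarrow> a \<in> fst ` set (arc_seq es)) \<and> (\<exists>a\<in>arcs H. Inr a \<in> set ys)"
proof -
  have w: "walk H us es" and arc: "arc_seq es \<noteq> []" and aw: "alternating_walk H us es"
    using c by (auto simp: alternating_cycle_def alternating_walk_def)
  obtain b where b: "alternates b es"
    using c by (auto simp: alternating_cycle_def alternating_walk_iff)
  define xs where "xs = lift_verts b us es"
  have len: "length us = Suc (length es)" using w by (simp add: walk_def)
  then have lx: "length xs = Suc (length es)" by (simp add: xs_def length_lift_verts)
  have ne: "us \<noteq> []" "xs \<noteq> []" using len lx by auto
  have closed: "hd xs = last xs"
  proof -
    have "us ! 0 = us ! length es"
      using c ne len by (simp add: alternating_cycle_def hd_conv_nth last_conv_nth)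
    then show ?thesis using even ne lx len
      by (simp add: hd_conv_nth last_conv_nth) (simp add: xs_def lift_verts_nth)
  qed
  have "distinct (tl xs)"
  proof (rule ccontr)
    assume "\<not> distinct (tl xs)"
    then obtain i j where ij: "i < j" "j < length (tl xs)" "tl xs ! i = tl xs ! j"
      by (auto simp: distinct_conv_nth) (metis linorder_neqE_nat)
    then have "xs ! Suc i = xs ! Suc j" "Suc i < Suc j" "Suc j \<le> length es"
      using lx by (auto simp: nth_tl)
    then show False
      using lift_verts_eq_iff[OF len, of "Suc i" "Suc j" b] alternating_cycle_repetition[OF c, of "Suc i" "Suc j"] len
      by (auto simp: xs_def)
  qed
  moreover have "distinct (lift_edges b es)"
    using c distinct_lift_edges_iff[of b es] by (simp add: alternating_cycle_def)
  moreover have "lift_edges b es \<noteq> []" using arc by (cases es) auto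
  ultimately have "edge_cycle (cover H) xs (lift_edges b es)"
    using walk_lift[OF w b] closed by (simp add: edge_cycle_def xs_def)
  moreover have "\<exists>a\<in>arcs H. Inr a \<in> set (lift_edges b es)"
    unfolding Inr_in_lift_edges using aw by (rule alternating_walk_has_arc)
  ultimately show ?thesis
    using count_lift_edges(1)[of es _ b] Inr_in_lift_edges[of _ b es] by blast
qed


section \<open>Shadows of the components of the cover\<close>

definition shadow :: "('v, 'e, 'a) mixed_graph \<Rightarrow> ('v \<times> bool, ('e \<times> bool) + 'a, 'a) mixed_graph
    \<Rightarrow> ('v, 'e, 'a) mixed_graph" where
  "shadow G C = G\<lparr>verts := fst ` verts C, edges := {e. \<exists>b. Inl (e, b) \<in> edges C}, arcs := {a. Inr a \<in> edges C}\<rparr>"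

lemma shadow_simps [simp]:
  "verts (shadow G C) = fst ` verts C" "edges (shadow G C) = {e. \<exists>b. Inl (e, b) \<in> edges C}"
  "arcs (shadow G C) = {a. Inr a \<in> edges C}"
  "uends (shadow G C) = uends G" "tail (shadow G C) = tail G" "head (shadow G C) = head G"
  by (simp_all add: shadow_def)

abbreviation "cover_component G z \<equiv> component (cover G) z"

lemma uends_cover_shadow [simp]: "uends (cover (shadow G C)) = uends (cover G)"
  by (simp add: cover_def)

lemma submixed_shadow:
  assumes G: "mixed_graph G" and z: "z \<in> verts (cover G)"
  shows "submixed (shadow G (cover_component G z)) G"
proof -
  let ?C = "cover_component G z" and ?H = "shadow G (cover_component G z)"
  have V: "verts ?C \<subseteq> verts G \<times> UNIV" using joined_verts[of "cover G" z] by auto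
  have E: "edges ?H \<subseteq> edges G" "arcs ?H \<subseteq> arcs G" by auto
  have fin: "finite (verts G)" "finite (edges G)" "finite (arcs G)"
    using G by (auto simp: mixed_graph_def)
  have fins: "finite (edges ?H)" "finite (arcs ?H)"
    using finite_subset[OF E(1) fin(2)] finite_subset[OF E(2) fin(3)] .
  have sub: "verts ?H \<subseteq> verts G" using V by auto
  then have "finite (verts ?H)" using fin(1) by (rule finite_subset)
  moreover have "z \<in> verts ?C" using joined_refl[OF z] by simp
  then have "verts ?H \<noteq> {}" unfolding shadow_simps by blast
  moreover have "\<exists>u\<in>verts ?H. \<exists>v\<in>verts ?H. uends G e = {u, v}" if e: "e \<in> edges ?H" for e
  proof -
    obtain b where b: "Inl (e, b) \<in> edges ?C" using e by auto
    obtain u v where uv: "uends G e = {u, v}" using G e E(1) unfolding mixed_graph_def by blast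
    have "uends (cover G) (Inl (e, b)) \<subseteq> verts ?C" using b by (simp only: component_simps) blast
    then have "{(u, b), (v, b)} \<subseteq> verts ?C" by (simp add: uv)
    then have "u \<in> fst ` verts ?C" "v \<in> fst ` verts ?C" by (simp_all only: insert_subset) force+
    then show ?thesis using uv unfolding shadow_simps by blast
  qed
  moreover have "tail G a \<in> verts ?H \<and> head G a \<in> verts ?H" if "a \<in> arcs ?H" for a
    using that by force
  ultimately have "mixed_graph ?H"
    using fins by (simp only: mixed_graph_def shadow_simps) blast
  then show ?thesis using sub E by (simp add: submixed_def)
qed

lemma joined_walk_verts:
  assumes "walk K xs es" "u \<in> set xs" "v \<in> set xs"
  shows "joined K u v"
proof -
  have "joined K (hd xs) w" if "walk K xs es" "w \<in> set xs" for xs w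
    using that
  proof (induction es arbitrary: xs)
    case Nil
    then show ?case by (auto intro: joined_refl)
  next
    case (Cons s es)
    then obtain x xs' where xs: "xs = x # xs'" by (cases xs) auto
    have w: "xs' \<noteq> []" "x \<in> verts K" "is_step K x s (hd xs')" "walk K xs' es"
      using Cons.prems by (auto simp: walk_Cons xs)
    then have "joined K x (hd xs')" using walk_set[OF w(4)] by (intro joined_step) auto
    then show ?case using Cons.IH[OF w(4)] Cons.prems(2) w(2)
      by (auto simp: xs intro: joined_refl joined_trans)
  qed
  then show ?thesis using assms by (blast intro: joined_sym joined_trans)
qed

lemma path_has_no_loop: "edge_path K xs ys \<Longrightarrow> y \<in> set ys \<Longrightarrow> uends K y \<noteq> {p}"
proof (induction ys arbitrary: xs)
  case (Cons y' ys)
  obtain x xs' where xs: "xs = x # xs'" using Cons.prems(1) by (cases xs) (auto simp: edge_path_def)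
  have px: "xs' \<noteq> []" "x \<notin> set xs'" "uends K y' = {x, hd xs'}" "edge_path K xs' ys"
    using Cons.prems(1) by (auto simp: edge_path_Cons xs)
  have "hd xs' \<noteq> x" using px(1,2) hd_in_set by metis
  then show ?case using Cons.IH[OF px(4)] Cons.prems(2) px(3) by (auto simp: doubleton_eq_iff)
qed simp

text \<open>A cycle that contains a loop consists of this loop. In particular it has no arcs, so that a prescribed
alternating cycle contains no loops.\<close>

lemma loop_in_cycle:
  assumes c: "edge_cycle K xs ys" and y: "y \<in> set ys" "uends K y = {p}"
  shows "ys = [y]"
proof -
  obtain y0 ys1 where ys: "ys = y0 # ys1" using y by (cases ys) auto
  obtain x xs1 where xs: "xs = x # xs1" using c by (cases xs) (auto simp: edge_cycle_def)
  have w: "xs1 \<noteq> []" "uends K y0 = {x, hd xs1}" "walk K xs1 (map Edge ys1)" "x = last xs1" "distinct xs1"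
    using c by (auto simp: edge_cycle_def xs ys walk_Cons)
  then have "edge_path K xs1 ys1" by (simp add: edge_path_def)
  then have "y \<notin> set ys1" using y(2) path_has_no_loop by metis
  then have "y = y0" using y(1) by (simp add: ys)
  then have "hd xs1 = last xs1" using y(2) w(2,4) by (auto simp: doubleton_eq_iff)
  then have "tl xs1 = []" using w(1,5) by (cases xs1) (auto split: if_splits)
  then have "length xs1 = 1" using w(1) by (cases xs1) auto
  then show ?thesis using w(3) \<open>y = y0\<close> by (simp add: walk_def ys)
qed

text \<open>The lift of the prescribed alternating path or cycle cannot be left. Let \<open>f\<close> be an edge of the component
that meets it and does not belong to it. As all arcs are used, \<open>f\<close> is a copy of an edge \<open>e\<close>, and the
other copy \<open>g\<close> is used. The two copies lie in different layers, hence have no end in common, and there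
is a path of the cover through \<open>f\<close> and \<open>g\<close>. So \<open>e\<close> is in \<open>Omega H\<close> and both copies are used.\<close>

lemma trail_spans_component:
  fixes G :: "('v, 'e, 'a) mixed_graph"
  assumes G: "mixed_graph G" and z: "z \<in> verts (cover G)"
  defines "C \<equiv> cover_component G z" and "H \<equiv> shadow G (cover_component G z)"
  assumes trail: "edge_path (cover H) xs ys \<or> edge_cycle (cover H) xs ys"
    and arcs: "\<And>a. a \<in> arcs H \<Longrightarrow> Inr a \<in> set ys" and arc: "a \<in> arcs H" "Inr a \<in> set ys"
    and edges: "\<And>e. e \<in> edges H \<Longrightarrow> Inl (e, True) \<in> set ys \<or> Inl (e, False) \<in> set ys"
    and twice: "\<And>e. e \<in> Omega H \<Longrightarrow> Inl (e, True) \<in> set ys \<and> Inl (e, False) \<in> set ys"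
  shows "set xs = verts C" "set ys = edges C"
proof -
  have w: "walk (cover H) xs (map Edge ys)" using trail by (auto simp: edge_path_def edge_cycle_def)
  have HG: "submixed (cover H) (cover G)"
    unfolding H_def using submixed_shadow[OF G z] by (rule submixed_cover)
  have uends: "uends (cover H) = uends (cover G)" by (simp add: H_def)
  have verts_C: "y \<in> verts C \<longleftrightarrow> joined (cover G) z y" for y by (simp add: C_def)
  have edges_C: "y \<in> edges C \<longleftrightarrow> y \<in> edges (cover G) \<and> uends (cover G) y \<subseteq> verts C" for y
    by (simp only: C_def component_simps mem_Collect_eq)
  have C_cover_H: "y \<in> edges (cover H)" if "y \<in> edges C" for y
    using that by (cases y) (force simp: C_def H_def)+
  have xs_C: "set xs \<subseteq> verts C"
  proof
    fix v assume "v \<in> set xs"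
    moreover have "(tail G a, True) \<in> set xs"
      using walk_edge_ends[OF w arc(2)] by (simp add: uends)
    moreover have "joined (cover G) z (tail G a, True)" using arc(1) by (simp add: H_def)
    ultimately show "v \<in> verts C"
      using joined_mono[OF HG joined_walk_verts[OF w]] unfolding verts_C by (blast intro: joined_trans)
  qed
  have ys_C: "set ys \<subseteq> edges C"
  proof
    fix y assume "y \<in> set ys"
    from walk_edge_ends[OF w this] have "y \<in> edges (cover H)" "uends (cover G) y \<subseteq> verts C"
      using xs_C by (auto simp: uends)
    then show "y \<in> edges C" using HG unfolding edges_C submixed_def by blast
  qed
  have absorbed: "f \<in> set ys" if f: "f \<in> edges C" and meet: "uends (cover G) f \<inter> set xs \<noteq> {}" for f
  proof (rule ccontr)
    assume nf: "f \<notin> set ys"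
    show False
    proof (cases f)
      case (Inr a)
      then show False using arcs[of a] nf f by (auto simp: H_def C_def)
    next
      case (Inl ec)
      then obtain e c where fe: "f = Inl (e, c)" by (cases ec) auto
      have e: "e \<in> edges H" using f by (auto simp: fe H_def C_def)
      \<comment> \<open>The copy of \<open>e\<close> in the other layer.\<close>
      define g :: "('e \<times> bool) + 'a" where "g = Inl (e, \<not> c)"
      have g: "g \<in> set ys" using edges[OF e] nf unfolding g_def fe by (cases c) auto
      have "submixed H G" unfolding H_def using submixed_shadow[OF G z] .
      then obtain p q where pq: "uends G e = {p, q}"
        using e unfolding submixed_def mixed_graph_def by metis
      have ends: "uends (cover H) f = {(p, c), (q, c)}" by (simp add: uends fe pq)
      have disj: "uends (cover H) f \<inter> uends (cover H) g = {}"
        unfolding ends by (auto simp: uends g_def)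
      have "mixed_graph (cover H)" using HG by (simp add: submixed_def)
      then have verts: "(p, c) \<in> verts (cover H)" "(q, c) \<in> verts (cover H)"
        using ends_in_verts[OF _ C_cover_H[OF f]] ends by simp_all
      have "p \<noteq> q"
      proof
        assume "p = q"
        then have loop: "uends (cover H) g = {(p, \<not> c)}" by (simp add: uends g_def pq)
        show False
          using trail
        proof
          assume "edge_path (cover H) xs ys"
          then show False using path_has_no_loop g loop by metis
        next
          assume "edge_cycle (cover H) xs ys"
          then have "ys = [g]" using loop_in_cycle g loop by metis
          then show False using arc(2) by (simp add: g_def)
        qed
      qed
      then have neq: "(p, c) \<noteq> (q, c)" by simp
      have meet': "uends (cover H) f \<inter> set xs \<noteq> {}" using meet by (simp add: uends)
      have "\<exists>xs' ys'. edge_path (cover H) xs' ys' \<and> f \<in> set ys' \<and> g \<in> set ys'"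
        using trail path_through_two_edges[OF _ g C_cover_H[OF f] ends neq verts meet' disj]
          cycle_through_two_edges[OF _ g C_cover_H[OF f] ends neq verts meet' disj] by blast
      then have "e \<in> Omega H" unfolding fe g_def by (cases c) (auto intro: mem_Omega_if_both_lifts)
      then show False using twice nf unfolding fe by (cases c) auto
    qed
  qed
  have "verts C \<subseteq> set xs"
  proof
    fix v assume "v \<in> verts C"
    have "xs \<noteq> []" using w by auto
    then obtain x0 where x0: "x0 \<in> set xs" by (cases xs) auto
    then have "joined (cover G) x0 v"
      using xs_C \<open>v \<in> verts C\<close> verts_C by (blast intro: joined_sym joined_trans)
    then have "(x0, v) \<in> (adjacent (cover G))\<^sup>*" by (simp add: joined_iff)
    then show "v \<in> set xs"
    proof (induction rule: rtrancl_induct)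
      case (step y y')
      then obtain s where s: "is_step (cover G) y s y'" "y' \<in> verts (cover G)" "y \<in> verts (cover G)"
        by (auto simp: adjacent_def)
      then obtain f where f: "f \<in> edges (cover G)" "uends (cover G) f = {y, y'}"
        by (cases s) (auto simp: cover_def)
      have "joined (cover G) y y'" using s by (intro joined_step)
      then have "{y, y'} \<subseteq> verts C" using step.IH xs_C verts_C by (blast intro: joined_trans)
      then have "f \<in> edges C" using f edges_C by simp
      then have "f \<in> set ys" using absorbed step.IH f(2) by blast
      from walk_edge_ends[OF w this] show ?case by (simp add: f(2) uends)
    qed (use x0 in simp)
  qed
  then show "set xs = verts C" using xs_C by blast
  have "f \<in> set ys" if "f \<in> edges C" for f
  proof -
    have "mixed_graph (cover G)" using G by (rule mixed_graph_cover)
    then have "uends (cover G) f \<noteq> {}" using that edges_C unfolding mixed_graph_def by blast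
    then show ?thesis using absorbed that edges_C \<open>verts C \<subseteq> set xs\<close> by blast
  qed
  then show "set ys = edges C" using ys_C by blast
qed


section \<open>Components with the AP property and with the AC property\<close>

lemma edge_path_is_path_graph:
  assumes p: "edge_path K xs ys" and C: "set xs = verts C" "set ys = edges C" "arcs C = {}" "uends C = uends K"
  shows "is_path_graph C"
proof -
  have w: "length xs = Suc (length ys)" "\<And>i. i < length ys \<Longrightarrow> uends K (ys ! i) = {xs ! i, xs ! Suc i}"
    using p by (auto simp: edge_path_def walk_def)
  moreover have "distinct xs" "distinct ys" using p edge_path_distinct by (auto simp: edge_path_def)
  ultimately show ?thesis unfolding is_path_graph_def using C by metis
qed

lemma edge_cycle_is_cycle_graph:
  assumes c: "edge_cycle K xs ys" and C: "set xs = verts C" "set ys = edges C" "arcs C = {}" "uends C = uends K"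
  shows "is_cycle_graph C"
proof -
  obtain x xs1 where xs: "xs = x # xs1" using c by (cases xs) (auto simp: edge_cycle_def)
  have len: "length xs = Suc (length ys)" and ne: "ys \<noteq> []" and closed: "last xs = x" and dist: "distinct xs1"
    and ends: "\<And>i. i < length ys \<Longrightarrow> uends K (ys ! i) = {xs ! i, xs ! Suc i}"
    using c by (auto simp: edge_cycle_def walk_def xs)
  have ne1: "xs1 \<noteq> []" using len ne by (auto simp: xs)
  then have xs1: "xs1 \<noteq> []" "last xs1 = x" using closed by (simp_all add: xs)
  then have split: "xs1 = butlast xs1 @ [x]" by (metis append_butlast_last_id)
  \<comment> \<open>The closing vertex of a cycle graph is implicit, so the repeated last vertex is dropped.\<close>
  define us where "us = butlast xs"
  have us: "us = x # butlast xs1" using xs1 by (simp add: us_def xs)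
  have "distinct (butlast xs1 @ [x])" using dist split by metis
  then have "distinct us" by (simp add: us)
  moreover have "set us = verts C"
  proof -
    have "set xs1 = set (butlast xs1 @ [x])" using split by metis
    then show ?thesis using C(1) by (simp add: us xs)
  qed
  moreover have lu: "length us = length ys" using len by (simp add: us_def)
  moreover have "uends K (ys ! i) = {us ! i, us ! (Suc i mod length us)}" if i: "i < length ys" for i
  proof -
    have "us ! i = xs ! i" using i lu by (simp add: us_def nth_butlast)
    moreover have "us ! (Suc i mod length us) = xs ! Suc i"
    proof (cases "Suc i = length ys")
      case True
      then have "xs ! Suc i = last xs" using len xs by (metis diff_Suc_1 last_conv_nth list.distinct(1))
      then show ?thesis using True lu closed by (simp add: us)
    next
      case False
      then show ?thesis using i lu by (simp add: us_def nth_butlast)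
    qed
    ultimately show ?thesis using ends[OF i] by simp
  qed
  moreover have "distinct ys" "us \<noteq> []" using c by (auto simp: edge_cycle_def us)
  ultimately show ?thesis unfolding is_cycle_graph_def using C by metis
qed

text \<open>In \<open>t_number\<close> the edges in \<open>Omega\<close> are counted twice because the component contains both of their
copies; of the other edges it contains one copy.\<close>

lemma card_component_edges:
  fixes G :: "('v, 'e, 'a) mixed_graph"
  assumes dist: "distinct ys" and C: "set ys = edges C" "edges C \<subseteq> edges (cover G)"
    and count: "\<And>e. e \<in> edges (shadow G C) \<Longrightarrow>
      count_list ys (Inl (e, True)) + count_list ys (Inl (e, False)) = (if e \<in> Omega (shadow G C) then 2 else 1)"
  shows "card (edges C) = t_number (shadow G C)"
proof -
  let ?H = "shadow G C"
  let ?B = "\<lambda>e. {b. Inl (e, b) \<in> edges C}"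
  have fin: "finite (edges C)" using C(1) by (metis finite_set)
  have "finite (Inl -` edges C)" "finite (Inr -` edges C)"
    using fin by (auto intro: finite_vimageI)
  moreover have "edges ?H = fst ` (Inl -` edges C)" by force
  moreover have "arcs ?H = Inr -` edges C" by auto
  ultimately have finH: "finite (edges ?H)" "finite (arcs ?H)" by (auto simp del: shadow_simps)
  have split: "edges C = Inl ` Sigma (edges ?H) ?B \<union> Inr ` arcs ?H"
  proof (rule Set.set_eqI)
    fix y show "y \<in> edges C \<longleftrightarrow> y \<in> Inl ` Sigma (edges ?H) ?B \<union> Inr ` arcs ?H"
      by (cases y) auto
  qed
  have cnt: "count_list ys y = (if y \<in> edges C then 1 else 0)" for y
    using dist C(1) distinct_iff_count[of ys] count_list_0_iff[of ys y]
    by (metis One_nat_def Suc_leI le_antisym neq0_conv)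
  have "card (?B e) = (if e \<in> Omega ?H then 2 else 1)" if "e \<in> edges ?H" for e
  proof -
    have "?B e = (if Inl (e, True) \<in> edges C then {True} else {}) \<union> (if Inl (e, False) \<in> edges C then {False} else {})"
      by (auto split: if_splits) (metis (full_types))+
    then show ?thesis using count[OF that] by (simp add: cnt split: if_splits)
  qed
  then have "card (Sigma (edges ?H) ?B) = (\<Sum>e\<in>edges ?H. 1 + (if e \<in> Omega ?H then 1 else 0))"
    using finH by (subst card_SigmaI) (auto intro!: sum.cong simp del: shadow_simps)
  also have "\<dots> = (\<Sum>e\<in>edges ?H. 1) + (\<Sum>e\<in>edges ?H. if e \<in> Omega ?H then 1 else 0)"
    by (rule sum.distrib)
  also have "\<dots> = card (edges ?H) + card (edges ?H \<inter> Omega ?H)"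
    using finH(1) by (simp add: sum.If_cases del: shadow_simps)
  also have "edges ?H \<inter> Omega ?H = Omega ?H" by (auto simp: Omega_def)
  finally have *: "card (Sigma (edges ?H) ?B) = card (edges ?H) + card (Omega ?H)" .
  have "card (edges C) = card (Inl ` Sigma (edges ?H) ?B :: (('e \<times> bool) + 'a) set) + card (Inr ` arcs ?H :: (('e \<times> bool) + 'a) set)"
    using finH by (subst split, subst card_Un_disjoint) (auto simp del: shadow_simps)
  also have "\<dots> = card (edges ?H) + card (Omega ?H) + card (arcs ?H)"
    by (subst card_image, simp, subst card_image, simp, subst *, simp)
  finally show ?thesis by (simp only: t_number_def)
qed

lemma layer_of_arcless_component:
  assumes "arcs (shadow G (cover_component G z)) = {}" "joined (cover G) z y"
  shows "snd y = snd z"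
proof -
  have zy: "z \<in> verts (cover G)" "(z, y) \<in> (adjacent (cover G))\<^sup>*" using assms(2) by (auto simp: joined_iff)
  from zy(2) show ?thesis
  proof (induction rule: rtrancl_induct)
    case (step y y')
    obtain s where s: "is_step (cover G) y s y'" "y \<in> verts (cover G)" "y' \<in> verts (cover G)"
      using step.hyps(2) by (auto simp: adjacent_def)
    then obtain f where f: "f \<in> edges (cover G)" "uends (cover G) f = {y, y'}"
      by (cases s) (auto simp: cover_def)
    have zy: "joined (cover G) z y" using zy(1) step.hyps(1) by (simp add: joined_iff)
    then have "{y, y'} \<subseteq> {y. joined (cover G) z y}" using joined_step[OF s] by (auto intro: joined_trans)
    then have "f \<in> edges (cover_component G z)" using f by simp
    then obtain e c where "f = Inl (e, c)" using assms(1) by (cases f) auto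
    then have "(\<lambda>v. (v, c)) ` uends G e = {y, y'}" using f(2) by simp
    then have "y \<in> (\<lambda>v. (v, c)) ` uends G e" "y' \<in> (\<lambda>v. (v, c)) ` uends G e" by simp_all
    then have "snd y = snd y'" by auto
    then show ?case using step.IH by simp
  qed simp
qed

text \<open>A component without arcs lies in one layer and is a copy of its shadow. Nothing in the shadow is
passed twice by an alternating path, since an alternating path contains an arc.\<close>

lemma arcless_component:
  assumes G: "mixed_graph G" and z: "z \<in> verts (cover G)"
    and C: "C = cover_component G z" and H: "H = shadow G C" and none: "arcs H = {}"
  shows "verts C = (\<lambda>v. (v, snd z)) ` verts H" "edges C = (\<lambda>e. Inl (e, snd z)) ` edges H"
    "t_number H = card (edges C)"
proof -
  have layer: "snd y = snd z" if "y \<in> verts C" for y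
    using layer_of_arcless_component none that by (simp add: C H)
  then show "verts C = (\<lambda>v. (v, snd z)) ` verts H" by (force simp: H)
  have "\<exists>e. y = Inl (e, snd z)" if y: "y \<in> edges C" for y
  proof (cases y)
    case (Inl ec)
    obtain e c where ec: "ec = (e, c)" by (cases ec)
    have "y \<in> edges (cover G)" "uends (cover G) y \<subseteq> verts C" using y by (auto simp: C)
    moreover have "uends (cover G) y \<noteq> {}"
      using mixed_graph_cover[OF G] calculation(1) unfolding mixed_graph_def by blast
    ultimately obtain v where "(v, c) \<in> verts C" unfolding Inl ec by auto
    then show ?thesis using layer by (auto simp: Inl ec)
  qed (use none y in \<open>auto simp: H\<close>)
  then show E: "edges C = (\<lambda>e. Inl (e, snd z)) ` edges H" by (force simp: H)
  have "card (edges C) = card (edges H)" unfolding E by (rule card_image) (auto intro: inj_onI)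
  moreover have "Omega H = {}"
    using none alternating_walk_has_arc by (fastforce simp: Omega_def alternating_path_def)
  ultimately show "t_number H = card (edges C)" by (simp add: t_number_def none)
qed

text \<open>The numbers of passages required by the properties AP and AC imply the hypotheses of
\<open>trail_spans_component\<close> and count the edges of the component.\<close>

lemma prescribed_trail_fills_component:
  assumes G: "mixed_graph G" and z: "z \<in> verts (cover G)"
  defines "C \<equiv> cover_component G z" and "H \<equiv> shadow G (cover_component G z)"
  assumes trail: "edge_path (cover H) xs ys \<or> edge_cycle (cover H) xs ys"
    and arcs: "\<And>a. a \<in> arcs H \<Longrightarrow> Inr a \<in> set ys" and arc: "\<exists>a\<in>arcs H. Inr a \<in> set ys"
    and count: "\<And>e. e \<in> edges H \<Longrightarrow>
      count_list ys (Inl (e, True)) + count_list ys (Inl (e, False)) = (if e \<in> Omega H then 2 else 1)"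
  shows "set xs = verts C" "set ys = edges C" "card (edges C) = t_number H"
proof -
  have dist: "distinct ys" using trail edge_path_distinct by (auto simp: edge_cycle_def)
  then have le: "count_list ys y \<le> 1" for y unfolding distinct_iff_count by blast
  obtain a where a: "a \<in> arcs H" "Inr a \<in> set ys" using arc by blast
  have one: "Inl (e, True) \<in> set ys \<or> Inl (e, False) \<in> set ys" if "e \<in> edges H" for e
    using count[OF that] count_list_0_iff[of ys "Inl (e, True)"] count_list_0_iff[of ys "Inl (e, False)"]
    by (auto split: if_splits)
  have two: "Inl (e, True) \<in> set ys \<and> Inl (e, False) \<in> set ys" if "e \<in> Omega H" for e
  proof -
    have "e \<in> edges H" using that by (simp add: Omega_def)
    then show ?thesis using count[of e] that le[of "Inl (e, True)"] le[of "Inl (e, False)"]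
        count_list_0_iff[of ys "Inl (e, True)"] count_list_0_iff[of ys "Inl (e, False)"]
      by (auto split: if_splits)
  qed
  show verts: "set xs = verts C" and edges: "set ys = edges C"
    using trail_spans_component[OF G z, of xs ys a] trail arcs a one two unfolding C_def H_def by blast+
  show "card (edges C) = t_number H"
    unfolding H_def C_def
    by (rule card_component_edges[OF dist]) (use count edges in \<open>auto simp: C_def H_def\<close>)
qed

text \<open>A path graph among the shadows has no arcs, so its component is a copy of it. In the other case the
lift of the prescribed alternating path fills the component.\<close>

lemma AP_component_is_path:
  assumes G: "mixed_graph G" and z: "z \<in> verts (cover G)" and AP: "AP_property (shadow G (cover_component G z))"
  shows "is_path_graph (cover_component G z) \<and>
    card (edges (cover_component G z)) = t_number (shadow G (cover_component G z))"
proof -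
  define C H where C: "C = cover_component G z" and H: "H = shadow G C"
  have arcs_C: "arcs C = {}" "uends C = uends (cover G)" by (simp_all add: C)
  consider "is_path_graph H" | us es where "alternating_path H us es" "arcs H \<subseteq> fst ` set (arc_seq es)"
    "\<forall>e\<in>edges H. count_list es (Edge e) = (if e \<in> Omega H then 2 else 1)"
    using AP unfolding AP_property_def H C by blast
  then show ?thesis
  proof cases
    case 1
    then have none: "arcs H = {}" by (simp add: is_path_graph_def)
    note flat = arcless_component[OF G z C H none]
    obtain us es where p: "distinct us" "distinct es" "set us = verts H" "set es = edges H"
        "length us = Suc (length es)" "\<And>i. i < length es \<Longrightarrow> uends H (es ! i) = {us ! i, us ! Suc i}"
      using 1 unfolding is_path_graph_def by blast
    let ?us = "map (\<lambda>v. (v, snd z)) us" and ?es = "map (\<lambda>e. Inl (e, snd z)) es"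
    have "distinct ?us" "distinct ?es" "set ?us = verts C" "set ?es = edges C" "length ?us = Suc (length ?es)"
      using p flat by (auto simp: distinct_map intro: inj_onI)
    moreover have "\<forall>i<length ?es. uends C (?es ! i) = {?us ! i, ?us ! Suc i}"
      using p(5,6) by (auto simp: arcs_C H)
    ultimately have "is_path_graph C" unfolding is_path_graph_def using arcs_C(1) by blast
    then show ?thesis using flat(3) by (simp add: C H)
  next
    case 2
    obtain xs ys where p: "edge_path (cover H) xs ys"
      and cnt: "\<And>e. count_list es (Edge e) = count_list ys (Inl (e, True)) + count_list ys (Inl (e, False))"
      and arc: "\<And>a. Inr a \<in> set ys \<longleftrightarrow> a \<in> fst ` set (arc_seq es)" and ex: "\<exists>a\<in>arcs H. Inr a \<in> set ys"
      using alternating_path_lift[OF 2(1)] by blast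
    have arcs: "Inr a \<in> set ys" if "a \<in> arcs H" for a using that 2(2) arc by blast
    have count: "count_list ys (Inl (e, True)) + count_list ys (Inl (e, False)) = (if e \<in> Omega H then 2 else 1)"
      if "e \<in> edges H" for e using 2(3) that by (simp add: cnt)
    have fill: "set xs = verts C" "set ys = edges C" "card (edges C) = t_number H"
      using prescribed_trail_fills_component[OF G z, of xs ys] p arcs ex count unfolding C H by blast+
    have "is_path_graph C"
      using p fill(1,2) by (rule edge_path_is_path_graph) (simp_all add: arcs_C H)
    then show ?thesis using fill(3) by (simp add: C H)
  qed
qed

lemma AC_component_is_cycle:
  assumes G: "mixed_graph G" and z: "z \<in> verts (cover G)" and AC: "AC_property (shadow G (cover_component G z))"
  shows "is_cycle_graph (cover_component G z) \<and>
    card (edges (cover_component G z)) = t_number (shadow G (cover_component G z))"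
proof -
  define C H where C: "C = cover_component G z" and H: "H = shadow G C"
  have arcs_C: "arcs C = {}" "uends C = uends (cover G)" by (simp_all add: C)
  consider "is_cycle_graph H" | us es where "alternating_cycle H us es" "even (num_arcs es)"
    "arcs H \<subseteq> fst ` set (arc_seq es)"
    "\<forall>e\<in>edges H. count_list es (Edge e) = (if e \<in> Omega H then 2 else 1)"
    using AC unfolding AC_property_def H C by blast
  then show ?thesis
  proof cases
    case 1
    then have none: "arcs H = {}" by (simp add: is_cycle_graph_def)
    note flat = arcless_component[OF G z C H none]
    obtain us es where p: "us \<noteq> []" "distinct us" "distinct es" "set us = verts H" "set es = edges H"
        "length us = length es" "\<And>i. i < length es \<Longrightarrow> uends H (es ! i) = {us ! i, us ! (Suc i mod length us)}"
      using 1 unfolding is_cycle_graph_def by blast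
    let ?us = "map (\<lambda>v. (v, snd z)) us" and ?es = "map (\<lambda>e. Inl (e, snd z)) es"
    have "?us \<noteq> []" "distinct ?us" "distinct ?es" "set ?us = verts C" "set ?es = edges C" "length ?us = length ?es"
      using p flat by (auto simp: distinct_map intro: inj_onI)
    moreover have "\<forall>i<length ?es. uends C (?es ! i) = {?us ! i, ?us ! (Suc i mod length ?us)}"
    proof (intro allI impI)
      fix i assume i: "i < length ?es"
      then have "Suc i mod length us < length us" using p(1) by simp
      then show "uends C (?es ! i) = {?us ! i, ?us ! (Suc i mod length ?us)}"
        using p(6) p(7)[of i] i by (simp add: arcs_C H)
    qed
    ultimately have "is_cycle_graph C" unfolding is_cycle_graph_def using arcs_C(1) by blast
    then show ?thesis using flat(3) by (simp add: C H)
  next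
    case 2
    obtain xs ys where p: "edge_cycle (cover H) xs ys"
      and cnt: "\<And>e. count_list es (Edge e) = count_list ys (Inl (e, True)) + count_list ys (Inl (e, False))"
      and arc: "\<And>a. Inr a \<in> set ys \<longleftrightarrow> a \<in> fst ` set (arc_seq es)" and ex: "\<exists>a\<in>arcs H. Inr a \<in> set ys"
      using alternating_cycle_lift[OF 2(1,2)] by blast
    have arcs: "Inr a \<in> set ys" if "a \<in> arcs H" for a using that 2(3) arc by blast
    have count: "count_list ys (Inl (e, True)) + count_list ys (Inl (e, False)) = (if e \<in> Omega H then 2 else 1)"
      if "e \<in> edges H" for e using 2(4) that by (simp add: cnt)
    have fill: "set xs = verts C" "set ys = edges C" "card (edges C) = t_number H"
      using prescribed_trail_fills_component[OF G z, of xs ys] p arcs ex count unfolding C H by blast+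
    have "is_cycle_graph C"
      using p fill(1,2) by (rule edge_cycle_is_cycle_graph) (simp_all add: arcs_C H)
    then show ?thesis using fill(3) by (simp add: C H)
  qed
qed


section \<open>Mixed components are the shadows of the components of the cover\<close>

lemma joined_undirected_lift:
  assumes "joined (undirected_part G) v w"
  shows "joined (cover G) (v, b) (w, b)"
proof -
  have "v \<in> verts G" "(v, w) \<in> (adjacent (undirected_part G))\<^sup>*" using assms by (auto simp: joined_iff)
  from this(2,1) show ?thesis
  proof (induction rule: rtrancl_induct)
    case base
    then show ?case by (simp add: joined_refl)
  next
    case (step w w')
    then obtain s where s: "is_step (undirected_part G) w s w'" "w \<in> verts G" "w' \<in> verts G"
      by (auto simp: adjacent_def)
    then obtain e where "e \<in> edges G" "uends G e = {w, w'}" by (cases s) auto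
    then have "is_step (cover G) (w, b) (Edge (Inl (e, b))) (w', b)" by auto
    then have "joined (cover G) (w, b) (w', b)" by (rule joined_step) (use s(2,3) in simp_all)
    then show ?case using step by (blast intro: joined_trans)
  qed
qed

text \<open>No arc leaves the layer \<open>b\<close> above the undirected component of \<open>v\<close>. For \<open>b = True\<close> this means that all
out-degrees in the component are zero, as required for type I; for \<open>b = False\<close> it is the requirement on
the in-degrees for type II.\<close>

definition arcless :: "('v, 'e, 'a) mixed_graph \<Rightarrow> bool \<Rightarrow> 'v \<Rightarrow> bool" where
  "arcless G b v \<longleftrightarrow> (\<forall>w. joined (undirected_part G) v w \<longrightarrow>
     (\<forall>a\<in>arcs G. (if b then tail G a else head G a) \<noteq> w))"

lemma joined_cover_arcless:
  assumes v: "v \<in> verts G" and N: "arcless G b v"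
  shows "joined (cover G) (v, b) (w, c) \<longleftrightarrow> c = b \<and> joined (undirected_part G) v w"
proof
  assume "joined (cover G) (v, b) (w, c)"
  then have "((v, b), (w, c)) \<in> (adjacent (cover G))\<^sup>*" by (simp add: joined_iff)
  then have "snd (w, c) = b \<and> joined (undirected_part G) v (fst (w, c))"
  proof (induction rule: rtrancl_induct)
    case base
    then show ?case using v by (simp add: joined_refl)
  next
    case (step y y')
    obtain u where y: "y = (u, b)" "joined (undirected_part G) v u" using step.IH by (cases y) auto
    obtain u' c' where y': "y' = (u', c')" by (cases y')
    obtain s where s: "is_step (cover G) y s y'" "y \<in> verts (cover G)" "y' \<in> verts (cover G)"
      using step.hyps(2) by (auto simp: adjacent_def)
    then obtain f where f: "f \<in> edges (cover G)" "uends (cover G) f = {y, y'}"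
      by (cases s) (auto simp: cover_def)
    show ?case
    proof (cases f)
      case (Inl ec)
      obtain e c where ec: "ec = (e, c)" by (cases ec)
      have img: "(\<lambda>v. (v, c)) ` uends G e = {(u, b), (u', c')}" using f(2) by (simp add: Inl ec y y')
      then have "(u, b) \<in> (\<lambda>v. (v, c)) ` uends G e" "(u', c') \<in> (\<lambda>v. (v, c)) ` uends G e" by simp_all
      then have cb: "c = b" "c' = b" by auto
      have "fst ` ((\<lambda>v. (v, c)) ` uends G e) = {u, u'}" unfolding img by simp
      then have "uends G e = {u, u'}" by (simp add: image_image)
      then have "joined (undirected_part G) u u'"
        using f(1) s(2,3) by (intro joined_step[of _ _ "Edge e"]) (auto simp: Inl ec y(1) y')
      then show ?thesis using y(2) cb by (auto simp: y' intro: joined_trans)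
    next
      case (Inr a)
      have "a \<in> arcs G" using f(1) by (auto simp: Inr)
      moreover have "(if b then tail G a else head G a) = u"
        using f(2) by (cases b) (auto simp: Inr y y' doubleton_eq_iff)
      ultimately show ?thesis using N y(2) by (auto simp: arcless_def)
    qed
  qed
  then show "c = b \<and> joined (undirected_part G) v w" by simp
next
  assume "c = b \<and> joined (undirected_part G) v w"
  then show "joined (cover G) (v, b) (w, c)" using joined_undirected_lift[of G v w b] by simp
qed

text \<open>If the component of \<open>(v, b)\<close> contains the copy of an arc, it meets both layers, which is impossible
once it is the copy of an undirected component in the layer \<open>b\<close>.\<close>

lemma arcless_iff:
  assumes G: "mixed_graph G" and v: "v \<in> verts G"
  shows "arcless G b v \<longleftrightarrow> arcs (shadow G (cover_component G (v, b))) = {}"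
proof
  assume N: "arcless G b v"
  have "Inr a \<notin> edges (cover_component G (v, b))" for a
    using joined_cover_arcless[OF v N] by auto
  then show "arcs (shadow G (cover_component G (v, b))) = {}" by (simp del: component_simps)
next
  assume none: "arcs (shadow G (cover_component G (v, b))) = {}"
  show "arcless G b v"
    unfolding arcless_def
  proof (intro allI impI ballI notI)
    fix w a assume w: "joined (undirected_part G) v w" and a: "a \<in> arcs G"
      and eq: "(if b then tail G a else head G a) = w"
    have vw: "joined (cover G) (v, b) (w, b)" using w by (rule joined_undirected_lift)
    have "joined (cover G) (w, b) y" if "y \<in> uends (cover G) (Inr a)" for y
      using eq a that by (intro joined_edge[OF mixed_graph_cover[OF G], of "Inr a"]) (auto split: if_splits)
    then have "uends (cover G) (Inr a) \<subseteq> {y. joined (cover G) (v, b) y}"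
      using vw by (blast intro: joined_trans)
    then have "Inr a \<in> edges (cover_component G (v, b))"
      unfolding component_simps using a by (simp only: mem_Collect_eq cover_simps) blast
    then show False using none by (simp del: component_simps)
  qed
qed

lemma shadow_arcless:
  assumes G: "mixed_graph G" and v: "v \<in> verts G" and N: "arcless G b v"
  shows "shadow G (cover_component G (v, b)) = component (undirected_part G) v"
proof (rule mixed_graph.equality)
  note J = joined_cover_arcless[OF v N]
  show "verts (shadow G (cover_component G (v, b))) = verts (component (undirected_part G) v)"
    by (auto simp: J image_iff Bex_def)
  show "arcs (shadow G (cover_component G (v, b))) = arcs (component (undirected_part G) v)"
    using N unfolding arcless_iff[OF G v] by simp
  show "edges (shadow G (cover_component G (v, b))) = edges (component (undirected_part G) v)"
  proof (rule Set.set_eqI)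
    fix e
    let ?V = "{y. joined (cover G) (v, b) y}"
    have lift: "(\<exists>c. (\<lambda>w. (w, c)) ` uends G e \<subseteq> ?V) \<longleftrightarrow> uends G e \<subseteq> {w. joined (undirected_part G) v w}"
      if "e \<in> edges G"
    proof -
      have "uends G e \<noteq> {}" using G that unfolding mixed_graph_def by blast
      then show ?thesis by (auto simp: J image_subset_iff)
    qed
    have "e \<in> edges (shadow G (cover_component G (v, b))) \<longleftrightarrow>
        (\<exists>c. Inl (e, c) \<in> edges (cover G) \<and> uends (cover G) (Inl (e, c)) \<subseteq> ?V)"
      by (simp only: shadow_simps component_simps mem_Collect_eq)
    also have "\<dots> \<longleftrightarrow> e \<in> edges G \<and> (\<exists>c. (\<lambda>w. (w, c)) ` uends G e \<subseteq> ?V)"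
      unfolding cover_simps by blast
    also have "\<dots> \<longleftrightarrow> e \<in> edges (component (undirected_part G) v)"
      using lift by (simp only: component_simps undirected_part_simps mem_Collect_eq) blast
    finally show "e \<in> edges (shadow G (cover_component G (v, b))) \<longleftrightarrow> e \<in> edges (component (undirected_part G) v)" .
  qed
qed simp_all


definition cover_components :: "('v, 'e, 'a) mixed_graph \<Rightarrow> ('v \<times> bool, ('e \<times> bool) + 'a, 'a) mixed_graph set" where
  "cover_components G = component (cover G) ` verts (cover G)"

text \<open>The components inside the layer \<open>b\<close>.\<close>

definition flat_components :: "('v, 'e, 'a) mixed_graph \<Rightarrow> bool \<Rightarrow> ('v \<times> bool, ('e \<times> bool) + 'a, 'a) mixed_graph set" where
  "flat_components G b = (\<lambda>v. component (cover G) (v, b)) ` {v \<in> verts G. arcless G b v}"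

definition arc_components :: "('v, 'e, 'a) mixed_graph \<Rightarrow> ('v \<times> bool, ('e \<times> bool) + 'a, 'a) mixed_graph set" where
  "arc_components G = {C \<in> cover_components G. arcs (shadow G C) \<noteq> {}}"

lemma component_eqI:
  assumes "y \<in> verts (component K z)" "y \<in> verts (component K z')"
  shows "component K z = component K z'"
  using assms by (auto intro!: component_cong intro: joined_trans joined_sym)

lemma image_shadow_flat:
  assumes G: "mixed_graph G"
  shows "shadow G ` flat_components G b =
    {H. component_of H (undirected_part G) \<and> (\<forall>v\<in>verts H. if b then out_degree G v = 0 else in_degree G v = 0)}"
proof -
  have fin: "finite (arcs G)" using G by (simp add: mixed_graph_def)
  define Q where "Q w \<longleftrightarrow> (if b then out_degree G w = 0 else in_degree G w = 0)" for w
  have deg: "arcless G b v \<longleftrightarrow> (\<forall>w\<in>verts (component (undirected_part G) v). Q w)" for v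
    using fin by (auto simp: Q_def arcless_def out_degree_def in_degree_def)
  have "shadow G ` flat_components G b = component (undirected_part G) ` {v \<in> verts G. arcless G b v}"
    unfolding flat_components_def image_image by (rule image_cong) (auto simp: shadow_arcless[OF G])
  also have "\<dots> = {H. (\<exists>v\<in>verts (undirected_part G). H = component (undirected_part G) v) \<and> (\<forall>w\<in>verts H. Q w)}"
    unfolding deg by auto
  finally show ?thesis
    unfolding component_of_iff[OF mixed_graph_undirected_part[OF G]] Q_def .
qed

lemma inj_on_shadow_flat:
  assumes G: "mixed_graph G"
  shows "inj_on (shadow G) (flat_components G b)"
proof (rule inj_onI)
  fix C D assume "C \<in> flat_components G b" "D \<in> flat_components G b" and eq: "shadow G C = shadow G D"
  then obtain v w where v: "v \<in> verts G" "arcless G b v" "C = cover_component G (v, b)"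
    and w: "w \<in> verts G" "arcless G b w" "D = cover_component G (w, b)"
    by (auto simp: flat_components_def)
  have "component (undirected_part G) v = component (undirected_part G) w"
    using eq unfolding v(3) w(3) shadow_arcless[OF G v(1,2)] shadow_arcless[OF G w(1,2)] .
  then have "verts (component (undirected_part G) v) = verts (component (undirected_part G) w)" by simp
  moreover have "w \<in> verts (component (undirected_part G) w)" using w(1) by (simp add: joined_refl)
  ultimately have "joined (undirected_part G) v w" by auto
  then show "C = D" unfolding v(3) w(3) by (intro component_cong joined_undirected_lift)
qed

text \<open>An arc has only one copy in the cover, so it determines the component.\<close>

lemma inj_on_shadow_arc:
  assumes G: "mixed_graph G"
  shows "inj_on (shadow G) (arc_components G)"
proof (rule inj_onI)
  fix C D assume C: "C \<in> arc_components G" and D: "D \<in> arc_components G" and eq: "shadow G C = shadow G D"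
  obtain a where "a \<in> arcs (shadow G C)" using C by (auto simp: arc_components_def)
  moreover then have "a \<in> arcs (shadow G D)" by (simp only: eq)
  ultimately have a: "Inr a \<in> edges C" "Inr a \<in> edges D" by simp_all
  obtain z z' where "C = cover_component G z" "D = cover_component G z'"
    using C D by (auto simp: arc_components_def cover_components_def)
  moreover have "(tail G a, True) \<in> verts C" "(tail G a, True) \<in> verts D"
    using a unfolding calculation by auto
  ultimately show "C = D" using component_eqI by metis
qed

lemma cover_components_partition:
  assumes G: "mixed_graph G"
  shows "cover_components G = flat_components G True \<union> flat_components G False \<union> arc_components G"
    "flat_components G True \<inter> flat_components G False = {}"
    "(flat_components G True \<union> flat_components G False) \<inter> arc_components G = {}"
proof -
  have "C \<in> flat_components G True \<union> flat_components G False"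
    if C: "C \<in> cover_components G" "arcs (shadow G C) = {}" for C
  proof -
    obtain v b where v: "v \<in> verts G" "C = cover_component G (v, b)"
      using C(1) by (auto simp: cover_components_def)
    then have "arcless G b v" using C(2) arcless_iff[OF G v(1)] by simp
    then show ?thesis using v by (cases b) (auto simp: flat_components_def)
  qed
  then show "cover_components G = flat_components G True \<union> flat_components G False \<union> arc_components G"
    by (auto simp: arc_components_def) (auto simp: flat_components_def cover_components_def)
  show "flat_components G True \<inter> flat_components G False = {}"
  proof (rule ccontr)
    assume "flat_components G True \<inter> flat_components G False \<noteq> {}"
    then obtain v w where v: "v \<in> verts G" "arcless G True v" and w: "w \<in> verts G"
      and eq: "cover_component G (v, True) = cover_component G (w, False)"
      by (auto simp: flat_components_def)
    have "(w, False) \<in> verts (cover_component G (w, False))" using w by (simp add: joined_refl)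
    then have "joined (cover G) (v, True) (w, False)" unfolding eq[symmetric] by simp
    then show False using joined_cover_arcless[OF v] by simp
  qed
  show "(flat_components G True \<union> flat_components G False) \<inter> arc_components G = {}"
    using arcless_iff[OF G] by (auto simp: flat_components_def arc_components_def)
qed


lemma walk_append:
  assumes "walk K us es" "walk K vs fs" "is_step K (last us) s (hd vs)"
  shows "walk K (us @ vs) (es @ s # fs)"
  using assms(1,3)
proof (induction es arbitrary: us)
  case Nil
  then show ?case using assms(2) by (auto simp: walk_Cons)
next
  case (Cons e es)
  then obtain u us' where us: "us = u # us'" by (cases us) auto
  have "us' \<noteq> []" "u \<in> verts K" "is_step K u e (hd us')" "walk K us' es"
    using Cons.prems(1) by (auto simp: us walk_Cons)
  then show ?case using Cons.IH[of us'] Cons.prems(2) by (simp add: us walk_Cons)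
qed

lemma walk_without_arcs:
  assumes "walk K us es" "arcs K = {}"
  shows "\<exists>ys. es = map Edge ys"
  using assms(1)
proof (induction es arbitrary: us)
  case (Cons s es)
  then obtain u us' where us: "us = u # us'" by (cases us) auto
  have s: "is_step K u s (hd us')" and w: "walk K us' es" using Cons.prems(1) by (auto simp: us walk_Cons)
  obtain ys where "es = map Edge ys" using Cons.IH[OF w] by blast
  moreover obtain y where "s = Edge y" using s assms(2) by (cases s) auto
  ultimately have "s # es = map Edge (y # ys)" by simp
  then show ?case by (rule exI)
qed simp

text \<open>An alternating walk must contain an arc. This lemma leads a walk through a given copy of an arc.\<close>

lemma walk_through_edge:
  assumes x: "joined K x p" and y: "joined K q y" and f: "f \<in> edges K" "uends K f = {p, q}" and K: "arcs K = {}"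
  shows "\<exists>xs ys. walk K xs (map Edge ys) \<and> hd xs = x \<and> last xs = y \<and> f \<in> set ys"
proof -
  obtain us es where u: "walk K us es" "hd us = x" "last us = p" using x by (auto simp: joined_def)
  obtain vs fs where v: "walk K vs fs" "hd vs = q" "last vs = y" using y by (auto simp: joined_def)
  obtain es' fs' where m: "es = map Edge es'" "fs = map Edge fs'"
    using walk_without_arcs[OF u(1) K] walk_without_arcs[OF v(1) K] by blast
  have "walk K (us @ vs) (es @ Edge f # fs)" using f u v by (intro walk_append) auto
  moreover have "us \<noteq> []" "vs \<noteq> []" using u(1) v(1) by auto
  ultimately have "walk K (us @ vs) (map Edge (es' @ f # fs'))" "hd (us @ vs) = x" "last (us @ vs) = y"
    using u v by (simp_all add: m)
  then show ?thesis by (intro exI[of _ "us @ vs"] exI[of _ "es' @ f # fs'"]) simp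
qed

lemma alternating_walk_unlift:
  assumes w: "walk (cover H) xs (map Edge ys)" and a: "Inr a \<in> set ys"
  shows "\<exists>us es. alternating_walk H us es \<and> hd us = fst (hd xs) \<and> last us = fst (last xs) \<and>
    (odd (num_arcs es) \<longleftrightarrow> snd (hd xs) \<noteq> snd (last xs))"
proof -
  define b us es where "b = snd (hd xs)" and "us = map fst xs" and "es = unlift b ys"
  have l: "walk H us es" "alternates b es" "lift_verts b us es = xs" "lift_edges b es = ys"
    using walk_unlift[OF w b_def] by (simp_all add: us_def es_def)
  have len: "length us = Suc (length es)" using l(1) by (simp add: walk_def)
  have ne: "xs \<noteq> []" using w by auto
  have "arc_seq es \<noteq> []" using a Inr_in_lift_edges[of _ b es] l(4) by auto
  then have "alternating_walk H us es" using l by (auto simp: alternating_walk_iff)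
  moreover have "snd (last xs) = (b = even (num_arcs es))"
  proof -
    have "length xs = Suc (length es)" using len by (simp add: us_def)
    then have "last xs = lift_verts b us es ! length es" using ne l(3) by (simp add: last_conv_nth)
    then show ?thesis using len by (simp add: lift_verts_nth)
  qed
  then have "odd (num_arcs es) \<longleftrightarrow> snd (hd xs) \<noteq> snd (last xs)" using b_def by auto
  moreover have "hd us = fst (hd xs)" "last us = fst (last xs)"
    using ne by (simp_all add: us_def hd_map last_map)
  ultimately show ?thesis by blast
qed

lemma alternating_walk_lift:
  assumes aw: "alternating_walk H us es"
  shows "\<exists>b c. joined (cover H) (hd us, b) (last us, c) \<and> (odd (num_arcs es) \<longrightarrow> c = (\<not> b)) \<and>
    (\<exists>a\<in>arcs H. joined (cover H) (hd us, b) (tail H a, True))"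
proof -
  have w: "walk H us es" using aw by (simp add: alternating_walk_def)
  have len: "length us = Suc (length es)" using w by (simp add: walk_def)
  have ne: "us \<noteq> []" using len by auto
  obtain b where b: "alternates b es" using aw by (auto simp: alternating_walk_iff)
  define xs ys where "xs = lift_verts b us es" and "ys = lift_edges b es"
  have wl: "walk (cover H) xs (map Edge ys)" unfolding xs_def ys_def using w b by (rule walk_lift)
  have nx: "xs \<noteq> []" using ne by (simp add: xs_def)
  have hd: "hd xs = (hd us, b)" using ne by (simp add: xs_def hd_lift_verts)
  have "last xs = lift_verts b us es ! length es"
    using nx len length_lift_verts[OF len, of b] by (simp add: last_conv_nth xs_def)
  then have last: "last xs = (last us, b = even (num_arcs es))"
    using ne len by (simp add: lift_verts_nth last_conv_nth)
  obtain a where a: "a \<in> arcs H" "a \<in> fst ` set (arc_seq es)" using alternating_walk_has_arc[OF aw] by blast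
  have "Inr a \<in> set ys" unfolding ys_def Inr_in_lift_edges by (rule a(2))
  then have "(tail H a, True) \<in> set xs" using walk_edge_ends[OF wl] by fastforce
  then have "joined (cover H) (hd us, b) (tail H a, True)"
    using joined_walk_verts[OF wl] nx hd by (metis hd_in_set)
  moreover have "joined (cover H) (hd us, b) (last us, b = even (num_arcs es))"
    using joined_walk_verts[OF wl] nx hd last by (metis hd_in_set last_in_set)
  ultimately show ?thesis using a(1) by (intro exI[of _ b] exI[of _ "b = even (num_arcs es)"]) auto
qed

lemma submixed_cover_component:
  assumes G: "mixed_graph G" and z: "z \<in> verts (cover G)"
  shows "submixed (cover_component G z) (cover (shadow G (cover_component G z)))"
proof -
  let ?C = "cover_component G z"
  have "submixed ?C (cover G)" using mixed_graph_cover[OF G] z by (rule submixed_component)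
  moreover have "verts ?C \<subseteq> fst ` verts ?C \<times> UNIV" by force
  moreover have "y \<in> edges (shadow G ?C) \<times> UNIV <+> arcs (shadow G ?C)" if y: "y \<in> edges ?C" for y
  proof (cases y)
    case (Inl ec)
    then show ?thesis using y by (cases ec) (auto simp del: component_simps)
  next
    case (Inr a)
    then show ?thesis using y by (auto simp del: component_simps)
  qed
  ultimately show ?thesis
    by (auto simp: submixed_def cover_def simp del: component_simps(1,2))
qed

text \<open>The component lies in the cover of its shadow, and any two of its vertices are joined there by a walk
through a given arc. An undirected component of the shadow at which some arc starts and some arc ends
has copies in both layers within this component. A walk between the two copies of a vertex projects to
a closed walk with an odd number of arcs.\<close>

lemma special_shadow:
  assumes G: "mixed_graph G" and C: "C \<in> arc_components G"
  shows "special_submixed (shadow G C) G"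
proof -
  obtain z where z: "z \<in> verts (cover G)" "C = cover_component G z" and arc: "arcs (shadow G C) \<noteq> {}"
    using C unfolding arc_components_def cover_components_def by blast
  define H where "H = shadow G C"
  have sub: "submixed H G" unfolding H_def z(2) using G z(1) by (rule submixed_shadow)
  have th: "uends H = uends G" "tail H = tail G" "head H = head G" by (simp_all add: H_def)
  have CH: "submixed C (cover H)" unfolding H_def z(2) using G z(1) by (rule submixed_cover_component)
  have joined: "joined (cover H) y y'" if "y \<in> verts C" "y' \<in> verts C" for y y'
    using connected_component[OF z(1)] that joined_mono[OF CH]
    by (simp only: connected_mixed_def joined_def z(2)[symmetric])
  have ends: "(tail G a, True) \<in> verts C" "(head G a, False) \<in> verts C" if "a \<in> arcs H" for a
    using that by (auto simp: H_def z(2))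
  obtain a where a: "a \<in> arcs H" using arc by (auto simp: H_def)
  have alt: "\<exists>us es. alternating_walk H us es \<and> hd us = fst y \<and> last us = fst y' \<and>
      (odd (num_arcs es) \<longleftrightarrow> snd y \<noteq> snd y')" if "y \<in> verts C" "y' \<in> verts C" for y y'
  proof -
    have "\<exists>xs ys. walk (cover H) xs (map Edge ys) \<and> hd xs = y \<and> last xs = y' \<and> Inr a \<in> set ys"
      using that ends[OF a] a
      by (intro walk_through_edge[of _ _ "(tail G a, True)" "(head G a, False)"] joined) (auto simp: th)
    then show ?thesis using alternating_walk_unlift by metis
  qed
  have conn: "\<exists>us es. alternating_walk H us es \<and> hd us = u \<and> last us = v"
    if uv: "u \<in> verts H" "v \<in> verts H" for u v
  proof -
    obtain y y' where "y \<in> verts C" "u = fst y" "y' \<in> verts C" "v = fst y'"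
      using uv unfolding H_def shadow_simps by blast
    then show ?thesis using alt by blast
  qed
  have odd: "\<exists>us es. alternating_walk H us es \<and> hd us = v \<and> last us = v \<and> odd (num_arcs es)"
    if K: "component_of K (undirected_part H)" and v: "v \<in> verts K"
      and h: "v1 \<in> verts K" "a1 \<in> arcs H" "head H a1 = v1" and t: "v2 \<in> verts K" "a2 \<in> arcs H" "tail H a2 = v2"
    for K v v1 v2 a1 a2
  proof -
    have "mixed_graph (undirected_part H)"
      using sub by (simp add: submixed_def mixed_graph_undirected_part)
    then obtain x where "K = component (undirected_part H) x" using K by (auto simp: component_of_iff)
    then have j: "joined (undirected_part H) v1 v" "joined (undirected_part H) v2 v"
      using v h(1) t(1) by (auto intro: joined_trans joined_sym)
    have in_C: "y' \<in> verts C" if "y \<in> verts C" "joined (cover H) y y'" for y y'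
      using that joined_mono[OF submixed_cover[OF sub] that(2)] by (auto simp: z(2) intro: joined_trans)
    have "(v, False) \<in> verts C"
      using ends(2)[OF h(2)] joined_undirected_lift[OF j(1)] h(3) by (auto simp: th intro: in_C)
    moreover have "(v, True) \<in> verts C"
      using ends(1)[OF t(2)] joined_undirected_lift[OF j(2)] t(3) by (auto simp: th intro: in_C)
    ultimately show ?thesis using alt[of "(v, False)" "(v, True)"] by auto
  qed
  have "special_submixed H G"
    unfolding special_submixed_def
  proof (intro conjI ballI allI impI)
    show "submixed H G" by (rule sub)
    show "arcs H \<noteq> {}" using a by blast
  qed (use conn odd in blast)+
  then show ?thesis by (simp only: H_def)
qed

text \<open>In a special submixed graph all lifted arcs lie in one component of the cover. The alternating walks
that are required between distinct vertices only join some copies of these vertices. The required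
closed walks with an odd number of arcs join the two copies of one vertex, and they exist wherever
this is needed: if \<open>u\<close> is the tail of an arc and the component of \<open>(u, False)\<close> contains an arc, then an
arc ends in the undirected component of \<open>u\<close>.\<close>

lemma special_in_shadow:
  assumes G: "mixed_graph G" and special: "special_submixed H G"
  shows "\<exists>C\<in>arc_components G. submixed H (shadow G C)"
proof -
  have sub: "submixed H G" and alt: "\<And>u v. u \<in> verts H \<Longrightarrow> v \<in> verts H \<Longrightarrow> u \<noteq> v \<Longrightarrow>
        \<exists>us es. alternating_walk H us es \<and> hd us = u \<and> last us = v"
    and odd: "\<And>K v v1 v2 a1 a2. component_of K (undirected_part H) \<Longrightarrow> v1 \<in> verts K \<Longrightarrow> a1 \<in> arcs H \<Longrightarrow>
        head H a1 = v1 \<Longrightarrow> v2 \<in> verts K \<Longrightarrow> a2 \<in> arcs H \<Longrightarrow> tail H a2 = v2 \<Longrightarrow> v \<in> verts K \<Longrightarrow>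
        \<exists>us es. alternating_walk H us es \<and> hd us = v \<and> last us = v \<and> odd (num_arcs es)"
    using special unfolding special_submixed_def by blast+
  have H: "mixed_graph H" and th: "uends H = uends G" "tail H = tail G" "head H = head G"
    using sub by (auto simp: submixed_def)
  obtain a0 where a0: "a0 \<in> arcs H" using special by (auto simp: special_submixed_def)
  let ?j = "joined (cover H)"
  have tails: "tail H a \<in> verts H" if "a \<in> arcs H" for a using H that by (simp add: mixed_graph_def)
  have layers: "?j (tail H a, True) (tail H a, c)"
    if a: "a \<in> arcs H" and a1: "a1 \<in> arcs H" "?j (tail H a, c) (tail H a1, True)" for a a1 c
  proof (cases c)
    case True
    then show ?thesis using tails[OF a] by (simp add: joined_refl)
  next
    case False
    let ?u = "tail H a"
    have "Inr a1 \<in> edges (cover_component H (?u, c))"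
    proof -
      have "?j (tail H a1, True) (head H a1, False)"
        using a1(1) by (intro joined_edge[OF mixed_graph_cover[OF H], of "Inr a1"]) auto
      then show ?thesis using a1 by (auto intro: joined_trans)
    qed
    then have "\<not> arcless H c ?u" unfolding arcless_iff[OF H tails[OF a]] by (auto simp del: component_simps)
    then obtain w a2 where w: "joined (undirected_part H) ?u w" "a2 \<in> arcs H" "head H a2 = w"
      using False by (auto simp: arcless_def)
    have "component_of (component (undirected_part H) ?u) (undirected_part H)"
      unfolding component_of_iff[OF mixed_graph_undirected_part[OF H]] using tails[OF a] by auto
    from odd[OF this _ w(2,3) _ a refl, of ?u] obtain us es where
      "alternating_walk H us es" "hd us = ?u" "last us = ?u" "odd (num_arcs es)"
      using w(1) tails[OF a] by (auto simp: joined_refl)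
    then obtain b where "?j (?u, b) (?u, \<not> b)" using alternating_walk_lift by metis
    then show ?thesis using False by (cases b) (auto intro: joined_sym)
  qed
  \<comment> \<open>All vertices of \<open>H\<close> are joined to this vertex in at least one layer.\<close>
  define r where "r = (tail H a0, True)"
  have reach: "\<exists>b. ?j (v, b) r" if v: "v \<in> verts H" for v
  proof (cases "v = tail H a0")
    case True
    then have "?j (v, True) r" using v by (simp add: r_def joined_refl)
    then show ?thesis ..
  next
    case False
    obtain us es where us: "alternating_walk H us es" "hd us = v" "last us = tail H a0"
      using alt[OF v tails[OF a0] False] by blast
    obtain b c a1 where bc: "?j (v, b) (tail H a0, c)" "a1 \<in> arcs H" "?j (v, b) (tail H a1, True)"
      using alternating_walk_lift[OF us(1)] us(2,3) by auto
    have "?j (tail H a0, c) (tail H a1, True)" using bc by (blast intro: joined_sym joined_trans)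
    then have "?j (tail H a0, True) (tail H a0, c)" using layers[OF a0 bc(2)] by blast
    then have "?j (v, b) r" unfolding r_def using bc(1) by (blast intro: joined_sym joined_trans)
    then show ?thesis ..
  qed
  have tail_reach: "?j (tail H a, True) r" if a: "a \<in> arcs H" for a
  proof -
    obtain b where b: "?j (tail H a, b) r" using reach[OF tails[OF a]] by blast
    then have "?j (tail H a, True) (tail H a, b)" using layers[OF a a0] by (simp add: r_def)
    then show ?thesis using b by (rule joined_trans)
  qed
  have r: "r \<in> verts (cover G)" using tails[OF a0] sub by (auto simp: r_def submixed_def)
  define C where "C = cover_component G r"
  have JG: "joined (cover G) r y" if "?j y r" for y
    using joined_mono[OF submixed_cover[OF sub] that] by (rule joined_sym)
  have arcs: "Inr a \<in> edges C" if a: "a \<in> arcs H" for a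
  proof -
    have "?j (head H a, False) (tail H a, True)"
      using a by (intro joined_edge[OF mixed_graph_cover[OF H], of "Inr a"]) auto
    then have "?j (head H a, False) r" using tail_reach[OF a] by (rule joined_trans)
    then have "uends (cover G) (Inr a) \<subseteq> {y. joined (cover G) r y}"
      using JG tail_reach[OF a] by (auto simp: th)
    moreover have "a \<in> arcs G" using a sub by (auto simp: submixed_def)
    ultimately show ?thesis by (auto simp: C_def)
  qed
  have verts: "v \<in> fst ` verts C" if "v \<in> verts H" for v
    using reach[OF that] JG by (force simp: C_def)
  have edges: "\<exists>b. Inl (e, b) \<in> edges C" if e: "e \<in> edges H" for e
  proof -
    obtain x y where xy: "uends H e = {x, y}" "x \<in> verts H" using H e unfolding mixed_graph_def by blast
    obtain b where b: "?j (x, b) r" using reach[OF xy(2)] by blast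
    have "?j w r" if "w \<in> uends (cover H) (Inl (e, b))" for w
    proof -
      have "?j w (x, b)"
        using that e xy(1) by (intro joined_edge[OF mixed_graph_cover[OF H], of "Inl (e, b)"]) auto
      then show ?thesis using b by (rule joined_trans)
    qed
    then have "uends (cover G) (Inl (e, b)) \<subseteq> {y. joined (cover G) r y}" using JG by (auto simp: th)
    moreover have "e \<in> edges G" using e sub by (auto simp: submixed_def)
    ultimately have "Inl (e, b) \<in> edges C" by (auto simp: C_def)
    then show ?thesis ..
  qed
  have "submixed H (shadow G C)"
    using H th verts edges arcs by (auto simp: submixed_def)
  moreover have "C \<in> arc_components G"
    using r arcs[OF a0] unfolding arc_components_def cover_components_def C_def shadow_simps by blast
  ultimately show ?thesis by blast
qed

text \<open>The special submixed graphs are contained in shadows, and these are special themselves. So the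
maximal ones are shadows, and a shadow is maximal because shadows with a common arc are equal.\<close>

lemma type_III_eq:
  assumes G: "mixed_graph G"
  shows "type_III G = shadow G ` arc_components G"
proof (rule Set.set_eqI, rule iffI)
  fix H assume H: "H \<in> type_III G"
  then have "special_submixed H G" by (simp add: type_III_def)
  then obtain C where C: "C \<in> arc_components G" "submixed H (shadow G C)"
    using special_in_shadow[OF G] by blast
  then have "shadow G C = H" using H special_shadow[OF G C(1)] by (simp add: type_III_def)
  then show "H \<in> shadow G ` arc_components G" using C(1) by blast
next
  fix H assume "H \<in> shadow G ` arc_components G"
  then obtain C where C: "C \<in> arc_components G" "H = shadow G C" by blast
  have "H' = H" if H': "special_submixed H' G" "submixed H H'" for H'
  proof -
    obtain D where D: "D \<in> arc_components G" "submixed H' (shadow G D)"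
      using special_in_shadow[OF G H'(1)] by blast
    have "submixed H (shadow G D)" using H'(2) D(2) by (rule submixed_trans)
    then have sub: "arcs (shadow G C) \<subseteq> arcs (shadow G D)" by (simp only: submixed_def C(2))
    obtain a where "a \<in> arcs (shadow G C)" using C(1) by (auto simp: arc_components_def)
    with sub have a: "Inr a \<in> edges C" "Inr a \<in> edges D" by auto
    obtain z z' where zz: "C = cover_component G z" "D = cover_component G z'"
      using C D by (auto simp: arc_components_def cover_components_def)
    have "(tail G a, True) \<in> verts C" "(tail G a, True) \<in> verts D" using a unfolding zz by auto
    then have "C = D" unfolding zz by (rule component_eqI)
    then have "submixed H' H" using D(2) C(2) by simp
    then show ?thesis using H'(2) by (rule submixed_antisym)
  qed
  then show "H \<in> type_III G" using special_shadow[OF G C(1)] C(2) by (auto simp: type_III_def)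
qed

lemma finite_cover_components: "mixed_graph G \<Longrightarrow> finite (cover_components G)"
  by (simp add: cover_components_def mixed_graph_def)

lemma mixed_components_eq:
  assumes G: "mixed_graph G"
  shows "mixed_components G = image_mset (shadow G) (mset_set (cover_components G))"
proof -
  note part = cover_components_partition[OF G]
  have fin: "finite (flat_components G True)" "finite (flat_components G False)" "finite (arc_components G)"
    using finite_cover_components[OF G] part(1) by simp_all
  have "type_I G = shadow G ` flat_components G True" "type_II G = shadow G ` flat_components G False"
    by (simp_all add: image_shadow_flat[OF G] type_I_def type_II_def)
  then have "mixed_components G = mset_set (shadow G ` flat_components G True)
      + mset_set (shadow G ` flat_components G False) + mset_set (shadow G ` arc_components G)"
    by (simp add: mixed_components_def type_III_eq[OF G])
  also have "\<dots> = image_mset (shadow G) (mset_set (flat_components G True)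
      + mset_set (flat_components G False) + mset_set (arc_components G))"
    by (simp add: image_mset_mset_set inj_on_shadow_flat[OF G] inj_on_shadow_arc[OF G])
  also have "mset_set (flat_components G True) + mset_set (flat_components G False) + mset_set (arc_components G)
      = mset_set (cover_components G)"
    using fin part(2,3) unfolding part(1) by (simp add: mset_set_Union)
  finally show ?thesis .
qed


section \<open>Determinants of the components\<close>

text \<open>The entries of \<open>edge_matrix\<close>, with vertices in the place of their numbers.\<close>

definition adj :: "('v, 'e, 'a) mixed_graph \<Rightarrow> 'v \<Rightarrow> 'v \<Rightarrow> real" where
  "adj K x y = (if x = y then 2 * real (card {e \<in> edges K. uends K e = {x}})
     else real (card {e \<in> edges K. uends K e = {x, y}}))"

lemma layer_image_eq: "(\<lambda>w. (w, c)) ` E = {(u, b), (v, d)} \<longleftrightarrow> E = {u, v} \<and> c = b \<and> c = d"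
proof
  assume *: "(\<lambda>w. (w, c)) ` E = {(u, b), (v, d)}"
  then have "(u, b) \<in> (\<lambda>w. (w, c)) ` E" "(v, d) \<in> (\<lambda>w. (w, c)) ` E" by simp_all
  moreover have "fst ` ((\<lambda>w. (w, c)) ` E) = {u, v}" unfolding * by simp
  ultimately show "E = {u, v} \<and> c = b \<and> c = d" by (auto simp: image_image)
qed auto

lemma cover_edges_between:
  "{y \<in> edges (cover G). uends (cover G) y = {(u, b), (v, b)}} =
     (\<lambda>e. Inl (e, b)) ` {e \<in> edges G. uends G e = {u, v}}"
  "{y \<in> edges (cover G). uends (cover G) y = {(u, True), (v, False)}} =
     Inr ` {a \<in> arcs G. tail G a = u \<and> head G a = v}"
proof -
  show "{y \<in> edges (cover G). uends (cover G) y = {(u, b), (v, b)}} =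
     (\<lambda>e. Inl (e, b)) ` {e \<in> edges G. uends G e = {u, v}}"
  proof (rule Set.set_eqI)
    fix y show "y \<in> {y \<in> edges (cover G). uends (cover G) y = {(u, b), (v, b)}} \<longleftrightarrow>
      y \<in> (\<lambda>e. Inl (e, b)) ` {e \<in> edges G. uends G e = {u, v}}"
    proof (cases y)
      case (Inl ec)
      then show ?thesis by (cases ec) (auto simp: layer_image_eq)
    qed (auto simp: doubleton_eq_iff)
  qed
  show "{y \<in> edges (cover G). uends (cover G) y = {(u, True), (v, False)}} =
     Inr ` {a \<in> arcs G. tail G a = u \<and> head G a = v}"
  proof (rule Set.set_eqI)
    fix y show "y \<in> {y \<in> edges (cover G). uends (cover G) y = {(u, True), (v, False)}} \<longleftrightarrow>
      y \<in> Inr ` {a \<in> arcs G. tail G a = u \<and> head G a = v}"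
    proof (cases y)
      case (Inl ec)
      then show ?thesis by (cases ec) (auto simp: layer_image_eq)
    qed (auto simp: doubleton_eq_iff)
  qed
qed

lemma adj_cover:
  fixes G :: "('v, 'e, 'a) mixed_graph"
  shows "adj (cover G) (u, b) (v, b) = adj G u v"
  "adj (cover G) (u, True) (v, False) = real (card {a \<in> arcs G. tail G a = u \<and> head G a = v})"
  "adj (cover G) (u, False) (v, True) = real (card {a \<in> arcs G. tail G a = v \<and> head G a = u})"
proof -
  have inl: "card ((\<lambda>e. Inl (e, b) :: ('e \<times> bool) + 'a) ` X) = card X" for X :: "'e set" and b
    by (rule card_image) (auto intro: inj_onI)
  have inr: "card (Inr ` X :: (('e \<times> bool) + 'a) set) = card X" for X :: "'a set"
    by (rule card_image) simp
  show "adj (cover G) (u, b) (v, b) = adj G u v"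
    using arg_cong[OF cover_edges_between(1)[of G u b v], of card]
    by (auto simp: adj_def inl simp del: cover_simps)
  have *: "card {y \<in> edges (cover G). uends (cover G) y = {(u, True), (v, False)}} =
      card {a \<in> arcs G. tail G a = u \<and> head G a = v}" for u v
    unfolding cover_edges_between(2) by (rule inr)
  show "adj (cover G) (u, True) (v, False) = real (card {a \<in> arcs G. tail G a = u \<and> head G a = v})"
    using *[of u v] by (simp add: adj_def del: cover_simps)
  show "adj (cover G) (u, False) (v, True) = real (card {a \<in> arcs G. tail G a = v \<and> head G a = u})"
    using *[of v u] by (simp add: adj_def insert_commute del: cover_simps)
qed

lemma det_integrated:
  assumes G: "mixed_graph G" and vs: "distinct vs" "set vs = verts G"
  shows "det (integrated_adjacency_matrix G vs) = Det (verts (cover G)) (adj (cover G))"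
proof -
  define ws where "ws = map (\<lambda>v. (v, True)) vs @ map (\<lambda>v. (v, False)) vs"
  let ?n = "length vs"
  have dist: "distinct ws" using vs(1) by (auto simp: ws_def distinct_map intro: inj_onI)
  have set: "set ws = verts (cover G)" using vs(2) by (auto simp: ws_def)
  have len: "length ws = ?n + ?n" by (simp add: ws_def)
  have ws: "ws ! i = (if i < ?n then (vs ! i, True) else (vs ! (i - ?n), False))" if "i < ?n + ?n" for i
    using that by (auto simp: ws_def nth_append)
  have em: "edge_matrix G vs $$ (i, j) = adj G (vs ! i) (vs ! j)" if "i < ?n" "j < ?n" for i j
    using that vs(1) by (simp add: edge_matrix_def adj_def nth_eq_iff_index_eq)
  have am: "arc_matrix G vs $$ (i, j) = real (card {a \<in> arcs G. tail G a = vs ! i \<and> head G a = vs ! j})"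
    if "i < ?n" "j < ?n" for i j
    using that by (simp add: arc_matrix_def)
  have dims: "dim_row (edge_matrix G vs) = ?n" "dim_col (edge_matrix G vs) = ?n"
    "dim_row (arc_matrix G vs) = ?n" "dim_col (arc_matrix G vs) = ?n"
    by (simp_all add: edge_matrix_def arc_matrix_def)
  have "integrated_adjacency_matrix G vs = mat (length ws) (length ws) (\<lambda>(i, j). adj (cover G) (ws ! i) (ws ! j))"
  proof (rule eq_matI)
    fix i j assume "i < dim_row (mat (length ws) (length ws) (\<lambda>(i, j). adj (cover G) (ws ! i) (ws ! j)))"
      "j < dim_col (mat (length ws) (length ws) (\<lambda>(i, j). adj (cover G) (ws ! i) (ws ! j)))"
    then have ij: "i < ?n + ?n" "j < ?n + ?n" by (simp_all add: len)
    have t: "transpose_mat (arc_matrix G vs) $$ (i, j) = arc_matrix G vs $$ (j, i)" if "i < ?n" "j < ?n" for i j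
      using that by (simp add: dims)
    show "integrated_adjacency_matrix G vs $$ (i, j) =
        mat (length ws) (length ws) (\<lambda>(i, j). adj (cover G) (ws ! i) (ws ! j)) $$ (i, j)"
      unfolding integrated_adjacency_matrix_def
      using ij by (auto simp: dims len ws em am t adj_cover)
  qed (simp_all add: integrated_adjacency_matrix_def dims len)
  then show ?thesis using det_eq_Det[OF dist, of "adj (cover G)"] by (simp add: set del: cover_simps)
qed

text \<open>Vertices in different components are not adjacent, so the matrix is block diagonal.\<close>

lemma Det_components:
  assumes K: "mixed_graph K"
  shows "Det (verts K) (adj K) = (\<Prod>C\<in>component K ` verts K. Det (verts C) (adj C))"
proof -
  let ?\<C> = "component K ` verts K"
  have fin: "finite (verts K)" using K by (simp add: mixed_graph_def)
  have sub: "submixed C K" if "C \<in> ?\<C>" for C using that submixed_component[OF K] by auto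
  have eqI: "C = D" if CD: "C \<in> ?\<C>" "D \<in> ?\<C>" and x: "x \<in> verts C" "x \<in> verts D" for C D x
  proof -
    obtain z z' where "C = component K z" "D = component K z'" using CD by blast
    then show ?thesis using x component_eqI by metis
  qed
  have ne: "verts C \<noteq> {}" if "C \<in> ?\<C>" for C using sub[OF that] by (simp add: submixed_def mixed_graph_def)
  have inj: "inj_on verts ?\<C>"
  proof (rule inj_onI)
    fix C D assume CD: "C \<in> ?\<C>" "D \<in> ?\<C>" "verts C = verts D"
    obtain x where "x \<in> verts C" using ne[OF CD(1)] by blast
    then show "C = D" using eqI[OF CD(1,2)] CD(3) by simp
  qed
  have union: "\<Union>(verts ` ?\<C>) = verts K"
    using sub joined_refl by (fastforce simp: submixed_def)
  have "Det (\<Union>(verts ` ?\<C>)) (adj K) = (\<Prod>T\<in>verts ` ?\<C>. Det T (adj K))"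
  proof (rule Det_Union)
    show "finite (verts ` ?\<C>)" using fin by simp
    show "finite T" if "T \<in> verts ` ?\<C>" for T using that union fin by (metis Union_upper finite_subset)
    show disj': "disjoint (verts ` ?\<C>)"
      unfolding disjoint_def
    proof (intro ballI impI)
      fix S T assume S: "S \<in> verts ` ?\<C>" and T: "T \<in> verts ` ?\<C>" and "S \<noteq> T"
      from S obtain C where C: "S = verts C" "C \<in> ?\<C>" by (rule imageE)
      from T obtain D where D: "T = verts D" "D \<in> ?\<C>" by (rule imageE)
      have "C \<noteq> D" using \<open>S \<noteq> T\<close> C(1) D(1) by metis
      then have "x \<notin> verts D" if "x \<in> verts C" for x using eqI[OF C(2) D(2) that] by metis
      then show "S \<inter> T = {}" unfolding C(1) D(1) by blast
    qed
    then have disj: "S \<inter> T = {}" if "S \<in> verts ` ?\<C>" "T \<in> verts ` ?\<C>" "S \<noteq> T" for S T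
      using that unfolding disjoint_def by blast
    fix S T x y assume S: "S \<in> verts ` ?\<C>" and T: "T \<in> verts ` ?\<C>" "S \<noteq> T" and x: "x \<in> S" and y: "y \<in> T"
    have "\<not> (e \<in> edges K \<and> uends K e = {x, y})" for e
    proof
      assume e: "e \<in> edges K \<and> uends K e = {x, y}"
      then have xy: "joined K x y" using joined_edge[OF K, of e x y] by simp
      obtain z where z: "S = verts (component K z)" using S by blast
      then have "y \<in> S" using xy x by (auto intro: joined_trans)
      then show False using disj S T y by blast
    qed
    then have "{e \<in> edges K. uends K e = {x, y}} = {}" by blast
    then have "card {e \<in> edges K. uends K e = {x, y}} = 0" by (simp only: card.empty)
    moreover have "x \<noteq> y" using disj S T x y by blast
    ultimately show "adj K x y = 0" by (simp add: adj_def)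
  qed
  also have "\<dots> = (\<Prod>C\<in>?\<C>. Det (verts C) (adj K))" using inj by (simp add: prod.reindex)
  also have "\<dots> = (\<Prod>C\<in>?\<C>. Det (verts C) (adj C))"
  proof (rule prod.cong[OF refl], rule Det_cong[OF refl])
    fix C x y assume C: "C \<in> ?\<C>" and xy: "x \<in> verts C" "y \<in> verts C"
    obtain z where z: "C = component K z" using C by blast
    have "{e \<in> edges C. uends C e = {x, y}} = {e \<in> edges K. uends K e = {x, y}}" if "x \<in> verts C" "y \<in> verts C" for x y
      using that by (auto simp: z)
    then show "adj K x y = adj C x y" using xy by (force simp: adj_def)
  qed
  finally show ?thesis unfolding union .
qed

lemma card_filter_nth:
  assumes "distinct es"
  shows "card {e \<in> set es. P e} = card {i. i < length es \<and> P (es ! i)}"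
proof -
  have "bij_betw ((!) es) {i. i < length es \<and> P (es ! i)} {e \<in> set es. P e}"
    using assms by (auto simp: bij_betw_def inj_on_def nth_eq_iff_index_eq in_set_conv_nth)
  then show ?thesis by (simp add: bij_betw_same_card)
qed

lemma Det_path_graph:
  assumes "is_path_graph C"
  shows "Det (verts C) (adj C) = (if odd (card (edges C)) then (-1) ^ ((card (edges C) + 1) div 2) else 0)"
    and "card (verts C) = card (edges C) + 1"
proof -
  obtain us es where p: "distinct us" "distinct es" "set us = verts C" "set es = edges C"
    "length us = Suc (length es)" "\<And>i. i < length es \<Longrightarrow> uends C (es ! i) = {us ! i, us ! Suc i}"
    using assms unfolding is_path_graph_def by blast
  have cards: "card (verts C) = length us" "card (edges C) = length es"
    using p(1-4) by (metis distinct_card)+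
  then show "card (verts C) = card (edges C) + 1" using p(5) by simp
  have cnt: "card {e \<in> edges C. uends C e = {us ! a, us ! b}} = card {i. i < length es \<and> {i, Suc i} = {a, b}}"
    if "a < length us" "b < length us" for a b
  proof -
    have "{us ! i, us ! Suc i} = {us ! a, us ! b} \<longleftrightarrow> {i, Suc i} = {a, b}" if "i < length es" for i
      using p(1,5) that \<open>a < length us\<close> \<open>b < length us\<close> by (simp add: doubleton_eq_iff nth_eq_iff_index_eq)
    then have "uends C (es ! i) = {us ! a, us ! b} \<longleftrightarrow> {i, Suc i} = {a, b}" if "i < length es" for i
      unfolding p(6)[OF that] using that by blast
    then have "{i. i < length es \<and> uends C (es ! i) = {us ! a, us ! b}} = {i. i < length es \<and> {i, Suc i} = {a, b}}"
      by (intro Collect_cong conj_cong refl)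
    then show ?thesis using card_filter_nth[OF p(2), of "\<lambda>e. uends C e = {us ! a, us ! b}"] by (simp add: p(4))
  qed
  have "Det (set us) (adj C) = (if even (length us) then (-1) ^ (length us div 2) else 0)"
  proof (rule Det_path[OF p(1)])
    fix a b assume ab: "a < length us" "b < length us"
    have idx: "{i. i < length es \<and> {i, Suc i} = {c, d}} = (if d = Suc c then {c} else if c = Suc d then {d} else {})"
      if "c < length us" "d < length us" for c d
      using that p(5) by (auto simp: doubleton_eq_iff)
    have eq: "us ! a = us ! b \<longleftrightarrow> a = b" using ab p(1) by (simp add: nth_eq_iff_index_eq)
    show "adj C (us ! a) (us ! b) = (if b = Suc a \<or> a = Suc b then 1 else 0)"
    proof (cases "a = b")
      case True
      have "card {e \<in> edges C. uends C e = {us ! a, us ! a}} = 0"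
        unfolding cnt[OF ab(1) ab(1)] idx[OF ab(1) ab(1)] by simp
      then show ?thesis using True by (simp add: adj_def)
    next
      case False
      have "adj C (us ! a) (us ! b) = real (card {e \<in> edges C. uends C e = {us ! a, us ! b}})"
        using False eq by (simp add: adj_def)
      then show ?thesis unfolding cnt[OF ab] idx[OF ab] by simp
    qed
  qed
  then show "Det (verts C) (adj C) = (if odd (card (edges C)) then (-1) ^ ((card (edges C) + 1) div 2) else 0)"
    using p(5) by (simp add: p(3) cards)
qed

text \<open>A loop and two parallel edges, which are the cycles of length \<open>1\<close> and \<open>2\<close>, have an entry \<open>2\<close> in their
matrices and are treated separately; the general formula holds for them as well.\<close>

lemma Det_cycle_graph:
  assumes "is_cycle_graph C"
  shows "Det (verts C) (adj C) = (if odd (card (edges C)) then 2 else - 2 * (1 - (-1) ^ (card (edges C) div 2)))"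
    and "card (verts C) = card (edges C)"
proof -
  obtain us es where p: "us \<noteq> []" "distinct us" "distinct es" "set us = verts C" "set es = edges C"
    "length us = length es" "\<And>i. i < length es \<Longrightarrow> uends C (es ! i) = {us ! i, us ! (Suc i mod length us)}"
    using assms unfolding is_cycle_graph_def by blast
  define L where "L = length us"
  have L: "0 < L" "length es = L" using p(1,6) by (auto simp: L_def)
  have cards: "card (verts C) = L" "card (edges C) = L"
    using p(2-6) by (metis L_def distinct_card)+
  then show "card (verts C) = card (edges C)" by simp
  have cnt: "card {e \<in> edges C. uends C e = {us ! a, us ! b}} = card {i. i < L \<and> {i, Suc i mod L} = {a, b}}"
    if "a < L" "b < L" for a b
  proof -
    have "{us ! i, us ! (Suc i mod L)} = {us ! a, us ! b} \<longleftrightarrow> {i, Suc i mod L} = {a, b}" if "i < L" for i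
      using p(2) that \<open>a < L\<close> \<open>b < L\<close> L(1) by (simp add: doubleton_eq_iff nth_eq_iff_index_eq L_def[symmetric])
    then have "uends C (es ! i) = {us ! a, us ! b} \<longleftrightarrow> {i, Suc i mod L} = {a, b}" if "i < L" for i
      unfolding p(7)[unfolded L(2) L_def[symmetric], OF that] using that by blast
    then have "{i. i < length es \<and> uends C (es ! i) = {us ! a, us ! b}} = {i. i < L \<and> {i, Suc i mod L} = {a, b}}"
      unfolding L(2) by (intro Collect_cong conj_cong refl)
    then show ?thesis using card_filter_nth[OF p(3), of "\<lambda>e. uends C e = {us ! a, us ! b}"] by (simp add: p(5))
  qed
  have eq: "us ! a = us ! b \<longleftrightarrow> a = b" if "a < L" "b < L" for a b
    using that p(2) by (simp add: nth_eq_iff_index_eq L_def)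
  consider "L = 1" | "L = 2" | "3 \<le> L" using L(1) by linarith
  then have "Det (set us) (adj C) = (if odd L then 2 else - 2 * (1 - (-1) ^ (L div 2)))"
  proof cases
    case 1
    then obtain x where us: "us = [x]" by (auto simp: L_def length_Suc_conv)
    have "{i. i < L \<and> {i, Suc i mod L} = {0, 0}} = {0}" using 1 by auto
    then have "adj C x x = 2" using cnt[of 0 0] 1 by (simp add: us adj_def)
    then show ?thesis using 1 by (simp add: us)
  next
    case 2
    then obtain x y where us: "us = [x, y]" by (auto simp: L_def length_Suc_conv numeral_2_eq_2)
    have xy: "x \<noteq> y" using p(2) by (simp add: us)
    have "{i. i < L \<and> {i, Suc i mod L} = {0, 1}} = {0, 1}" "{i. i < L \<and> {i, Suc i mod L} = {0, 0}} = {}"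
      using 2 by (auto simp: less_2_cases_iff doubleton_eq_iff)
    then have "adj C x y = 2" "adj C x x = 0"
      using cnt[of 0 1] cnt[of 0 0] 2 xy by (simp_all add: us adj_def)
    moreover have "adj C y x = adj C x y" by (simp add: adj_def insert_commute)
    ultimately have "Det (insert x (insert y {})) (adj C) = - 4"
      using xy by (subst Det_pendant) auto
    then show ?thesis using 2 by (simp add: us)
  next
    case 3
    have "cycle_matrix us (adj C)"
      unfolding cycle_matrix_def
    proof (intro conjI allI impI)
      fix a b assume "a < length us" "b < length us"
      then have ab: "a < L" "b < L" by (simp_all add: L_def)
      show "adj C (us ! a) (us ! b) = (if b = Suc a mod length us \<or> a = Suc b mod length us then 1 else 0)"
        unfolding L_def[symmetric]
      proof (cases "a = b")
        case True
        have "{i. i < L \<and> {i, Suc i mod L} = {a, a}} = {}"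
          using 3 by (auto simp: doubleton_eq_iff Suc_mod_eq split: if_splits)
        then have "card {e \<in> edges C. uends C e = {us ! a, us ! a}} = 0"
          unfolding cnt[OF ab(1) ab(1)] by (simp only: card.empty)
        moreover have "Suc a mod L \<noteq> a" using ab 3 by (auto simp: Suc_mod_eq split: if_splits)
        ultimately show "adj C (us ! a) (us ! b) = (if b = Suc a mod L \<or> a = Suc b mod L then 1 else 0)"
          using True by (simp add: adj_def)
      next
        case False
        have idx: "{i. i < L \<and> {i, Suc i mod L} = {a, b}} =
            (if b = Suc a mod L then {a} else if a = Suc b mod L then {b} else {})"
        proof (rule Set.set_eqI)
          fix i
          have "Suc a mod L = b \<Longrightarrow> Suc b mod L \<noteq> a"
            using ab 3 by (auto simp: Suc_mod_eq split: if_splits)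
          then show "i \<in> {i. i < L \<and> {i, Suc i mod L} = {a, b}} \<longleftrightarrow>
              i \<in> (if b = Suc a mod L then {a} else if a = Suc b mod L then {b} else {})"
            using ab by (auto simp: doubleton_eq_iff)
        qed
        have "adj C (us ! a) (us ! b) = real (card {e \<in> edges C. uends C e = {us ! a, us ! b}})"
          using False eq[OF ab] by (simp add: adj_def)
        then show "adj C (us ! a) (us ! b) = (if b = Suc a mod L \<or> a = Suc b mod L then 1 else 0)"
          unfolding cnt[OF ab] idx by simp
      qed
    qed (use p(2) 3 in \<open>simp_all add: L_def\<close>)
    then have det: "Det (set us) (adj C) = 2 * (-1) ^ (L - 1) - (if even L then 2 * (-1) ^ (L div 2 - 1) else 0)"
      unfolding L_def by (rule Det_long_cycle)
    show ?thesis
    proof (cases "even L")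
      case True
      then obtain k where k: "L = 2 * k" by (elim evenE)
      then obtain j where "k = Suc j" using L(1) by (cases k) auto
      then show ?thesis using det by (simp add: k)
    next
      case False
      then show ?thesis using det by simp
    qed
  qed
  then show "Det (verts C) (adj C) = (if odd (card (edges C)) then 2 else - 2 * (1 - (-1) ^ (card (edges C) div 2)))"
    by (simp add: p(4) cards)
qed


section \<open>The determinant formula\<close>

definition path_det :: "nat \<Rightarrow> real" where
  "path_det t = (if odd t then (-1) ^ ((t + 1) div 2) else 0)"

definition cycle_det :: "nat \<Rightarrow> real" where
  "cycle_det t = (if odd t then 2 else - 2 * (1 - (-1) ^ (t div 2)))"

text \<open>A path has one vertex more than edges and a cycle has as many vertices as edges. This gives the number
of vertices of the cover, and it shows that no mixed component has both properties.\<close>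

lemma det_integrated_components:
  assumes G: "mixed_graph G" and vs: "distinct vs" "set vs = verts G"
    and props: "\<forall>K\<in>#mixed_components G. AP_property K \<or> AC_property K"
  shows "det (integrated_adjacency_matrix G vs) = prod_mset (image_mset
      (\<lambda>K. if AP_property K then path_det (t_number K) else cycle_det (t_number K)) (mixed_components G))"
    and "2 * card (verts G) = sum_mset (image_mset
      (\<lambda>K. if AP_property K then t_number K + 1 else t_number K) (mixed_components G))"
    and "\<forall>K\<in>#mixed_components G. \<not> (AP_property K \<and> AC_property K)"
proof -
  let ?\<C> = "cover_components G"
  have fin: "finite ?\<C>" using G by (rule finite_cover_components)
  have mc: "mixed_components G = image_mset (shadow G) (mset_set ?\<C>)" using G by (rule mixed_components_eq)
  have elems: "shadow G C \<in># mixed_components G" if "C \<in> ?\<C>" for C using that fin by (simp add: mc)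
  have path: "is_path_graph C" "card (edges C) = t_number (shadow G C)"
    if "C \<in> ?\<C>" "AP_property (shadow G C)" for C
    using that AP_component_is_path[OF G] by (auto simp: cover_components_def simp del: cover_simps)
  have cycle: "is_cycle_graph C" "card (edges C) = t_number (shadow G C)"
    if "C \<in> ?\<C>" "AC_property (shadow G C)" for C
    using that AC_component_is_cycle[OF G] by (auto simp: cover_components_def simp del: cover_simps)
  have both: "\<not> (AP_property (shadow G C) \<and> AC_property (shadow G C))" if C: "C \<in> ?\<C>" for C
    using path(1)[OF C] cycle(1)[OF C] Det_path_graph(2)[of C] Det_cycle_graph(2)[of C] by fastforce
  then show "\<forall>K\<in>#mixed_components G. \<not> (AP_property K \<and> AC_property K)" using fin by (simp add: mc)
  have AC: "AC_property (shadow G C)" if "C \<in> ?\<C>" "\<not> AP_property (shadow G C)" for C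
    using props elems[OF that(1)] that(2) by blast
  have "det (integrated_adjacency_matrix G vs) = (\<Prod>C\<in>?\<C>. Det (verts C) (adj C))"
    unfolding det_integrated[OF G vs] Det_components[OF mixed_graph_cover[OF G]] cover_components_def ..
  also have "\<dots> = (\<Prod>C\<in>?\<C>. if AP_property (shadow G C) then path_det (t_number (shadow G C))
      else cycle_det (t_number (shadow G C)))"
  proof (rule prod.cong[OF refl])
    fix C assume C: "C \<in> ?\<C>"
    show "Det (verts C) (adj C) = (if AP_property (shadow G C) then path_det (t_number (shadow G C))
      else cycle_det (t_number (shadow G C)))"
      using Det_path_graph(1)[OF path(1)[OF C]] path(2)[OF C] Det_cycle_graph(1)[OF cycle(1)[OF C]] cycle(2)[OF C] AC[OF C]
      by (simp add: path_det_def cycle_det_def)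
  qed
  also have "\<dots> = prod_mset (image_mset
      (\<lambda>K. if AP_property K then path_det (t_number K) else cycle_det (t_number K)) (mixed_components G))"
    by (simp add: mc prod_unfold_prod_mset multiset.map_comp comp_def)
  finally show "det (integrated_adjacency_matrix G vs) = prod_mset (image_mset
      (\<lambda>K. if AP_property K then path_det (t_number K) else cycle_det (t_number K)) (mixed_components G))" .
  have union: "\<Union>(verts ` ?\<C>) = verts (cover G)"
  proof
    show "\<Union>(verts ` ?\<C>) \<subseteq> verts (cover G)"
    proof (rule UN_least)
      fix C assume "C \<in> ?\<C>"
      then obtain z where "z \<in> verts (cover G)" "C = cover_component G z"
        unfolding cover_components_def by blast
      then show "verts C \<subseteq> verts (cover G)"
        using submixed_component[OF mixed_graph_cover[OF G]] unfolding submixed_def by blast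
    qed
    show "verts (cover G) \<subseteq> \<Union>(verts ` ?\<C>)"
    proof
      fix z assume z: "z \<in> verts (cover G)"
      then have "z \<in> verts (cover_component G z)" by (simp add: joined_refl del: cover_simps)
      then show "z \<in> \<Union>(verts ` ?\<C>)" unfolding cover_components_def using z by blast
    qed
  qed
  have "2 * card (verts G) = card (verts (cover G))" by (simp add: card_cartesian_product)
  also have "\<dots> = card (\<Union>(verts ` ?\<C>))" unfolding union ..
  also have "\<dots> = (\<Sum>C\<in>?\<C>. card (verts C))"
  proof (rule card_UN_disjoint[OF fin])
    have "finite (verts (cover G))" using G by (simp add: mixed_graph_def)
    then show "\<forall>C\<in>?\<C>. finite (verts C)" using union by (metis UN_upper finite_subset)
    show "\<forall>C\<in>?\<C>. \<forall>D\<in>?\<C>. C \<noteq> D \<longrightarrow> verts C \<inter> verts D = {}"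
    proof (intro ballI impI)
      fix C D assume C: "C \<in> ?\<C>" and D: "D \<in> ?\<C>" and ne: "C \<noteq> D"
      obtain z z' where "C = cover_component G z" "D = cover_component G z'"
        using C D unfolding cover_components_def by blast
      then show "verts C \<inter> verts D = {}" using ne component_eqI by (metis disjoint_iff)
    qed
  qed
  also have "\<dots> = (\<Sum>C\<in>?\<C>. if AP_property (shadow G C) then t_number (shadow G C) + 1 else t_number (shadow G C))"
  proof (rule sum.cong[OF refl])
    fix C assume C: "C \<in> ?\<C>"
    show "card (verts C) = (if AP_property (shadow G C) then t_number (shadow G C) + 1 else t_number (shadow G C))"
      using Det_path_graph(2)[OF path(1)[OF C]] path(2)[OF C] Det_cycle_graph(2)[OF cycle(1)[OF C]] cycle(2)[OF C] AC[OF C]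
      by simp
  qed
  also have "\<dots> = sum_mset (image_mset
      (\<lambda>K. if AP_property K then t_number K + 1 else t_number K) (mixed_components G))"
    by (simp add: mc sum_unfold_sum_mset multiset.map_comp comp_def)
  finally show "2 * card (verts G) = sum_mset (image_mset
      (\<lambda>K. if AP_property K then t_number K + 1 else t_number K) (mixed_components G))" .
qed

lemma minus_one_powi: "(-1 :: real) powi (int a - int b) = (-1) ^ (a + b)"
  by (auto simp: power_int_minus_left minus_one_power_iff)

lemma even_sum_mset: "(\<And>x. x \<in># M \<Longrightarrow> even (f x)) \<Longrightarrow> even (sum_mset (image_mset f M))" for f :: "_ \<Rightarrow> nat"
  by (induction M) auto

lemma even_sum_mset_odd:
  "(\<And>x. x \<in># M \<Longrightarrow> odd (f x)) \<Longrightarrow> even (sum_mset (image_mset f M)) \<longleftrightarrow> even (size M)" for f :: "_ \<Rightarrow> nat"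
  by (induction M) auto

lemma prod_mset_constant:
  "(\<And>x. x \<in># M \<Longrightarrow> f x = c) \<Longrightarrow> prod_mset (image_mset f M) = c ^ size M"
  by (induction M) auto

theorem theorem7p1:
  fixes G :: "('v, 'e, 'a) mixed_graph"
    and vs :: "'v list"
    and F H :: "nat \<Rightarrow> ('v, 'e, 'a) mixed_graph"
    and n p q l :: nat
  assumes "mixed_graph G"
    and "distinct vs" and "set vs = verts G" and "n = card (verts G)"
    and "\<forall>K \<in># mixed_components G. AP_property K \<or> AC_property K"
    and "image_mset F (mset_set {1..q}) = {#K \<in># mixed_components G. AP_property K#}"
    and "image_mset H (mset_set {1..l}) =
           {#K \<in># mixed_components G. AC_property K \<and> even (t_number K)#}"
    and "p = size {#K \<in># mixed_components G. AC_property K#}"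
  shows "det (integrated_adjacency_matrix G vs) =
    (if \<forall>i\<in>{1..q}. odd (t_number (F i))
     then 2 ^ p * (-1) powi (2 * int n - int p - (\<Sum>i=1..q. int ((t_number (F i) + 1) div 2))) *
       (\<Sum>S\<in>Pow {1..l}. (-1) powi (int (card S) - (\<Sum>i\<in>S. int (t_number (H i) div 2))))
     else 0)"
proof -
  define \<delta> where "\<delta> K = (if AP_property K then path_det (t_number K) else cycle_det (t_number K))"
    for K :: "('v, 'e, 'a) mixed_graph"
  define \<nu> where "\<nu> K = (if AP_property K then t_number K + 1 else t_number K)"
    for K :: "('v, 'e, 'a) mixed_graph"
  note parts = det_integrated_components[OF assms(1,2,3,5)]
  let ?M = "mixed_components G"
  \<comment> \<open>The paths, the even cycles and the odd cycles.\<close>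
  define P where "P = {#K \<in># ?M. AP_property K#}"
  define E where "E = {#K \<in># ?M. AC_property K \<and> even (t_number K)#}"
  define Q where "Q = {#K \<in># ?M. AC_property K \<and> odd (t_number K)#}"
  have AC_eq: "{#K \<in># ?M. AC_property K#} = {#K \<in># ?M. \<not> AP_property K#}"
    using assms(5) parts(3) by (intro filter_mset_cong) auto
  have AC_split: "{#K \<in># ?M. AC_property K#} = E + Q"
    unfolding E_def Q_def using multiset_partition[of "{#K \<in># ?M. AC_property K#}" "\<lambda>K. even (t_number K)"]
    by (simp add: filter_filter_mset conj_commute)
  have M: "?M = P + (E + Q)"
    unfolding AC_split[symmetric] AC_eq P_def by (rule multiset_partition)
  have in_P: "AP_property K" if "K \<in># P" for K using that by (simp add: P_def)
  have in_E: "\<not> AP_property K \<and> even (t_number K)" if "K \<in># E" for K using that parts(3) by (auto simp: E_def)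
  have in_Q: "\<not> AP_property K \<and> odd (t_number K)" if "K \<in># Q" for K using that parts(3) by (auto simp: Q_def)
  have P: "P = image_mset F (mset_set {1..q})" and E: "E = image_mset H (mset_set {1..l})"
    using assms(6,7) by (simp_all add: P_def E_def)
  define r where "r = size Q"
  have p: "p = l + r" using assms(8) by (simp add: AC_split E r_def)
  have F_AP: "AP_property (F i)" if "i \<in> {1..q}" for i using that in_P[of "F i"] by (simp add: P)
  have H_E: "\<not> AP_property (H i) \<and> even (t_number (H i))" if "i \<in> {1..l}" for i
    using that in_E[of "H i"] by (simp add: E)
  have det: "det (integrated_adjacency_matrix G vs) =
      prod_mset (image_mset \<delta> P) * (prod_mset (image_mset \<delta> E) * prod_mset (image_mset \<delta> Q))"
    using parts(1) unfolding \<delta>_def[symmetric] by (subst (asm) M) simp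
  have prod_P: "prod_mset (image_mset \<delta> P) = (\<Prod>i=1..q. path_det (t_number (F i)))"
    using F_AP by (simp add: P multiset.map_comp comp_def prod_unfold_prod_mset[symmetric] \<delta>_def)
  have "prod_mset (image_mset \<delta> E) = (\<Prod>i=1..l. cycle_det (t_number (H i)))"
    using H_E by (simp add: E multiset.map_comp comp_def prod_unfold_prod_mset[symmetric] \<delta>_def)
  \<comment> \<open>The bracket is put into the form in which its product expands to the sum over subsets.\<close>
  also have "\<dots> = (\<Prod>i=1..l. - 2 * ((-1) ^ (1 + t_number (H i) div 2) + 1))"
    using H_E by (intro prod.cong) (auto simp: cycle_det_def)
  also have "\<dots> = (- 2) ^ l * (\<Sum>S\<in>Pow {1..l}. \<Prod>i\<in>S. (-1) ^ (1 + t_number (H i) div 2))"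
    unfolding prod.distrib by (subst prod_add) simp_all
  finally have prod_E: "prod_mset (image_mset \<delta> E) =
      (- 2) ^ l * (\<Sum>S\<in>Pow {1..l}. \<Prod>i\<in>S. (-1) ^ (1 + t_number (H i) div 2))" .
  have prod_Q: "prod_mset (image_mset \<delta> Q) = 2 ^ r"
    unfolding r_def using in_Q by (intro prod_mset_constant) (auto simp: \<delta>_def cycle_det_def)
  show ?thesis
  proof (cases "\<forall>i\<in>{1..q}. odd (t_number (F i))")
    case False
    then obtain i where "i \<in> {1..q}" "even (t_number (F i))" by blast
    then have "(\<Prod>i=1..q. path_det (t_number (F i))) = 0"
      by (intro prod_zero) (auto simp: path_det_def)
    then show ?thesis using False by (simp only: det prod_P if_False mult_zero_left)
  next
    case True
    define s where "s = (\<Sum>i=1..q. (t_number (F i) + 1) div 2)"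
    have "(\<Prod>i=1..q. path_det (t_number (F i))) = (\<Prod>i=1..q. (-1) ^ ((t_number (F i) + 1) div 2))"
      using True by (intro prod.cong) (auto simp: path_det_def)
    then have prod_P': "prod_mset (image_mset \<delta> P) = (-1) ^ s" by (simp add: prod_P s_def power_sum)
    \<comment> \<open>Counting the vertices of the cover modulo two shows that the number of odd cycles is even.\<close>
    have "2 * n = sum_mset (image_mset \<nu> P) + (sum_mset (image_mset \<nu> E) + sum_mset (image_mset \<nu> Q))"
      using parts(2) unfolding \<nu>_def[symmetric] assms(4) by (subst (asm) M) simp
    moreover have "even (sum_mset (image_mset \<nu> P))"
      using True in_P by (intro even_sum_mset) (auto simp: P \<nu>_def)
    moreover have "even (sum_mset (image_mset \<nu> E))"
      using in_E by (intro even_sum_mset) (auto simp: \<nu>_def)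
    moreover have "even (sum_mset (image_mset \<nu> Q)) \<longleftrightarrow> even r"
      unfolding r_def using in_Q by (intro even_sum_mset_odd) (auto simp: \<nu>_def)
    ultimately have even_o: "even r" by (metis dvd_triv_left even_add)
    have "2 * int n - int p - (\<Sum>i=1..q. int ((t_number (F i) + 1) div 2)) = int (2 * n) - int (p + s)"
      by (simp add: s_def)
    then have "(-1 :: real) powi (2 * int n - int p - (\<Sum>i=1..q. int ((t_number (F i) + 1) div 2))) = (-1) ^ (2 * n + (p + s))"
      by (simp only: minus_one_powi)
    also have "\<dots> = (-1) ^ (l + s)" using even_o by (simp add: p power_add)
    finally have sign: "(-1 :: real) powi (2 * int n - int p - (\<Sum>i=1..q. int ((t_number (F i) + 1) div 2))) = (-1) ^ (l + s)" .
    have subset: "(-1 :: real) powi (int (card S) - (\<Sum>i\<in>S. int (t_number (H i) div 2))) =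
        (\<Prod>i\<in>S. (-1) ^ (1 + t_number (H i) div 2))" if "S \<in> Pow {1..l}" for S
    proof -
      have "(\<Sum>i\<in>S. int (t_number (H i) div 2)) = int (\<Sum>i\<in>S. t_number (H i) div 2)" by simp
      then have "(-1 :: real) powi (int (card S) - (\<Sum>i\<in>S. int (t_number (H i) div 2))) =
          (-1) ^ (card S + (\<Sum>i\<in>S. t_number (H i) div 2))" by (simp only: minus_one_powi)
      also have "card S + (\<Sum>i\<in>S. t_number (H i) div 2) = (\<Sum>i\<in>S. 1 + t_number (H i) div 2)"
        by (simp only: sum.distrib card_eq_sum)
      finally show ?thesis by (simp only: power_sum)
    qed
    have "(-2 :: real) ^ l = (-1) ^ l * 2 ^ l" by (simp flip: power_mult_distrib)
    then have "det (integrated_adjacency_matrix G vs) = 2 ^ p * (-1) ^ (l + s) *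
        (\<Sum>S\<in>Pow {1..l}. \<Prod>i\<in>S. (-1) ^ (1 + t_number (H i) div 2))"
      unfolding det prod_P' prod_E prod_Q p power_add by (simp only: mult_ac)
    moreover have "(\<Sum>S\<in>Pow {1..l}. (-1 :: real) powi (int (card S) - (\<Sum>i\<in>S. int (t_number (H i) div 2)))) =
        (\<Sum>S\<in>Pow {1..l}. \<Prod>i\<in>S. (-1) ^ (1 + t_number (H i) div 2))"
      using subset by (rule sum.cong[OF refl])
    ultimately show ?thesis unfolding sign if_P[OF True] by simp
  qed
qed

end
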